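(* Let $n,k,l$ be integers with $1\le l<k\le n$ and $k-l\in\{1,2\}$, let $0<\delta<1/2$, and let $F(\lambda)=\sigma_k(\lambda)/\sigma_l(\lambda)$. There exist constants $A=A(n,k,l,\delta)\ge 2$ and $K=K(n,k,l,\delta)\ge 1$ such that the following holds. Whenever $\lambda\in\mathbb{R}^n$ satisfies $$\lambda_1=\lambda_2=\cdots=\lambda_m=:\lambda_{\max}>\lambda_{m+1}\ge\cdots\ge\lambda_n\ge 0,\qquad \sigma_k(\lambda)>0$$ for some integer $1\le m\le n$, and $$\lambda_{\max}\ge A\,F(\lambda)^{1/(k-l)},$$ we have $$-\sum_{i,j=1}^n F_{ij}\xi_i\xi_j+\frac{K}{F}\Big(\sum_{i=1}^n F_i\xi_i\Big)^2+\sum_{i>m}\frac{2F_i\xi_i^2}{\lambda_{\max}-\lambda_i}\ \ge\ (1+\delta)\frac{F_1\xi_1^2}{\lambda_{\max}}$$ for every $\xi\in\mathbb{R}^n$ satisfying $\xi_1=\xi_2=\cdots=\xi_m$, where $F$, $F_i$, $F_{ij}$ are evaluated at $\lambda$. When $m=n$, the terms involving $\lambda_{m+1}$ and the sums over $i>m$ are understood to be omitted.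
   Context: For $\lambda=(\lambda_1,\dots,\lambda_n)\in\mathbb{R}^n$, $\sigma_j(\lambda)$ denotes the $j$-th elementary symmetric function of $\lambda_1,\dots,\lambda_n$, with $\sigma_0=1$. $F_i=\partial F/\partial\lambda_i$ and $F_{ij}=\partial^2F/\partial\lambda_i\partial\lambda_j$ denote derivatives with respect to the eigenvalue variables. (If $\lambda$ has nonnegative entries and $\sigma_k(\lambda)>0$, then $\sigma_l(\lambda)>0$, so $F$ is smooth near $\lambda$.) *)

theory Defs
  imports "HOL-Analysis.Analysis"
begin

text \<open>A point of \<open>\<real>\<^sup>n\<close> is a function \<open>nat \<Rightarrow> real\<close> of which only the coordinates in \<open>{1..n}\<close> matter:
  \<open>esym n j\<close> does not depend on the others. This keeps the order of the coordinates available.\<close>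

definition esym :: "nat \<Rightarrow> nat \<Rightarrow> (nat \<Rightarrow> real) \<Rightarrow> real" where
  "esym n j x = (\<Sum>S | S \<subseteq> {1..n} \<and> card S = j. \<Prod>i\<in>S. x i)"

definition sigma_quot :: "nat \<Rightarrow> nat \<Rightarrow> nat \<Rightarrow> (nat \<Rightarrow> real) \<Rightarrow> real" where
  "sigma_quot n k l x = esym n k x / esym n l x"

definition pderiv1 :: "nat \<Rightarrow> ((nat \<Rightarrow> real) \<Rightarrow> real) \<Rightarrow> (nat \<Rightarrow> real) \<Rightarrow> real" where
  "pderiv1 i f x = deriv (\<lambda>t. f (x(i := t))) (x i)"

definition pderiv2 :: "nat \<Rightarrow> nat \<Rightarrow> ((nat \<Rightarrow> real) \<Rightarrow> real) \<Rightarrow> (nat \<Rightarrow> real) \<Rightarrow> real" where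
  "pderiv2 i j f = pderiv1 i (pderiv1 j f)"

end

theory Submission
  imports Defs "HOL-Computational_Algebra.Formal_Power_Series"
begin

text \<open>Let \<open>\<lambda>\<^sub>1 \<ge> \<dots> \<ge> \<lambda>\<^sub>n\<close>. If \<open>\<lambda>\<^sub>1, \<dots>, \<lambda>\<^sub>k\<close> are comparable, then \<open>F\<close> is bounded from below by a multiple of
  \<open>\<lambda>\<^sub>1\<^sup>k\<^sup>-\<^sup>l\<close>, which the hypothesis on \<open>\<lambda>\<^sub>m\<^sub>a\<^sub>x\<close> excludes for large \<open>A\<close>. So there is a last index \<open>s < k\<close> at which
  \<open>\<lambda>\<^sub>s\<^sub>+\<^sub>1 / \<lambda>\<^sub>s\<close> is small, and \<open>\<lambda>\<^sub>s\<^sub>+\<^sub>1, \<dots>, \<lambda>\<^sub>k\<close> are comparable.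

  In the variables \<open>1 / \<lambda>\<^sub>i\<close> for \<open>i \<le> s\<close> and \<open>\<lambda>\<^sub>i\<close> for \<open>i > s\<close>, up to scale, \<open>F\<close> becomes a quotient that extends
  smoothly to \<open>1 / \<lambda>\<^sub>i = 0\<close>, and the new coordinates range over a compact set. The second derivative of \<open>F\<close> along a
  line in the new variables differs from its Hessian by \<open>2 \<Sum> F\<^sub>i \<xi>\<^sub>i\<^sup>2 / \<lambda>\<^sub>i\<close> over \<open>i \<le> s\<close>, which has the right
  sign and contains twice \<open>F\<^sub>1 \<xi>\<^sub>1\<^sup>2 / \<lambda>\<^sub>1\<close>. It therefore suffices to show that the limiting form on the
  boundary is positive; by compactness this persists nearby. For \<open>s \<le> k - 2\<close> the limit is \<open>\<sigma>\<^sub>a / \<sigma>\<^sub>b\<close> in the small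
  variables, which is strictly concave up to the radial direction. For \<open>s = k - 1\<close> the limit is
  not; there the \<open>1 / \<lambda>\<^sub>i\<close> are rescaled to have sum \<open>1\<close>, and the terms of next order in \<open>t = \<Sum> \<lambda>\<^sub>k / \<lambda>\<^sub>i\<close> over \<open>i \<le> s\<close> decide.\<close>

unbundle no vec_syntax
unbundle fps_syntax

subsection \<open>Elementary symmetric functions\<close>

text \<open>The order \<open>j\<close> is an integer, so that the recursions hold without exception when \<open>j - 1 < 0\<close>.\<close>
definition es :: "'i set \<Rightarrow> int \<Rightarrow> ('i \<Rightarrow> 'a::comm_semiring_1) \<Rightarrow> 'a" where
  "es I j x = (\<Sum>S | S \<subseteq> I \<and> int (card S) = j. \<Prod>i\<in>S. x i)"

lemma esym_eq_es: "esym n j x = es {1..n} (int j) x"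
  by (simp add: esym_def es_def)

lemma es_cong: "(\<And>i. i \<in> I \<Longrightarrow> x i = y i) \<Longrightarrow> es I j x = es I j y"
  unfolding es_def by (intro sum.cong prod.cong) auto

lemma es_neg: "j < 0 \<Longrightarrow> es I j x = 0"
  unfolding es_def by (intro sum.neutral) auto

lemma es_gt_card:
  assumes "finite I" "int (card I) < j"
  shows "es I j x = 0"
proof -
  have "int (card S) \<noteq> j" if "S \<subseteq> I" for S
    using card_mono[OF assms(1) that] assms(2) by linarith
  then show ?thesis unfolding es_def by (intro sum.neutral) blast
qed

lemma es_0 [simp]:
  assumes "finite I"
  shows "es I 0 x = 1"
proof -
  have "{S. S \<subseteq> I \<and> int (card S) = 0} = {{}}"
    using assms by (auto simp: card_eq_0_iff dest: finite_subset)
  then show ?thesis by (simp add: es_def)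
qed

lemma es_empty [simp]: "es {} j x = of_bool (j = 0)"
  using es_neg[of j "{}" x] es_gt_card[of "{}" j x] by (cases "j = 0") force+

lemma es_insert:
  assumes "finite I" "a \<notin> I"
  shows "es (insert a I) j x = x a * es I (j - 1) x + es I j x"
proof -
  let ?A = "{S. S \<subseteq> I \<and> int (card S) = j}" and ?B = "{S. S \<subseteq> I \<and> int (card S) = j - 1}"
  have split: "{S. S \<subseteq> insert a I \<and> int (card S) = j} = ?A \<union> insert a ` ?B"
  proof (intro equalityI subsetI)
    fix S assume S: "S \<in> {S. S \<subseteq> insert a I \<and> int (card S) = j}"
    then have fin: "finite S" using assms(1) finite_subset by blast
    show "S \<in> ?A \<union> insert a ` ?B"
    proof (cases "a \<in> S")
      case True
      then have "card S = Suc (card (S - {a}))" using card.remove[OF fin] by blast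
      then have "S - {a} \<in> ?B" using S by auto
      then have "insert a (S - {a}) \<in> insert a ` ?B" by (rule imageI)
      then show ?thesis using True by (simp add: insert_absorb)
    qed (use S in auto)
  next
    fix S assume "S \<in> ?A \<union> insert a ` ?B"
    then show "S \<in> {S. S \<subseteq> insert a I \<and> int (card S) = j}"
      using assms by (auto simp: finite_subset[OF _ assms(1)] card_insert_if)
  qed
  have fin: "finite ?A" "finite ?B" using assms(1) by auto
  have inj: "inj_on (insert a) ?B"
    using assms(2) by (intro inj_onI) (metis Diff_insert_absorb mem_Collect_eq subsetD)
  have "es (insert a I) j x = (\<Sum>S\<in>?A. \<Prod>i\<in>S. x i) + (\<Sum>S\<in>insert a ` ?B. \<Prod>i\<in>S. x i)"
    unfolding es_def split using fin assms(2) by (intro sum.union_disjoint) auto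
  also have "(\<Sum>S\<in>insert a ` ?B. \<Prod>i\<in>S. x i) = (\<Sum>S\<in>?B. \<Prod>i\<in>insert a S. x i)"
    by (simp add: sum.reindex[OF inj])
  also have "\<dots> = (\<Sum>S\<in>?B. x a * (\<Prod>i\<in>S. x i))"
    using assms by (intro sum.cong refl prod.insert) (auto dest: finite_subset)
  finally show ?thesis by (simp add: es_def sum_distrib_left add.commute)
qed

lemma es_remove:
  assumes "finite I" "a \<in> I"
  shows "es I j x = x a * es (I - {a}) (j - 1) x + es (I - {a}) j x"
  using es_insert[of "I - {a}" a j x] assms by (simp add: insert_absorb)

lemma es_zero_fun:
  assumes "finite I"
  shows "es I j (\<lambda>_. 0) = of_bool (j = 0)"
  using assms by (induction I rule: finite_induct) (auto simp: es_insert)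

lemma es_1: "finite I \<Longrightarrow> es I 1 x = (\<Sum>i\<in>I. x i)"
  by (induction I rule: finite_induct) (auto simp: es_insert)

lemma power2_sum_eq_es_2:
  assumes "finite I"
  shows "(\<Sum>i\<in>I. x i)\<^sup>2 = (\<Sum>i\<in>I. (x i)\<^sup>2) + 2 * es I 2 x"
  using assms
  by (induction I rule: finite_induct) (auto simp: es_insert es_1 power2_sum algebra_simps)

lemma es_scale: "es I j (\<lambda>i. c * x i) = c ^ nat j * es I j x"
proof -
  have "es I j (\<lambda>i. c * x i) = (\<Sum>S | S \<subseteq> I \<and> int (card S) = j. c ^ nat j * (\<Prod>i\<in>S. x i))"
    unfolding es_def by (intro sum.cong) (auto simp: prod.distrib)
  then show ?thesis by (simp add: es_def sum_distrib_left)
qed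

lemma es_Euler:
  fixes x :: "'i \<Rightarrow> 'a::comm_ring_1"
  assumes "finite I"
  shows "(\<Sum>i\<in>I. x i * es (I - {i}) (j - 1) x) = of_int j * es I j x"
  using assms
proof (induction I arbitrary: j rule: finite_induct)
  case (insert a I)
  have "insert a I - {i} = insert a (I - {i})" if "i \<in> I" for i
    using that insert by auto
  then have "(\<Sum>i\<in>I. x i * es (insert a I - {i}) (j - 1) x)
      = (\<Sum>i\<in>I. x a * (x i * es (I - {i}) (j - 1 - 1) x) + x i * es (I - {i}) (j - 1) x)"
    using insert by (intro sum.cong) (auto simp: es_insert algebra_simps)
  also have "\<dots> = x a * (of_int (j - 1) * es I (j - 1) x) + of_int j * es I j x"
    unfolding sum.distrib sum_distrib_left[symmetric] insert.IH ..
  finally show ?case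
    using insert by (simp add: es_insert algebra_simps)
qed auto

lemma es_Un_disjoint:
  assumes "finite L" "finite R" "L \<inter> R = {}"
  shows "es (L \<union> R) m x = (\<Sum>i\<le>card L. es L (int i) x * es R (m - int i) x)"
  using assms
proof (induction L arbitrary: m rule: finite_induct)
  case empty
  then show ?case by simp
next
  case (insert a L)
  let ?c = "card L"
  have "(\<Sum>i\<le>Suc ?c. es (insert a L) (int i) x * es R (m - int i) x)
      = (\<Sum>i\<le>Suc ?c. x a * es L (int i - 1) x * es R (m - int i) x)
        + (\<Sum>i\<le>Suc ?c. es L (int i) x * es R (m - int i) x)"
    using insert by (simp add: es_insert distrib_right sum.distrib)
  also have "(\<Sum>i\<le>Suc ?c. x a * es L (int i - 1) x * es R (m - int i) x)
      = x a * (\<Sum>i\<le>?c. es L (int i) x * es R (m - 1 - int i) x)"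
    by (simp add: sum.atMost_Suc_shift es_neg sum_distrib_left mult.assoc algebra_simps
        del: sum.atMost_Suc)
  also have "(\<Sum>i\<le>Suc ?c. es L (int i) x * es R (m - int i) x)
      = (\<Sum>i\<le>?c. es L (int i) x * es R (m - int i) x)"
    using insert by (simp add: es_gt_card)
  finally show ?case using insert by (simp add: es_insert)
qed

lemma es_reciprocal:
  assumes "finite L" and inv: "\<And>i. i \<in> L \<Longrightarrow> y i * z i = 1"
  shows "es L (int (card L) - j) y = (\<Prod>i\<in>L. y i) * es L j z"
proof -
  have "(\<Prod>i\<in>L. y i) * es L j z = (\<Sum>S | S \<subseteq> L \<and> int (card S) = j. (\<Prod>i\<in>L. y i) * (\<Prod>i\<in>S. z i))"
    by (simp add: es_def sum_distrib_left)
  also have "\<dots> = (\<Sum>S | S \<subseteq> L \<and> int (card S) = j. \<Prod>i\<in>L - S. y i)"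
  proof (intro sum.cong refl)
    fix S assume "S \<in> {S. S \<subseteq> L \<and> int (card S) = j}"
    then have S: "S \<subseteq> L" by simp
    have "(\<Prod>i\<in>L. y i) * (\<Prod>i\<in>S. z i) = (\<Prod>i\<in>L - S. y i) * (\<Prod>i\<in>S. y i * z i)"
      using prod.subset_diff[OF S assms(1), of y] by (simp add: prod.distrib mult.assoc)
    also have "(\<Prod>i\<in>S. y i * z i) = 1"
      using S inv by (intro prod.neutral) auto
    finally show "(\<Prod>i\<in>L. y i) * (\<Prod>i\<in>S. z i) = (\<Prod>i\<in>L - S. y i)" by simp
  qed
  also have "\<dots> = es L (int (card L) - j) y"
    unfolding es_def using assms(1)
    by (intro sum.reindex_bij_witness[of _ "\<lambda>S. L - S" "\<lambda>S. L - S"])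
       (auto simp: card_Diff_subset finite_subset double_diff card_mono of_nat_diff)
  finally show ?thesis by simp
qed

lemma es_Un_reciprocal:
  assumes fin: "finite L" "finite R" "L \<inter> R = {}" and inv: "\<And>i. i \<in> L \<Longrightarrow> x i * z i = 1"
  shows "es (L \<union> R) (int (card L) + b) x
    = (\<Prod>i\<in>L. x i) * (\<Sum>j\<le>card L. es L (int j) z * es R (b + int j) x)"
proof -
  have "es (L \<union> R) (int (card L) + b) x
      = (\<Sum>i\<le>card L. es L (int i) x * es R (int (card L) + b - int i) x)"
    by (rule es_Un_disjoint[OF fin])
  also have "\<dots> = (\<Sum>j\<le>card L. es L (int (card L) - int j) x * es R (b + int j) x)"
    by (intro sum.reindex_bij_witness[of _ "\<lambda>j. card L - j" "\<lambda>j. card L - j"])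
       (auto simp: algebra_simps of_nat_diff)
  also have "\<dots> = (\<Sum>j\<le>card L. (\<Prod>i\<in>L. x i) * (es L (int j) z * es R (b + int j) x))"
    by (simp add: es_reciprocal[OF fin(1) inv] mult.assoc)
  finally show ?thesis by (simp add: sum_distrib_left)
qed

lemma es_nonneg:
  fixes x :: "'i \<Rightarrow> 'a::linordered_idom"
  shows "(\<And>i. i \<in> I \<Longrightarrow> 0 \<le> x i) \<Longrightarrow> 0 \<le> es I j x"
  unfolding es_def by (intro sum_nonneg prod_nonneg) auto

lemma prod_le_es:
  fixes x :: "'i \<Rightarrow> 'a::linordered_idom"
  assumes "finite I" "J \<subseteq> I" "\<And>i. i \<in> I \<Longrightarrow> 0 \<le> x i"
  shows "(\<Prod>i\<in>J. x i) \<le> es I (int (card J)) x"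
proof -
  have "sum (\<lambda>S. \<Prod>i\<in>S. x i) {J} \<le> es I (int (card J)) x"
    unfolding es_def using assms by (intro sum_mono2) (auto intro!: prod_nonneg)
  then show ?thesis by simp
qed

lemma es_ge_power:
  fixes x :: "'i \<Rightarrow> 'a::linordered_idom"
  assumes "finite I" "J \<subseteq> I" "j \<le> card J" "\<And>i. i \<in> I \<Longrightarrow> 0 \<le> x i"
    and "\<And>i. i \<in> J \<Longrightarrow> c \<le> x i" "0 \<le> c"
  shows "c ^ j \<le> es I (int j) x"
proof -
  obtain J' where J': "J' \<subseteq> J" "card J' = j"
    using assms(3) by (meson obtain_subset_with_card_n)
  have "c ^ j = (\<Prod>i\<in>J'. c)" using J' by simp
  also have "\<dots> \<le> (\<Prod>i\<in>J'. x i)" using J' assms by (intro prod_mono) auto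
  also have "\<dots> \<le> es I (int (card J')) x" using J' assms by (intro prod_le_es) auto
  finally show ?thesis using J' by simp
qed

lemma es_le_power:
  fixes x :: "'i \<Rightarrow> 'a::linordered_idom"
  assumes "finite I" "\<And>i. i \<in> I \<Longrightarrow> 0 \<le> x i" "\<And>i. i \<in> I \<Longrightarrow> x i \<le> c" and c: "0 \<le> c"
  shows "es I (int j) x \<le> 2 ^ card I * c ^ j"
proof -
  have "es I (int j) x \<le> (\<Sum>S | S \<subseteq> I \<and> int (card S) = int j. c ^ j)"
    unfolding es_def
  proof (rule sum_mono)
    fix S assume S: "S \<in> {S. S \<subseteq> I \<and> int (card S) = int j}"
    have "(\<Prod>i\<in>S. x i) \<le> (\<Prod>i\<in>S. c)" using S assms by (intro prod_mono) auto
    then show "(\<Prod>i\<in>S. x i) \<le> c ^ j" using S by simp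
  qed
  also have "\<dots> \<le> (\<Sum>S\<in>Pow I. c ^ j)"
    using assms(1) c by (intro sum_mono2) auto
  finally show ?thesis using assms(1) by (simp add: card_Pow)
qed

definition newton_gap :: "'i set \<Rightarrow> ('i \<Rightarrow> 'a::comm_ring_1) \<Rightarrow> int \<Rightarrow> int \<Rightarrow> 'a" where
  "newton_gap I x i j = es I i x * es I j x - es I (i - 1) x * es I (j + 1) x"

lemma newton_gap_self: "newton_gap I x (j + 1) j = 0"
  by (simp add: newton_gap_def)

lemma newton_gap_insert:
  assumes "finite I" "a \<notin> I"
  shows "newton_gap (insert a I) x i j = (x a)\<^sup>2 * newton_gap I x (i - 1) (j - 1)
    + x a * (newton_gap I x i (j - 1) + newton_gap I x (i - 1) j) + newton_gap I x i j"
  using assms by (simp add: newton_gap_def es_insert power2_eq_square algebra_simps)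

lemma newton_gap_nonneg:
  fixes x :: "'i \<Rightarrow> 'a::linordered_idom"
  assumes "finite I" "\<And>i. i \<in> I \<Longrightarrow> 0 \<le> x i" "i \<le> j + 1"
  shows "0 \<le> newton_gap I x i j"
  using assms
proof (induction I arbitrary: i j rule: finite_induct)
  case empty
  then show ?case by (simp add: newton_gap_def)
next
  case (insert a I)
  show ?case
  proof (cases "i = j + 1")
    case False
    then show ?thesis
      using insert unfolding newton_gap_insert[OF insert.hyps(1,2)]
      by (intro add_nonneg_nonneg mult_nonneg_nonneg) auto
  qed (simp add: newton_gap_self)
qed

lemma newton_gap_insert_ge:
  fixes x :: "'i \<Rightarrow> 'a::linordered_idom"
  assumes "finite I" "a \<notin> I" "\<And>i. i \<in> insert a I \<Longrightarrow> 0 \<le> x i" "i \<le> j"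
  shows "(x a)\<^sup>2 * newton_gap I x (i - 1) (j - 1) \<le> newton_gap (insert a I) x i j"
proof -
  have nonneg: "0 \<le> newton_gap I x p q" if "p \<le> q + 1" for p q
    using assms that by (intro newton_gap_nonneg) auto
  have "0 \<le> x a * (newton_gap I x i (j - 1) + newton_gap I x (i - 1) j)"
    using assms by (intro mult_nonneg_nonneg add_nonneg_nonneg nonneg) auto
  moreover have "0 \<le> newton_gap I x i j" using assms(4) by (intro nonneg) auto
  ultimately show ?thesis unfolding newton_gap_insert[OF assms(1,2)] by simp
qed

definition many_pos :: "nat \<Rightarrow> 'i set \<Rightarrow> ('i \<Rightarrow> real) \<Rightarrow> bool" where
  "many_pos a I x \<longleftrightarrow> finite I \<and> (\<forall>i\<in>I. 0 \<le> x i) \<and> a \<le> card {i \<in> I. 0 < x i}"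

lemma many_pos_mono: "many_pos a I x \<Longrightarrow> b \<le> a \<Longrightarrow> many_pos b I x"
  by (simp add: many_pos_def)

lemma many_pos_remove:
  assumes "many_pos (Suc a) I x"
  shows "many_pos a (I - {i}) x"
proof -
  have "card {j \<in> I. 0 < x j} - 1 \<le> card ({j \<in> I. 0 < x j} - {i})"
    using card_Diff_singleton_if[of "{j \<in> I. 0 < x j}" i] by auto
  moreover have "{j \<in> I. 0 < x j} - {i} = {j \<in> I - {i}. 0 < x j}" by auto
  ultimately show ?thesis using assms by (auto simp: many_pos_def)
qed

lemma es_pos:
  assumes "many_pos a I x" "j \<le> a"
  shows "0 < es I (int j) x"
proof -
  have "j \<le> card {i \<in> I. 0 < x i}" using assms by (simp add: many_pos_def)
  then obtain J where J: "J \<subseteq> {i \<in> I. 0 < x i}" "card J = j"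
    by (meson obtain_subset_with_card_n)
  have "0 < (\<Prod>i\<in>J. x i)" using J by (intro prod_pos) auto
  also have "\<dots> \<le> es I (int (card J)) x"
    using assms(1) J by (intro prod_le_es) (auto simp: many_pos_def)
  finally show ?thesis using J by simp
qed

lemma newton_gap_pos:
  assumes "many_pos j I x" "i \<le> j"
  shows "0 < newton_gap I x (int i) (int j)"
  using assms
proof (induction i arbitrary: j I)
  case 0
  then show ?case using es_pos[of j I x j] by (simp add: newton_gap_def es_neg many_pos_def)
next
  case (Suc i)
  obtain j' where j: "j = Suc j'" using Suc.prems(2) by (cases j) auto
  then have "{i \<in> I. 0 < x i} \<noteq> {}" using Suc.prems(1) by (force simp: many_pos_def)
  then obtain a where a: "a \<in> I" "0 < x a" by blast
  have I: "finite I" "\<And>i. i \<in> I \<Longrightarrow> 0 \<le> x i" using Suc.prems(1) by (auto simp: many_pos_def)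
  have "0 < newton_gap (I - {a}) x (int i) (int j')"
    using Suc j by (intro Suc.IH many_pos_remove) auto
  then have "0 < (x a)\<^sup>2 * newton_gap (I - {a}) x (int i) (int j')" using a by simp
  also have "\<dots> \<le> newton_gap (insert a (I - {a})) x (int (Suc i)) (int j)"
    using newton_gap_insert_ge[of "I - {a}" a x "int (Suc i)" "int j"] I a Suc.prems(2) j by auto
  finally show ?case using a by (simp add: insert_absorb)
qed

subsection \<open>The second-order chain rule for \<open>\<sigma>\<^sub>k / \<sigma>\<^sub>l\<close>\<close>

lemma fps_mult_nth_Suc_0: "(f * g) $ Suc 0
    = f $ 0 * g $ Suc 0 + f $ Suc 0 * (g $ 0 :: 'a::comm_semiring_1)"
  by (simp add: fps_mult_nth)

lemma fps_mult_nth_2: "(f * g) $ 2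
    = f $ 0 * g $ 2 + f $ Suc 0 * g $ Suc 0 + f $ 2 * (g $ 0 :: 'a::comm_semiring_1)"
  by (simp add: fps_mult_nth numeral_2_eq_2)

lemma fps_mult_inverse_cancel: "g $ 0 \<noteq> 0 \<Longrightarrow> f * inverse g * g = (f :: 'a::field fps)"
  by (simp add: mult.assoc inverse_mult_eq_1)

lemma fps_quotient_nth:
  fixes f g q :: "'a::field fps"
  assumes q: "q * g = f" and g: "g $ 0 \<noteq> 0"
  shows "q $ 0 = f $ 0 / g $ 0"
    and "q $ Suc 0 = (f $ Suc 0 - q $ 0 * g $ Suc 0) / g $ 0"
    and "q $ 2 = (f $ 2 - q $ Suc 0 * g $ Suc 0 - q $ 0 * g $ 2) / g $ 0"
proof -
  have "q $ 0 * g $ 0 = f $ 0" "q $ 0 * g $ Suc 0 + q $ Suc 0 * g $ 0 = f $ Suc 0"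
    "q $ 0 * g $ 2 + q $ Suc 0 * g $ Suc 0 + q $ 2 * g $ 0 = f $ 2"
    by (simp_all add: q[symmetric] fps_mult_nth_Suc_0 fps_mult_nth_2)
  then show "q $ 0 = f $ 0 / g $ 0" "q $ Suc 0 = (f $ Suc 0 - q $ 0 * g $ Suc 0) / g $ 0"
    "q $ 2 = (f $ 2 - q $ Suc 0 * g $ Suc 0 - q $ 0 * g $ 2) / g $ 0"
    using g by (auto simp: nonzero_eq_divide_eq algebra_simps)
qed

lemma fps_prod_nth_0: "(\<Prod>i\<in>S. f i :: 'a::comm_ring_1 fps) $ 0 = (\<Prod>i\<in>S. f i $ 0)"
  by (induction S rule: infinite_finite_induct) auto

lemma es_fps_nth_0:
  assumes "\<And>i. i \<in> I \<Longrightarrow> c i $ 0 = (x i :: 'a::comm_ring_1)"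
  shows "es I j c $ 0 = es I j x"
  unfolding es_def fps_sum_nth fps_prod_nth_0 using assms by (intro sum.cong prod.cong) auto

lemma fps_deriv_es:
  fixes c :: "'i \<Rightarrow> 'a::comm_ring_1 fps"
  assumes "finite I"
  shows "fps_deriv (es I j c) = (\<Sum>i\<in>I. fps_deriv (c i) * es (I - {i}) (j - 1) c)"
  using assms
proof (induction I arbitrary: j rule: finite_induct)
  case empty
  then show ?case by (simp add: of_bool_def)
next
  case (insert a I)
  have "insert a I - {i} = insert a (I - {i})" if "i \<in> I" for i
    using that insert by auto
  then have "(\<Sum>i\<in>I. fps_deriv (c i) * es (insert a I - {i}) (j - 1) c)
      = (\<Sum>i\<in>I. c a * (fps_deriv (c i) * es (I - {i}) (j - 1 - 1) c)
          + fps_deriv (c i) * es (I - {i}) (j - 1) c)"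
    using insert by (intro sum.cong) (auto simp: es_insert algebra_simps)
  also have "\<dots> = c a * fps_deriv (es I (j - 1) c) + fps_deriv (es I j c)"
    unfolding sum.distrib sum_distrib_left[symmetric] insert.IH ..
  finally show ?case
    using insert by (simp add: es_insert algebra_simps)
qed

definition es_partial :: "'i set \<Rightarrow> int \<Rightarrow> 'i \<Rightarrow> ('i \<Rightarrow> 'a::comm_semiring_1) \<Rightarrow> 'a" where
  "es_partial I j i x = es (I - {i}) (j - 1) x"

definition es_partial2 :: "'i set \<Rightarrow> int \<Rightarrow> 'i \<Rightarrow> 'i \<Rightarrow> ('i \<Rightarrow> 'a::comm_semiring_1) \<Rightarrow> 'a" where
  "es_partial2 I j i k x = (if i = k then 0 else es (I - {k} - {i}) (j - 2) x)"

lemma fps_deriv_es_partial: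
  fixes c :: "'i \<Rightarrow> 'a::comm_ring_1 fps"
  assumes "finite I"
  shows "fps_deriv (es_partial I j k c) = (\<Sum>i\<in>I. fps_deriv (c i) * es_partial2 I j i k c)"
proof -
  have "fps_deriv (es_partial I j k c)
      = (\<Sum>i\<in>I - {k}. fps_deriv (c i) * es (I - {k} - {i}) (j - 1 - 1) c)"
    using assms by (simp add: es_partial_def fps_deriv_es)
  also have "\<dots> = (\<Sum>i\<in>I - {k}. fps_deriv (c i) * es_partial2 I j i k c)"
    by (intro sum.cong) (auto simp: es_partial2_def)
  also have "\<dots> = (\<Sum>i\<in>I. fps_deriv (c i) * es_partial2 I j i k c)"
    using assms by (intro sum.mono_neutral_left) (auto simp: es_partial2_def)
  finally show ?thesis .
qed

context
  fixes I :: "'i set" and c :: "'i \<Rightarrow> 'a::comm_ring_1 fps" and x :: "'i \<Rightarrow> 'a"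
  assumes fin: "finite I" and base: "\<And>i. i \<in> I \<Longrightarrow> c i $ 0 = x i"
begin

lemma es_partial_fps_nth_0: "es_partial I j i c $ 0 = es_partial I j i x"
  unfolding es_partial_def by (rule es_fps_nth_0) (use base in auto)

lemma es_partial2_fps_nth_0: "es_partial2 I j i k c $ 0 = es_partial2 I j i k x"
  unfolding es_partial2_def using base es_fps_nth_0[of "I - {k} - {i}" c x "j - 2"] by auto

lemma es_fps_nth_Suc_0: "es I j c $ Suc 0 = (\<Sum>i\<in>I. c i $ Suc 0 * es_partial I j i x)"
proof -
  have "es I j c $ Suc 0 = fps_deriv (es I j c) $ 0" by simp
  then show ?thesis
    by (simp add: fps_deriv_es[OF fin] fps_sum_nth es_partial_fps_nth_0 flip: es_partial_def)
qed

lemma es_fps_nth_2: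
  "2 * es I j c $ 2 = (\<Sum>i\<in>I. \<Sum>k\<in>I. es_partial2 I j i k x * c i $ Suc 0 * c k $ Suc 0)
     + 2 * (\<Sum>i\<in>I. c i $ 2 * es_partial I j i x)"
proof -
  have "2 * es I j c $ 2 = fps_deriv (fps_deriv (es I j c)) $ 0"
    by (simp add: numeral_2_eq_2)
  also have "fps_deriv (fps_deriv (es I j c)) = (\<Sum>k\<in>I. fps_deriv (fps_deriv (c k)) * es_partial I j k c)
      + (\<Sum>k\<in>I. \<Sum>i\<in>I. fps_deriv (c k) * (fps_deriv (c i) * es_partial2 I j i k c))"
    by (simp add: fps_deriv_es[OF fin] fps_deriv_sum fps_deriv_es_partial[OF fin] sum.distrib
        sum_distrib_left add.commute flip: es_partial_def)
  also have "\<dots> $ 0 = (\<Sum>k\<in>I. 2 * c k $ 2 * es_partial I j k x)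
      + (\<Sum>k\<in>I. \<Sum>i\<in>I. es_partial2 I j i k x * c i $ Suc 0 * c k $ Suc 0)"
    by (simp add: fps_sum_nth es_partial_fps_nth_0 es_partial2_fps_nth_0 numeral_2_eq_2 mult_ac)
  also have "(\<Sum>k\<in>I. \<Sum>i\<in>I. es_partial2 I j i k x * c i $ Suc 0 * c k $ Suc 0)
      = (\<Sum>i\<in>I. \<Sum>k\<in>I. es_partial2 I j i k x * c i $ Suc 0 * c k $ Suc 0)"
    by (rule sum.swap)
  finally show ?thesis by (simp add: sum_distrib_left mult.assoc)
qed

end

lemma es_fun_upd_outside: "i \<notin> I \<Longrightarrow> es I j (x(i := t)) = es I j x"
  by (rule es_cong) auto

lemma es_fun_upd:
  fixes x :: "'i \<Rightarrow> 'a::comm_ring_1"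
  assumes "finite I" "i \<in> I"
  shows "es I j (x(i := t)) = es I j x + (t - x i) * es_partial I j i x"
  using es_remove[OF assms, of j x] es_remove[OF assms, of j "x(i := t)"]
  by (simp add: es_fun_upd_outside es_partial_def algebra_simps)

lemma es_partial_fun_upd:
  fixes x :: "'i \<Rightarrow> 'a::comm_ring_1"
  assumes "finite I" "i \<in> I"
  shows "es_partial I j k (x(i := t)) = es_partial I j k x + (t - x i) * es_partial2 I j i k x"
  using assms es_fun_upd[of "I - {k}" i "j - 1" x t]
  by (cases "i = k") (auto simp: es_partial_def es_partial2_def es_fun_upd_outside)

lemma pderiv1_sigma_quot:
  fixes n k l x
  defines "S \<equiv> es {1..n} (int k) x" and "T \<equiv> es {1..n} (int l) x"
    and "S1 \<equiv> \<lambda>i. es_partial {1..n} (int k) i x" and "T1 \<equiv> \<lambda>i. es_partial {1..n} (int l) i x"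
  assumes T: "T \<noteq> 0" and i: "i \<in> {1..n}"
  shows "pderiv1 i (sigma_quot n k l) x = (S1 i * T - S * T1 i) / T\<^sup>2"
proof -
  have "(\<lambda>t. sigma_quot n k l (x(i := t))) = (\<lambda>t. (S + (t - x i) * S1 i) / (T + (t - x i) * T1 i))"
    using i by (simp add: sigma_quot_def esym_eq_es es_fun_upd S_def T_def S1_def T1_def)
  moreover have "((\<lambda>t. (S + (t - x i) * S1 i) / (T + (t - x i) * T1 i))
    has_real_derivative (S1 i * T - S * T1 i) / T\<^sup>2) (at (x i))"
    using T by (auto intro!: derivative_eq_intros simp: power2_eq_square)
  ultimately show ?thesis
    unfolding pderiv1_def by (simp add: DERIV_imp_deriv)
qed

lemma pderiv2_sigma_quot:
  fixes n k l x
  defines "S \<equiv> es {1..n} (int k) x" and "T \<equiv> es {1..n} (int l) x"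
    and "S1 \<equiv> \<lambda>i. es_partial {1..n} (int k) i x" and "T1 \<equiv> \<lambda>i. es_partial {1..n} (int l) i x"
    and "S2 \<equiv> \<lambda>i j. es_partial2 {1..n} (int k) i j x" and "T2 \<equiv> \<lambda>i j. es_partial2 {1..n} (int l) i j x"
  assumes T: "T \<noteq> 0" and ij: "i \<in> {1..n}" "j \<in> {1..n}"
  shows "pderiv2 i j (sigma_quot n k l) x =
    S2 i j / T - (S1 j * T1 i + S1 i * T1 j) / T\<^sup>2 - S * T2 i j / T\<^sup>2 + 2 * S * T1 i * T1 j / T ^ 3"
    (is "_ = ?D")
proof -
  let ?h = "\<lambda>t. ((S1 j + (t - x i) * S2 i j) * (T + (t - x i) * T1 i)
      - (S + (t - x i) * S1 i) * (T1 j + (t - x i) * T2 i j)) / (T + (t - x i) * T1 i)\<^sup>2"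
  have "\<forall>\<^sub>F t in nhds (x i). T + (t - x i) * T1 i \<noteq> 0"
  proof -
    have "isCont (\<lambda>t. T + (t - x i) * T1 i) (x i)" by (intro continuous_intros)
    then show ?thesis
      using T tendsto_imp_eventually_ne[of "\<lambda>t. T + (t - x i) * T1 i" T "at (x i)" 0]
      by (simp add: isCont_def eventually_nhds_conv_at)
  qed
  then have near: "\<forall>\<^sub>F t in nhds (x i). pderiv1 j (sigma_quot n k l) (x(i := t)) = ?h t"
  proof eventually_elim
    case (elim t)
    have "es {1..n} (int l) (x(i := t)) \<noteq> 0"
      using elim ij by (simp add: es_fun_upd T_def T1_def)
    then show ?case
      using ij by (simp add: pderiv1_sigma_quot es_fun_upd es_partial_fun_upd
          S_def T_def S1_def T1_def S2_def T2_def)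
  qed
  have "(?h has_real_derivative ?D) (at (x i))"
    using T by (auto intro!: derivative_eq_intros simp: field_simps eval_nat_numeral)
  then show ?thesis
    unfolding pderiv2_def pderiv1_def[of i] using deriv_cong_ev[OF near refl]
    by (simp add: DERIV_imp_deriv)
qed

definition sigma_quot_fps :: "nat \<Rightarrow> nat \<Rightarrow> nat \<Rightarrow> (nat \<Rightarrow> real fps) \<Rightarrow> real fps" where
  "sigma_quot_fps n k l c = es {1..n} (int k) c * inverse (es {1..n} (int l) c)"

context
  fixes n k l :: nat and x :: "nat \<Rightarrow> real" and c :: "nat \<Rightarrow> real fps"
  assumes denom: "es {1..n} (int l) x \<noteq> 0" and base: "\<And>i. i \<in> {1..n} \<Longrightarrow> c i $ 0 = x i"
begin

lemma es_curve_nth: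
  "es {1..n} j c $ 0 = es {1..n} j x"
  "es {1..n} j c $ Suc 0 = (\<Sum>i=1..n. c i $ Suc 0 * es_partial {1..n} j i x)"
  "2 * es {1..n} j c $ 2 = (\<Sum>i=1..n. \<Sum>k=1..n. es_partial2 {1..n} j i k x * c i $ Suc 0 * c k $ Suc 0)
    + 2 * (\<Sum>i=1..n. c i $ 2 * es_partial {1..n} j i x)"
  using base by (auto intro!: es_fps_nth_0 es_fps_nth_Suc_0 es_fps_nth_2)

lemma sigma_quot_fps_mult: "sigma_quot_fps n k l c * es {1..n} (int l) c = es {1..n} (int k) c"
  unfolding sigma_quot_fps_def using denom
  by (intro fps_mult_inverse_cancel) (simp_all only: es_curve_nth(1) simp_thms)

lemmas sigma_quot_fps_nth = fps_quotient_nth[OF sigma_quot_fps_mult, unfolded es_curve_nth(1), OF denom]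

lemma sigma_quot_fps_nth_0: "sigma_quot_fps n k l c $ 0 = sigma_quot n k l x"
  using sigma_quot_fps_nth(1) by (simp add: sigma_quot_def esym_eq_es)

lemma sum_pderiv1_mult:
  "(\<Sum>i=1..n. pderiv1 i (sigma_quot n k l) x * v i)
    = (\<Sum>i=1..n. v i * es_partial {1..n} (int k) i x) * (1 / es {1..n} (int l) x)
      - (\<Sum>i=1..n. v i * es_partial {1..n} (int l) i x) * (es {1..n} (int k) x / (es {1..n} (int l) x)\<^sup>2)"
  unfolding sum_distrib_right sum_subtractf[symmetric] using denom
  by (intro sum.cong refl) (auto simp: pderiv1_sigma_quot field_simps power2_eq_square)

lemma sum_pderiv1_sigma_quot:
  "(\<Sum>i=1..n. pderiv1 i (sigma_quot n k l) x * c i $ Suc 0) = sigma_quot_fps n k l c $ Suc 0"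
  using denom unfolding sigma_quot_fps_nth(2) sigma_quot_fps_nth(1) sum_pderiv1_mult es_curve_nth(2)
  by (simp add: field_simps power2_eq_square)

lemma sum_pderiv2_sigma_quot:
  "(\<Sum>i=1..n. \<Sum>j=1..n. pderiv2 i j (sigma_quot n k l) x * c i $ Suc 0 * c j $ Suc 0)
    + 2 * (\<Sum>i=1..n. pderiv1 i (sigma_quot n k l) x * c i $ 2) = 2 * sigma_quot_fps n k l c $ 2"
proof -
  define s t where "s = es {1..n} (int k) c" and "t = es {1..n} (int l) c"
  define S T S1 T1 S2 T2 where defs: "S = es {1..n} (int k) x" "T = es {1..n} (int l) x"
    "S1 = (\<lambda>i. es_partial {1..n} (int k) i x)" "T1 = (\<lambda>i. es_partial {1..n} (int l) i x)"
    "S2 = (\<lambda>i j. es_partial2 {1..n} (int k) i j x)" "T2 = (\<lambda>i j. es_partial2 {1..n} (int l) i j x)"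
  let ?u = "\<lambda>i. c i $ Suc 0" and ?v = "\<lambda>i. c i $ 2"
  have T0: "T \<noteq> 0" using denom by (simp add: defs)
  have s1: "(\<Sum>i=1..n. ?u i * S1 i) = s $ Suc 0" and t1: "(\<Sum>i=1..n. ?u i * T1 i) = t $ Suc 0"
    by (simp_all only: s_def t_def defs es_curve_nth(2))
  have s2: "(\<Sum>i=1..n. \<Sum>j=1..n. S2 i j * ?u i * ?u j) = 2 * s $ 2 - 2 * (\<Sum>i=1..n. ?v i * S1 i)"
    and t2: "(\<Sum>i=1..n. \<Sum>j=1..n. T2 i j * ?u i * ?u j) = 2 * t $ 2 - 2 * (\<Sum>i=1..n. ?v i * T1 i)"
    by (simp_all add: s_def t_def defs es_curve_nth(3) del: One_nat_def)
  have F2: "pderiv2 i j (sigma_quot n k l) x = S2 i j / T - (S1 j * T1 i + S1 i * T1 j) / T\<^sup>2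
      - S * T2 i j / T\<^sup>2 + 2 * S * T1 i * T1 j / T ^ 3" if "i \<in> {1..n}" "j \<in> {1..n}" for i j
    unfolding defs by (rule pderiv2_sigma_quot[OF denom that])
  have "(\<Sum>i=1..n. \<Sum>j=1..n. pderiv2 i j (sigma_quot n k l) x * ?u i * ?u j) =
    (\<Sum>i=1..n. \<Sum>j=1..n. S2 i j * ?u i * ?u j * (1 / T) - (?u i * T1 i) * (?u j * S1 j) * (1 / T\<^sup>2)
      - (?u i * S1 i) * (?u j * T1 j) * (1 / T\<^sup>2)
      - T2 i j * ?u i * ?u j * (S / T\<^sup>2) + (?u i * T1 i) * (?u j * T1 j) * (2 * S / T ^ 3))"
    by (intro sum.cong refl) (simp add: F2 add_divide_distrib algebra_simps)
  also have "\<dots> = (2 * s $ 2 - 2 * (\<Sum>i=1..n. ?v i * S1 i)) * (1 / T) - t $ Suc 0 * s $ Suc 0 * (1 / T\<^sup>2)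
      - s $ Suc 0 * t $ Suc 0 * (1 / T\<^sup>2) - (2 * t $ 2 - 2 * (\<Sum>i=1..n. ?v i * T1 i)) * (S / T\<^sup>2)
      + t $ Suc 0 * t $ Suc 0 * (2 * S / T ^ 3)"
    unfolding sum.distrib sum_subtractf sum_distrib_right[symmetric] sum_product[symmetric] s1 t1
      s2 t2 ..
  finally have second: "(\<Sum>i=1..n. \<Sum>j=1..n. pderiv2 i j (sigma_quot n k l) x * ?u i * ?u j) = \<dots>" .
  have first: "(\<Sum>i=1..n. pderiv1 i (sigma_quot n k l) x * ?v i)
      = (\<Sum>i=1..n. ?v i * S1 i) * (1 / T) - (\<Sum>i=1..n. ?v i * T1 i) * (S / T\<^sup>2)"
    unfolding defs by (rule sum_pderiv1_mult)
  show ?thesis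
    unfolding second first sigma_quot_fps_nth(3) sigma_quot_fps_nth(2) sigma_quot_fps_nth(1)
      s_def[symmetric] t_def[symmetric] defs(1,2)[symmetric]
    using T0 by (simp add: field_simps power2_eq_square power3_eq_cube)
qed

end

subsection \<open>Strict concavity of quotients of elementary symmetric functions\<close>

definition line :: "('i \<Rightarrow> real) \<Rightarrow> ('i \<Rightarrow> real) \<Rightarrow> 'i \<Rightarrow> real fps" where
  "line x u i = fps_const (x i) + fps_const (u i) * fps_X"

lemma line_nth [simp]: "line x u i $ 0 = x i" "line x u i $ Suc 0 = u i" "line x u i $ 2 = 0"
  by (simp_all add: line_def numeral_2_eq_2)

lemma es_line_nth_0 [simp]: "es I j (line x u) $ 0 = es I j x"
  by (rule es_fps_nth_0) simp

definition es_ratio :: "'i set \<Rightarrow> nat \<Rightarrow> ('i \<Rightarrow> real) \<Rightarrow> ('i \<Rightarrow> real) \<Rightarrow> real fps" where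
  "es_ratio I a x u = es I (int a) (line x u) * inverse (es I (int a - 1) (line x u))"

lemma es_ratio_mult:
  "es I (int a - 1) x \<noteq> 0 \<Longrightarrow> es_ratio I a x u * es I (int a - 1) (line x u) = es I (int a) (line x u)"
  by (simp add: es_ratio_def fps_mult_inverse_cancel)

lemma es_ratio_nth_0_pos:
  assumes "many_pos a I x" "1 \<le> a"
  shows "0 < es_ratio I a x u $ 0"
proof -
  have "0 < es I (int a) x" "0 < es I (int a - 1) x"
    using es_pos[OF assms(1), of a] es_pos[OF assms(1), of "a - 1"] assms(2) by (auto simp: of_nat_diff)
  then show ?thesis using fps_quotient_nth(1)[OF es_ratio_mult, of I a x u] by simp
qed

lemma es_ratio_1: "finite I \<Longrightarrow> es_ratio I 1 x u = (\<Sum>i\<in>I. line x u i)"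
  by (simp add: es_ratio_def es_1)

lemma parallel_product_nth_2:
  fixes h x Q :: "real fps"
  assumes h: "h * (x + Q) = x * Q" and x: "x $ 2 = 0" and nonzero: "x $ 0 + Q $ 0 \<noteq> 0"
  shows "h $ 2 = Q $ 2 * (x $ 0)\<^sup>2 / (x $ 0 + Q $ 0)\<^sup>2
    - (Q $ 0 * x $ Suc 0 - x $ 0 * Q $ Suc 0)\<^sup>2 / (x $ 0 + Q $ 0) ^ 3"
proof -
  define y where "y = x $ 0 + Q $ 0"
  have y: "y \<noteq> 0" "Q $ 0 = y - x $ 0" using nonzero by (simp_all add: y_def)
  have "(x + Q) $ 0 \<noteq> 0" using nonzero by simp
  note nth = fps_quotient_nth[OF h this, unfolded fps_add_nth fps_mult_nth_Suc_0 fps_mult_nth_2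
      fps_mult_nth_0 y_def[symmetric] x]
  show ?thesis
    unfolding nth(3) nth(2) nth(1) y_def[symmetric] unfolding y(2) using y(1)
    by (simp add: field_simps power2_eq_square power3_eq_cube)
qed

lemma es_ratio_parallel_product:
  fixes x u :: "'i \<Rightarrow> real"
  assumes pos: "many_pos (Suc a) I x" and a: "1 \<le> a" and i: "i \<in> I"
  defines "h \<equiv> line x u i * es (I - {i}) (int a) (line x u) * inverse (es I (int a) (line x u))"
  shows "h * (line x u i + es_ratio (I - {i}) a x u) = line x u i * es_ratio (I - {i}) a x u"
proof -
  define E e Q where "E = es I (int a) (line x u)" and "e = es (I - {i}) (int a - 1) (line x u)"
    and "Q = es_ratio (I - {i}) a x u"
  have fin: "finite I" using pos by (simp add: many_pos_def)
  have E: "E $ 0 \<noteq> 0" using es_pos[OF pos, of a] by (simp add: E_def)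
  have e: "e $ 0 \<noteq> 0"
    using es_pos[OF many_pos_remove[OF pos], of "a - 1" i] a by (simp add: e_def of_nat_diff)
  then have Qe: "Q * e = es (I - {i}) (int a) (line x u)"
    by (simp add: Q_def e_def es_ratio_mult)
  have "(line x u i + Q) * e = E"
    using es_remove[OF fin i, of "int a" "line x u"] Qe by (simp add: E_def e_def algebra_simps)
  then have "h * (line x u i + Q) * e = line x u i * (Q * e) * (inverse E * E)"
    unfolding h_def Qe E_def[symmetric] by (simp add: mult_ac)
  also have "\<dots> = line x u i * Q * e" using E by (simp add: inverse_mult_eq_1 mult.assoc)
  finally show ?thesis using e unfolding Q_def by (metis fps_zero_nth mult_right_cancel)
qed

text \<open>Marcus and Lopes: \<open>(a + 1) \<sigma>\<^sub>a\<^sub>+\<^sub>1 / \<sigma>\<^sub>a = \<Sum> x\<^sub>i Q\<^sub>i / (x\<^sub>i + Q\<^sub>i)\<close>, where \<open>Q\<^sub>i = \<sigma>\<^sub>a / \<sigma>\<^sub>a\<^sub>-\<^sub>1\<close> in the variables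
  other than \<open>x\<^sub>i\<close>. So concavity is inherited from that of the harmonic mean.\<close>
lemma es_ratio_Suc_nth_2:
  fixes x u :: "'i \<Rightarrow> real" and I :: "'i set" and a :: nat
  assumes pos: "many_pos (Suc a) I x" and a: "1 \<le> a"
  defines "Q \<equiv> \<lambda>i. es_ratio (I - {i}) a x u"
  shows "- (real (Suc a) * es_ratio I (Suc a) x u $ 2) = (\<Sum>i\<in>I. - (Q i $ 2) * (x i)\<^sup>2 / (x i + Q i $ 0)\<^sup>2
     + (Q i $ 0 * u i - x i * Q i $ Suc 0)\<^sup>2 / (x i + Q i $ 0) ^ 3)"
proof -
  define h where "h i =
      line x u i * es (I - {i}) (int a) (line x u) * inverse (es I (int a) (line x u))" for i
  have fin: "finite I" using pos by (simp add: many_pos_def)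
  have "of_nat (Suc a) * es_ratio I (Suc a) x u = (\<Sum>i\<in>I. h i)"
    using es_Euler[OF fin, of "line x u" "int (Suc a)"]
    by (simp add: es_ratio_def h_def mult.assoc[symmetric] flip: sum_distrib_right)
  then have "fps_const (real (Suc a)) * es_ratio I (Suc a) x u = (\<Sum>i\<in>I. h i)"
    by (simp only: fps_of_nat)
  from arg_cong[OF this, of "\<lambda>f. f $ 2"]
  have "real (Suc a) * es_ratio I (Suc a) x u $ 2 = (\<Sum>i\<in>I. h i $ 2)"
    by (simp only: fps_mult_left_const_nth fps_sum_nth)
  moreover have "- (h i $ 2) = - (Q i $ 2) * (x i)\<^sup>2 / (x i + Q i $ 0)\<^sup>2
     + (Q i $ 0 * u i - x i * Q i $ Suc 0)\<^sup>2 / (x i + Q i $ 0) ^ 3" if i: "i \<in> I" for i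
  proof -
    have "0 \<le> x i" "0 < Q i $ 0"
      using pos i es_ratio_nth_0_pos[OF many_pos_remove[OF pos] a] by (auto simp: many_pos_def Q_def)
    then have "line x u i $ 0 + Q i $ 0 \<noteq> 0" by simp
    then show ?thesis
      using parallel_product_nth_2[OF es_ratio_parallel_product[OF pos a i, of u]]
      by (simp add: h_def Q_def)
  qed
  ultimately show ?thesis by (simp add: sum_negf[symmetric] del: sum_negf)
qed

context
  fixes x u :: "'i \<Rightarrow> real"
begin

lemma es_ratio_Suc_summand_nonneg:
  assumes "many_pos a (I - {i}) x" "1 \<le> a" "0 \<le> x i" "es_ratio (I - {i}) a x u $ 2 \<le> 0"
  defines "Q \<equiv> es_ratio (I - {i}) a x u"
  shows "0 \<le> - (Q $ 2) * (x i)\<^sup>2 / (x i + Q $ 0)\<^sup>2"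
    "0 \<le> (Q $ 0 * u i - x i * Q $ Suc 0)\<^sup>2 / (x i + Q $ 0) ^ 3"
  using assms es_ratio_nth_0_pos[OF assms(1,2), of u]
  by (auto intro!: divide_nonpos_nonneg mult_nonpos_nonneg)

lemma es_ratio_concave:
  assumes "1 \<le> a" "many_pos a I x"
  shows "es_ratio I a x u $ 2 \<le> 0"
  using assms
proof (induction a arbitrary: I rule: nat_induct_at_least)
  case base
  then show ?case by (simp add: es_ratio_1[unfolded One_nat_def] fps_sum_nth many_pos_def)
next
  case (Suc a)
  have "0 \<le> - (real (Suc a) * es_ratio I (Suc a) x u $ 2)"
    unfolding es_ratio_Suc_nth_2[OF Suc.prems Suc.hyps]
    using Suc many_pos_remove[OF Suc.prems]
    by (intro sum_nonneg add_nonneg_nonneg es_ratio_Suc_summand_nonneg) (auto simp: many_pos_def)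
  then show ?case by (simp add: mult_le_0_iff)
qed

lemma es_ratio_Suc_nth_2_eq_0D:
  assumes pos: "many_pos (Suc a) I x" and a: "1 \<le> a" and zero: "es_ratio I (Suc a) x u $ 2 = 0"
    and i: "i \<in> I"
  defines "Q \<equiv> es_ratio (I - {i}) a x u"
  shows "Q $ 0 * u i = x i * Q $ Suc 0" and "0 < x i \<Longrightarrow> Q $ 2 = 0"
proof -
  have fin: "finite I" and nonneg: "\<And>i. i \<in> I \<Longrightarrow> 0 \<le> x i" using pos by (auto simp: many_pos_def)
  note pos' = many_pos_remove[OF pos]
  define f g where "f j =
      - (es_ratio (I - {j}) a x u $ 2) * (x j)\<^sup>2 / (x j + es_ratio (I - {j}) a x u $ 0)\<^sup>2"
    and "g j = (es_ratio (I - {j}) a x u $ 0 * u j - x j * es_ratio (I - {j}) a x u $ Suc 0)\<^sup>2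
        / (x j + es_ratio (I - {j}) a x u $ 0) ^ 3" for j
  have nonneg_fg: "0 \<le> f j" "0 \<le> g j" if "j \<in> I" for j
    using es_ratio_Suc_summand_nonneg[OF pos' a nonneg[OF that] es_ratio_concave[OF a pos']]
    by (auto simp: f_def g_def)
  have "(\<Sum>j\<in>I. f j + g j) = 0"
    using es_ratio_Suc_nth_2[OF pos a, of u] zero by (simp add: f_def g_def)
  then have "f i + g i = 0"
    using sum_nonneg_eq_0_iff[OF fin, of "\<lambda>j. f j + g j"] nonneg_fg i by (simp add: add_nonneg_nonneg)
  then have "f i = 0" "g i = 0" using nonneg_fg[OF i] by linarith+
  moreover have "0 < x i + Q $ 0"
    using nonneg[OF i] es_ratio_nth_0_pos[OF pos' a, of i u] unfolding Q_def by linarith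
  ultimately show "Q $ 0 * u i = x i * Q $ Suc 0" "0 < x i \<Longrightarrow> Q $ 2 = 0"
    by (auto simp: f_def g_def Q_def)
qed

end

lemma es_ratio_radial:
  assumes pos: "many_pos a I x" and a: "1 \<le> a" and radial: "\<And>i. i \<in> I \<Longrightarrow> u i = r * x i"
  shows "es_ratio I a x u $ Suc 0 = r * es_ratio I a x u $ 0"
proof -
  have fin: "finite I" using pos by (simp add: many_pos_def)
  have es_nth_1: "es I j (line x u) $ Suc 0 = r * (of_int j * es I j x)" for j
  proof -
    have "es I j (line x u) $ Suc 0 = (\<Sum>i\<in>I. u i * es (I - {i}) (j - 1) x)"
      using es_fps_nth_Suc_0[OF fin, of "line x u" x j] by (simp add: es_partial_def)
    also have "\<dots> = r * (\<Sum>i\<in>I. x i * es (I - {i}) (j - 1) x)"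
      using radial by (simp add: sum_distrib_left mult.assoc)
    finally show ?thesis by (simp only: es_Euler[OF fin])
  qed
  have denom: "es I (int a - 1) x \<noteq> 0" using es_pos[OF pos, of "a - 1"] a by (simp add: of_nat_diff)
  note nth = fps_quotient_nth[OF es_ratio_mult[OF denom, of u], unfolded es_line_nth_0, OF denom]
  show ?thesis
    unfolding nth(2) nth(1) es_nth_1 using denom by (simp add: field_simps)
qed

lemma es_ratio_nth_2_eq_0_imp_radial:
  assumes "2 \<le> a" "many_pos a I x" "es_ratio I a x u $ 2 = 0"
  shows "\<exists>r. \<forall>i\<in>I. u i = r * x i"
  using assms
proof (induction a arbitrary: I rule: nat_induct_at_least)
  case base
  have fin: "finite I" and pos: "many_pos (Suc 1) I x" using base
    by (simp_all add: many_pos_def numeral_2_eq_2)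
  define \<sigma> U where "\<sigma> = (\<Sum>i\<in>I. x i)" and "U = (\<Sum>i\<in>I. u i)"
  have \<sigma>: "0 < \<sigma>" using es_pos[OF pos, of 1] fin by (simp add: \<sigma>_def es_1)
  have "(\<sigma> - x i) * u i = x i * (U - u i)" if "i \<in> I" for i
    using es_ratio_Suc_nth_2_eq_0D(1)[OF pos order_refl _ that, of u] base(2) fin that
    by (simp add: es_ratio_1[unfolded One_nat_def] fps_sum_nth sum_diff1 \<sigma>_def U_def numeral_2_eq_2)
  then have "\<forall>i\<in>I. u i = U / \<sigma> * x i" using \<sigma> by (simp add: field_simps)
  then show ?case by blast
next
  case (Suc a)
  have a: "1 \<le> a" using Suc.hyps by simp
  have "{i \<in> I. 0 < x i} \<noteq> {}" using Suc.prems(1) by (force simp: many_pos_def)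
  then obtain i where i: "i \<in> I" "0 < x i" by blast
  note pos = many_pos_remove[OF Suc.prems(1), of i]
  note D = es_ratio_Suc_nth_2_eq_0D[OF Suc.prems(1) a Suc.prems(2) i(1)]
  obtain r where r: "\<forall>j\<in>I - {i}. u j = r * x j" using Suc.IH[OF pos D(2)[OF i(2)]] ..
  then have "es_ratio (I - {i}) a x u $ Suc 0 = r * es_ratio (I - {i}) a x u $ 0"
    by (intro es_ratio_radial[OF pos a]) auto
  then have "u i = r * x i"
    using D(1) es_ratio_nth_0_pos[OF pos a, of u] by simp
  then show ?case using r by blast
qed

lemma es_ratio_not_affine:
  assumes "2 \<le> a" "many_pos a I x" and u: "\<exists>i\<in>I. u i \<noteq> 0"
  shows "es_ratio I a x u $ Suc 0 \<noteq> 0 \<or> es_ratio I a x u $ 2 < 0"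
proof (rule ccontr)
  assume affine: "\<not> ?thesis"
  have a: "1 \<le> a" using assms(1) by simp
  have "es_ratio I a x u $ 2 = 0"
    using affine es_ratio_concave[OF a assms(2), of u] by simp
  then obtain r where r: "\<forall>i\<in>I. u i = r * x i"
    using es_ratio_nth_2_eq_0_imp_radial[OF assms(1,2)] by blast
  then have "r * es_ratio I a x u $ 0 = 0"
    using es_ratio_radial[OF assms(2) a, of u r] affine by simp
  then show False using es_ratio_nth_0_pos[OF assms(2) a, of u] r u by auto
qed

definition slope_energy :: "real fps \<Rightarrow> real" where
  "slope_energy q = (q $ Suc 0)\<^sup>2 / q $ 0"

definition penalized_concavity :: "real fps \<Rightarrow> real" where
  "penalized_concavity q = 16 * slope_energy q - 2 * q $ 2"

lemma slope_energy_nonneg: "0 < q $ 0 \<Longrightarrow> 0 \<le> slope_energy q"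
  by (simp add: slope_energy_def)

lemma penalized_concavity_mult_pos:
  fixes p q :: "real fps"
  assumes q: "0 < q $ 0" "q $ 2 \<le> 0" and p: "0 < p $ 0" "p $ 2 \<le> 0"
    and strict: "q $ Suc 0 \<noteq> 0 \<or> q $ 2 < 0"
  shows "0 < penalized_concavity (q * p)"
proof -
  define s t where "s = q $ Suc 0 * p $ 0" and "t = q $ 0 * p $ Suc 0"
  have nth: "(q * p) $ 0 = q $ 0 * p $ 0" "(q * p) $ Suc 0 = s + t"
    "(q * p) $ 2 = q $ 0 * p $ 2 + s * t / (q $ 0 * p $ 0) + q $ 2 * p $ 0"
    using q p by (simp_all add: s_def t_def fps_mult_nth_Suc_0 fps_mult_nth_2)
  have "16 * (s + t)\<^sup>2 - 2 * (s * t) = s\<^sup>2 + (15 * (s + t)\<^sup>2 + t\<^sup>2)"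
    by (simp add: power2_eq_square algebra_simps)
  then have "s\<^sup>2 \<le> 16 * (s + t)\<^sup>2 - 2 * (s * t)"
    using zero_le_power2[of "s + t"] zero_le_power2[of t] by linarith
  then have "s\<^sup>2 / (q $ 0 * p $ 0) \<le> (16 * (s + t)\<^sup>2 - 2 * (s * t)) / (q $ 0 * p $ 0)"
    using q p by (intro divide_right_mono) auto
  then have "s\<^sup>2 / (q $ 0 * p $ 0) - 2 * (q $ 2 * p $ 0) - 2 * (q $ 0 * p $ 2)
      \<le> penalized_concavity (q * p)"
    unfolding penalized_concavity_def slope_energy_def nth diff_divide_distrib by simp
  moreover have "0 \<le> s\<^sup>2 / (q $ 0 * p $ 0)" "q $ 2 * p $ 0 \<le> 0" "q $ 0 * p $ 2 \<le> 0"
    using q p by (auto simp: mult_nonneg_nonpos mult_nonpos_nonneg)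
  moreover have "0 < s\<^sup>2 / (q $ 0 * p $ 0) \<or> q $ 2 * p $ 0 < 0"
    using strict q p by (auto simp: s_def mult_neg_pos)
  ultimately show ?thesis by linarith
qed

text \<open>The first-order term makes up for the radial direction, in which \<open>\<sigma>\<^sub>a / \<sigma>\<^sub>b\<close> is not strictly concave.\<close>
lemma penalized_concavity_es_quotient_pos:
  assumes "2 \<le> a" and pos: "many_pos a I x" and b: "b = a - 1 \<or> b = a - 2" and u: "\<exists>i\<in>I. u i \<noteq> 0"
  defines "G \<equiv> es I (int a) (line x u) * inverse (es I (int b) (line x u))"
  shows "0 < penalized_concavity G"
proof -
  define q p where "q = es_ratio I a x u" and "p = (if b = a - 1 then 1 else es_ratio I (a - 1) x u)"
  have a: "1 \<le> a" "1 \<le> a - 1" "int a - 1 = int (a - 1)" "int (a - 1) - 1 = int (a - 2)"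
    using assms(1) by auto
  have pos': "many_pos (a - 1) I x" using pos by (rule many_pos_mono) simp
  have "G = q * p"
  proof (cases "b = a - 1")
    case True
    then show ?thesis by (simp add: G_def q_def p_def es_ratio_def a)
  next
    case False
    have "es I (int (a - 1)) x \<noteq> 0" using es_pos[OF pos' order_refl] by simp
    then have "inverse (es I (int (a - 1)) (line x u)) * es I (int (a - 1)) (line x u) = 1"
      by (intro inverse_mult_eq_1) simp
    then show ?thesis
      using False b unfolding G_def q_def p_def es_ratio_def a by (simp add: mult.assoc[symmetric])
  qed
  moreover have "0 < p $ 0" "p $ 2 \<le> 0"
    using es_ratio_nth_0_pos[OF pos' a(2)] es_ratio_concave[OF a(2) pos'] by (auto simp: p_def)
  moreover have "0 < q $ 0" "q $ 2 \<le> 0" "q $ Suc 0 \<noteq> 0 \<or> q $ 2 < 0"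
    unfolding q_def
    by (rule es_ratio_nth_0_pos[OF pos a(1)] es_ratio_concave[OF a(1) pos]
        es_ratio_not_affine[OF assms(1) pos u])+
  ultimately show ?thesis using penalized_concavity_mult_pos by simp
qed

subsection \<open>Straightening the inverses of the large variables\<close>

text \<open>The claim with \<open>16\<close> for \<open>K\<close> and \<open>3/2\<close> for \<open>1 + \<delta>\<close>, except that the last sum only runs over the variables
  after the gap \<open>\<lambda>\<^sub>s > \<lambda>\<^sub>s\<^sub>+\<^sub>1\<close> and that its denominators are enlarged to \<open>\<lambda>\<^sub>1\<close>.\<close>
definition gap_inequality :: "nat \<Rightarrow> nat \<Rightarrow> nat \<Rightarrow> nat \<Rightarrow> (nat \<Rightarrow> real) \<Rightarrow> (nat \<Rightarrow> real) \<Rightarrow> bool" where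
  "gap_inequality n k l s x u \<longleftrightarrow> (let F = sigma_quot n k l in
    3 / 2 * (pderiv1 1 F x * (u 1)\<^sup>2 / x 1)
      \<le> - (\<Sum>i=1..n. \<Sum>j=1..n. pderiv2 i j F x * u i * u j)
        + 16 / F x * (\<Sum>i=1..n. pderiv1 i F x * u i)\<^sup>2
        + (\<Sum>i=s+1..n. 2 * pderiv1 i F x * (u i)\<^sup>2 / x 1))"

lemma gap_inequality_cong:
  assumes "\<And>i. i \<in> {1..n} \<Longrightarrow> u i = v i" "1 \<le> n"
  shows "gap_inequality n k l s x u \<longleftrightarrow> gap_inequality n k l s x v"
  using assms by (simp add: gap_inequality_def cong: sum.cong_simp)

lemma gap_inequality_scale:
  assumes "d \<noteq> 0"
  shows "gap_inequality n k l s x (\<lambda>i. d * u i) \<longleftrightarrow> gap_inequality n k l s x u"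
proof -
  define F where "F = sigma_quot n k l"
  define a Q L S where "a = 3 / 2 * (pderiv1 1 F x * (u 1)\<^sup>2 / x 1)"
    and "Q = (\<Sum>i=1..n. \<Sum>j=1..n. pderiv2 i j F x * u i * u j)"
    and "L = (\<Sum>i=1..n. pderiv1 i F x * u i)"
    and "S = (\<Sum>i=s+1..n. 2 * pderiv1 i F x * (u i)\<^sup>2 / x 1)"
  have "3 / 2 * (pderiv1 1 F x * (d * u 1)\<^sup>2 / x 1) = d\<^sup>2 * a"
    "(\<Sum>i=1..n. \<Sum>j=1..n. pderiv2 i j F x * (d * u i) * (d * u j)) = d\<^sup>2 * Q"
    "(\<Sum>i=1..n. pderiv1 i F x * (d * u i)) = d * L"
    "(\<Sum>i=s+1..n. 2 * pderiv1 i F x * (d * u i)\<^sup>2 / x 1) = d\<^sup>2 * S"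
    by (simp_all add: a_def Q_def L_def S_def sum_distrib_left power_mult_distrib power2_eq_square mult_ac)
  then have "gap_inequality n k l s x (\<lambda>i. d * u i)
    \<longleftrightarrow> d\<^sup>2 * a \<le> d\<^sup>2 * (- Q + 16 / F x * L\<^sup>2 + S)"
    unfolding gap_inequality_def F_def[symmetric] Let_def by (simp add: algebra_simps)
  also have "\<dots> \<longleftrightarrow> a \<le> - Q + 16 / F x * L\<^sup>2 + S"
    using assms by (intro mult_le_cancel_left_pos) simp
  finally show ?thesis
    by (simp only: gap_inequality_def[of n k l s x u] Let_def F_def a_def Q_def L_def S_def)
qed

text \<open>\<open>\<sigma>\<^sub>s\<^sub>+\<^sub>b\<close> of the variables \<open>1 / (t c\<^sub>i)\<close> for \<open>i \<le> s\<close> and \<open>c\<^sub>i\<close> for \<open>i > s\<close>, divided by the product of the former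
  and by \<open>t\<^sup>r\<close>, where \<open>r\<close> is the first \<open>j\<close> with \<open>b + j \<ge> 0\<close>.\<close>
definition flip_es :: "nat \<Rightarrow> nat \<Rightarrow> nat \<Rightarrow> int \<Rightarrow> real \<Rightarrow> (nat \<Rightarrow> real fps) \<Rightarrow> real fps" where
  "flip_es s n r b t c
      = (\<Sum>j=r..s. fps_const (t ^ (j - r)) * (es {1..s} (int j) c * es {s+1..n} (b + int j) c))"

definition flip_quot :: "nat \<Rightarrow> nat \<Rightarrow> int \<Rightarrow> int \<Rightarrow> real \<Rightarrow> (nat \<Rightarrow> real fps) \<Rightarrow> real fps" where
  "flip_quot s n a b t c = flip_es s n (nat (- a)) a t c * inverse (flip_es s n (nat (- b)) b t c)"

definition flip_curve :: "nat \<Rightarrow> real \<Rightarrow> real \<Rightarrow> (nat \<Rightarrow> real fps) \<Rightarrow> nat \<Rightarrow> real fps" where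
  "flip_curve s h t c i = fps_const h * (if i \<le> s then inverse (fps_const t * c i) else c i)"

lemma es_flip_curve:
  assumes s: "s \<le> n" and t: "t \<noteq> 0" and c: "\<And>i. i \<in> {1..s} \<Longrightarrow> c i $ 0 \<noteq> 0"
  shows "es {1..n} (int s + b) (flip_curve s h t c)
    = fps_const (h ^ nat (int s + b) * t ^ nat (- b)) * ((\<Prod>i=1..s. flip_curve s 1 t c i)
        * flip_es s n (nat (- b)) b t c)"
proof -
  let ?r = "nat (- b)"
  have inv: "flip_curve s 1 t c i * (fps_const t * c i) = 1" if "i \<in> {1..s}" for i
    using t c[OF that] that by (auto simp: flip_curve_def inverse_mult_eq_1)
  have "{1..n} = {1..s} \<union> {s+1..n}" using s by auto
  then have "es {1..n} (int s + b) (flip_curve s 1 t c)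
      = es ({1..s} \<union> {s+1..n}) (int (card {1..s}) + b) (flip_curve s 1 t c)"
    by simp
  also have "\<dots> = (\<Prod>i=1..s. flip_curve s 1 t c i) *
      (\<Sum>j\<le>card {1..s}. es {1..s} (int j) (\<lambda>i. fps_const t * c i)
        * es {s+1..n} (b + int j) (flip_curve s 1 t c))"
    by (rule es_Un_reciprocal) (use inv in auto)
  also have "(\<Sum>j\<le>card {1..s}. es {1..s} (int j) (\<lambda>i. fps_const t * c i)
      * es {s+1..n} (b + int j) (flip_curve s 1 t c))
      = (\<Sum>j\<le>s. fps_const (t ^ j) * (es {1..s} (int j) c * es {s+1..n} (b + int j) c))"
    using es_cong[of "{s+1..n}" "flip_curve s 1 t c" c]
    by (simp add: es_scale fps_const_power flip_curve_def mult.assoc)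
  also have "\<dots> = (\<Sum>j=?r..s. fps_const (t ^ j) * (es {1..s} (int j) c * es {s+1..n} (b + int j) c))"
    by (rule sum.mono_neutral_right) (auto simp: es_neg)
  also have "\<dots> = fps_const (t ^ ?r) * flip_es s n ?r b t c"
    unfolding flip_es_def sum_distrib_left
  proof (intro sum.cong refl)
    fix j assume "j \<in> {?r..s}"
    then have "t ^ j = t ^ ?r * t ^ (j - ?r)" by (simp flip: power_add)
    then show "fps_const (t ^ j) * (es {1..s} (int j) c * es {s+1..n} (b + int j) c)
      = fps_const (t ^ ?r) * (fps_const (t ^ (j - ?r)) * (es {1..s} (int j) c
          * es {s+1..n} (b + int j) c))"
      by (simp add: mult.assoc[symmetric])
  qed
  finally have "es {1..n} (int s + b) (flip_curve s 1 t c)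
      = fps_const (t ^ ?r) * ((\<Prod>i=1..s. flip_curve s 1 t c i) * flip_es s n ?r b t c)"
    by (simp add: mult_ac)
  moreover have "flip_curve s h t c = (\<lambda>i. fps_const h * flip_curve s 1 t c i)"
    by (auto simp: flip_curve_def)
  ultimately show ?thesis
    by (simp add: es_scale fps_const_power mult.assoc[symmetric])
qed

lemma sigma_quot_fps_flip_curve:
  assumes k: "int k = int s + a" and l: "int l = int s + b" "l \<le> k" and s: "s \<le> n"
    and h: "h \<noteq> 0" and t: "t \<noteq> 0" and c: "\<And>i. i \<in> {1..s} \<Longrightarrow> c i $ 0 \<noteq> 0"
  shows "sigma_quot_fps n k l (flip_curve s h t c)
    = fps_const (h ^ (k - l) * t ^ nat (- a) / t ^ nat (- b)) * flip_quot s n a b t c"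
proof -
  define P where "P = (\<Prod>i=1..s. flip_curve s 1 t c i)"
  have "P $ 0 \<noteq> 0" using t c by (simp add: P_def fps_prod_nth_0 flip_curve_def)
  then have P: "P * inverse P = 1" by (rule inverse_mult_eq_1')
  have num: "es {1..n} (int k) (flip_curve s h t c)
      = fps_const (h ^ k * t ^ nat (- a)) * (P * flip_es s n (nat (- a)) a t c)"
    using es_flip_curve[OF s t c, where b = a and h = h] by (simp add: P_def flip: k)
  have denom: "es {1..n} (int l) (flip_curve s h t c)
      = fps_const (h ^ l * t ^ nat (- b)) * (P * flip_es s n (nat (- b)) b t c)"
    using es_flip_curve[OF s t c, where b = b and h = h] by (simp add: P_def flip: l(1))
  have "sigma_quot_fps n k l (flip_curve s h t c) = P * inverse P *
     (fps_const (h ^ k * t ^ nat (- a)) * inverse (fps_const (h ^ l * t ^ nat (- b))))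
       * flip_quot s n a b t c"
    unfolding sigma_quot_fps_def num denom flip_quot_def by (simp add: fps_inverse_mult mult_ac)
  also have "fps_const (h ^ k * t ^ nat (- a)) * inverse (fps_const (h ^ l * t ^ nat (- b)))
     = fps_const (h ^ (k - l) * t ^ nat (- a) / t ^ nat (- b))"
    using h l(2) by (simp add: fps_const_inverse power_diff divide_inverse)
  finally show ?thesis by (simp add: P)
qed

definition unitv :: "'i \<Rightarrow> 'i \<Rightarrow> real" where
  "unitv i = (\<lambda>j. of_bool (j = i))"

definition flip_partial :: "nat \<Rightarrow> nat \<Rightarrow> int \<Rightarrow> int \<Rightarrow> real \<Rightarrow> (nat \<Rightarrow> real) \<Rightarrow> nat \<Rightarrow> real" where
  "flip_partial s n a b t z i = flip_quot s n a b t (line z (unitv i)) $ Suc 0"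

text \<open>The sum over \<open>i \<le> s\<close> is what the curvature of the flipped line contributes to the second derivative.\<close>
definition flip_inequality :: "nat \<Rightarrow> nat \<Rightarrow> int \<Rightarrow> int \<Rightarrow> real \<Rightarrow> (nat \<Rightarrow> real) \<Rightarrow> (nat \<Rightarrow> real) \<Rightarrow> bool" where
  "flip_inequality s n a b t z w \<longleftrightarrow>
    (let q = flip_quot s n a b t (line z w); d = flip_partial s n a b t z in
    3 / 2 * (- d 1 * ((w 1)\<^sup>2 / z 1)) \<le> penalized_concavity q
      + 2 * (\<Sum>i=1..s. - d i * ((w i)\<^sup>2 / z i)) + 2 * t * z 1 * (\<Sum>i=s+1..n. d i * (w i)\<^sup>2))"

lemma inverse_line_nth:
  assumes "x i \<noteq> 0"
  shows "inverse (line x u i) $ 0 = 1 / x i" "inverse (line x u i) $ Suc 0 = - u i / (x i)\<^sup>2"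
    "inverse (line x u i) $ 2 = (u i)\<^sup>2 / (x i) ^ 3"
proof -
  have "inverse (line x u i) * line x u i = 1" using assms by (simp add: inverse_mult_eq_1)
  note nth = fps_quotient_nth[OF this, unfolded line_nth, OF assms]
  show at_0: "inverse (line x u i) $ 0 = 1 / x i" using nth(1) by simp
  show at_1: "inverse (line x u i) $ Suc 0 = - u i / (x i)\<^sup>2" unfolding nth(2) at_0
    by (simp add: power2_eq_square)
  show "inverse (line x u i) $ 2 = (u i)\<^sup>2 / (x i) ^ 3"
    unfolding nth(3) at_1 by (simp add: power2_eq_square power3_eq_cube)
qed

context
  fixes n k l s :: nat and a b :: int and h t factor :: real and x z slope :: "nat \<Rightarrow> real"
  assumes k: "int k = int s + a" and l: "int l = int s + b" "l \<le> k" and s: "1 \<le> s" "s \<le> n"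
    and h: "0 < h" and t: "0 < t" and z: "\<And>i. i \<in> {1..s} \<Longrightarrow> 0 < z i"
    and x: "\<And>i. i \<in> {1..n} \<Longrightarrow> x i = h * (if i \<le> s then 1 / (t * z i) else z i)"
    and denom: "es {1..n} (int l) x \<noteq> 0"
  defines "slope \<equiv> \<lambda>i. h * (if i \<le> s then - 1 / (t * (z i)\<^sup>2) else 1)"
    and "factor \<equiv> h ^ (k - l) * t ^ nat (- a) / t ^ nat (- b)"
begin

lemma flip_curve_line_nth:
  assumes "i \<in> {1..n}"
  shows "flip_curve s h t (line z w) i $ 0 = x i"
    and "flip_curve s h t (line z w) i $ Suc 0 = slope i * w i"
    and "flip_curve s h t (line z w) i $ 2 = (if i \<le> s then slope i * (- (w i)\<^sup>2 / z i) else 0)"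
  using assms x z[of i] inverse_line_nth[of z i w] t
  by (auto simp: flip_curve_def slope_def fps_inverse_mult fps_const_inverse power2_eq_square
    power3_eq_cube field_simps)

lemma sigma_quot_fps_flip_line:
  "sigma_quot_fps n k l (flip_curve s h t (line z w))
      = fps_const factor * flip_quot s n a b t (line z w)"
  unfolding factor_def
  by (rule sigma_quot_fps_flip_curve[OF k l s(2)]) (use h t z in \<open>force+\<close>)

lemma factor_pos: "0 < factor"
  using h t by (simp add: factor_def)

lemma pderiv1_flip:
  assumes i: "i \<in> {1..n}"
  shows "pderiv1 i (sigma_quot n k l) x * slope i = factor * flip_partial s n a b t z i"
proof -
  let ?c = "flip_curve s h t (line z (unitv i))"
  have "pderiv1 i (sigma_quot n k l) x * slope i
      = (\<Sum>j=1..n. pderiv1 j (sigma_quot n k l) x * (slope j * unitv i j))"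
    using i by (simp add: unitv_def of_bool_def if_distrib cong: if_cong)
  also have "\<dots> = (\<Sum>j=1..n. pderiv1 j (sigma_quot n k l) x * ?c j $ Suc 0)"
    by (intro sum.cong refl) (simp add: flip_curve_line_nth)
  also have "\<dots> = sigma_quot_fps n k l ?c $ Suc 0"
    by (rule sum_pderiv1_sigma_quot[OF denom]) (rule flip_curve_line_nth)
  finally show ?thesis by (simp add: sigma_quot_fps_flip_line flip_partial_def)
qed

lemma pderiv1_flip_large:
  assumes i: "i \<in> {1..s}"
  shows "pderiv1 i (sigma_quot n k l) x * (slope i * v)\<^sup>2 / x i
      = factor * (- flip_partial s n a b t z i * (v\<^sup>2 / z i))"
proof -
  have "slope i / x i = - 1 / z i"
    using i s h t z[OF i] x[of i] by (simp add: slope_def power2_eq_square)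
  moreover have "pderiv1 i (sigma_quot n k l) x * (slope i * v)\<^sup>2 / x i
      = (pderiv1 i (sigma_quot n k l) x * slope i) * v\<^sup>2 * (slope i / x i)"
    by (simp add: power2_eq_square)
  ultimately show ?thesis using pderiv1_flip[of i] i s by simp
qed

lemma pderiv1_flip_small:
  assumes i: "i \<in> {s+1..n}"
  shows "2 * pderiv1 i (sigma_quot n k l) x * (slope i * v)\<^sup>2 / x 1
    = factor * (2 * t * z 1 * (flip_partial s n a b t z i * v\<^sup>2))"
proof -
  have "slope i / x 1 = t * z 1"
    using i s h t z[of 1] x[of 1] by (simp add: slope_def)
  moreover have "2 * pderiv1 i (sigma_quot n k l) x * (slope i * v)\<^sup>2 / x 1
      = 2 * (pderiv1 i (sigma_quot n k l) x * slope i) * v\<^sup>2 * (slope i / x 1)"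
    by (simp add: power2_eq_square)
  ultimately show ?thesis using pderiv1_flip[of i] i by simp
qed

lemma sigma_quot_flip: "sigma_quot n k l x = factor * flip_quot s n a b t (line z w) $ 0"
  using sigma_quot_fps_nth_0[OF denom, of "flip_curve s h t (line z w)" k] flip_curve_line_nth(1)
  by (simp add: sigma_quot_fps_flip_line)

lemma sum_pderiv1_flip:
  "(\<Sum>i=1..n. pderiv1 i (sigma_quot n k l) x * (slope i * w i))
      = factor * flip_quot s n a b t (line z w) $ Suc 0"
proof -
  have "(\<Sum>i=1..n. pderiv1 i (sigma_quot n k l) x * (slope i * w i))
      = (\<Sum>i=1..n. pderiv1 i (sigma_quot n k l) x * flip_curve s h t (line z w) i $ Suc 0)"
    by (intro sum.cong refl) (simp add: flip_curve_line_nth(2))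
  also have "\<dots> = sigma_quot_fps n k l (flip_curve s h t (line z w)) $ Suc 0"
    by (rule sum_pderiv1_sigma_quot[OF denom flip_curve_line_nth(1)])
  finally show ?thesis by (simp add: sigma_quot_fps_flip_line)
qed

lemma sum_pderiv2_flip:
  "(\<Sum>i=1..n. \<Sum>j=1..n. pderiv2 i j (sigma_quot n k l) x * (slope i * w i) * (slope j * w j))
    = factor * (2 * flip_quot s n a b t (line z w) $ 2
      - 2 * (\<Sum>i=1..s. - flip_partial s n a b t z i * ((w i)\<^sup>2 / z i)))"
proof -
  let ?c = "flip_curve s h t (line z w)"
  have "(\<Sum>i=1..n. pderiv1 i (sigma_quot n k l) x * ?c i $ 2)
      = (\<Sum>i=1..s. pderiv1 i (sigma_quot n k l) x * ?c i $ 2)"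
    using s(2) by (intro sum.mono_neutral_right) (auto simp: flip_curve_line_nth(3))
  also have "\<dots> = (\<Sum>i=1..s. factor * (- flip_partial s n a b t z i * ((w i)\<^sup>2 / z i)))"
  proof (intro sum.cong refl)
    fix i assume "i \<in> {1..s}"
    then have i: "i \<in> {1..n}" "i \<le> s" using s(2) by auto
    have "pderiv1 i (sigma_quot n k l) x * ?c i $ 2
        = (pderiv1 i (sigma_quot n k l) x * slope i) * (- (w i)\<^sup>2 / z i)"
      using i by (simp add: flip_curve_line_nth(3))
    then show "pderiv1 i (sigma_quot n k l) x * ?c i $ 2
        = factor * (- flip_partial s n a b t z i * ((w i)\<^sup>2 / z i))"
      unfolding pderiv1_flip[OF i(1)] by simp
  qed
  finally have bend: "(\<Sum>i=1..n. pderiv1 i (sigma_quot n k l) x * ?c i $ 2)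
      = factor * (\<Sum>i=1..s. - flip_partial s n a b t z i * ((w i)\<^sup>2 / z i))"
    by (simp only: sum_distrib_left)
  have "(\<Sum>i=1..n. \<Sum>j=1..n. pderiv2 i j (sigma_quot n k l) x * (slope i * w i) * (slope j * w j))
    = (\<Sum>i=1..n. \<Sum>j=1..n. pderiv2 i j (sigma_quot n k l) x * ?c i $ Suc 0 * ?c j $ Suc 0)"
    by (intro sum.cong refl) (simp add: flip_curve_line_nth(2))
  then show ?thesis
    using sum_pderiv2_sigma_quot[OF denom, of ?c k] flip_curve_line_nth(1) bend
    by (simp add: sigma_quot_fps_flip_line algebra_simps del: One_nat_def)
qed

lemma gap_inequality_flip:
  assumes "flip_inequality s n a b t z w"
  shows "gap_inequality n k l s x (\<lambda>i. slope i * w i)"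
proof -
  define q d where "q = flip_quot s n a b t (line z w)" and "d = flip_partial s n a b t z"
  have ineq: "factor * (3 / 2 * (- d 1 * ((w 1)\<^sup>2 / z 1))) \<le> factor * (penalized_concavity q
      + 2 * (\<Sum>i=1..s. - d i * ((w i)\<^sup>2 / z i)) + 2 * t * z 1 * (\<Sum>i=s+1..n. d i * (w i)\<^sup>2))"
    using assms factor_pos unfolding flip_inequality_def q_def[symmetric] d_def[symmetric] Let_def
    by (intro mult_left_mono) auto
  have large: "pderiv1 1 (sigma_quot n k l) x * (slope 1 * w 1)\<^sup>2 / x 1
      = factor * (- d 1 * ((w 1)\<^sup>2 / z 1))"
    unfolding d_def by (rule pderiv1_flip_large) (use s(1) in simp)
  have small: "(\<Sum>i=s+1..n. 2 * pderiv1 i (sigma_quot n k l) x * (slope i * w i)\<^sup>2 / x 1)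
      = factor * (2 * t * z 1 * (\<Sum>i=s+1..n. d i * (w i)\<^sup>2))"
    unfolding sum_distrib_left d_def by (intro sum.cong refl pderiv1_flip_small)
  have square: "16 / (factor * q $ 0) * (factor * q $ Suc 0)\<^sup>2 = factor * (16 * slope_energy q)"
    using factor_pos by (simp add: slope_energy_def power2_eq_square)
  show ?thesis
    using ineq unfolding gap_inequality_def Let_def sum_pderiv1_flip sum_pderiv2_flip
      sigma_quot_flip[of w]
      large small q_def[symmetric] d_def[symmetric] square penalized_concavity_def
    by (simp add: algebra_simps del: One_nat_def)
qed

end

subsection \<open>Compactness\<close>

lemma compact_lower_bound:
  fixes g h :: "'a::topological_space \<Rightarrow> real"
  assumes K: "compact K" and g: "continuous_on K g" and h: "continuous_on K h"
    and h_nonneg: "\<And>p. p \<in> K \<Longrightarrow> 0 \<le> h p" and pos: "\<And>p. p \<in> K \<Longrightarrow> h p = 0 \<Longrightarrow> 0 < g p"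
  shows "\<exists>\<epsilon>>0. \<exists>C\<ge>0. \<forall>p\<in>K. \<epsilon> - C * h p \<le> g p"
proof -
  have sublevel: "compact (K \<inter> f -` {..y})" if "continuous_on K f" for f :: "'a \<Rightarrow> real" and y
    by (intro closedin_compact[OF K] continuous_closedin_preimage that closed_atMost)
  have min_pos: "\<exists>\<epsilon>>0. \<forall>p\<in>L. \<epsilon> \<le> f p"
    if "compact L" "continuous_on L f" "\<And>p. p \<in> L \<Longrightarrow> 0 < f p" for L and f :: "'a \<Rightarrow> real"
  proof (cases "L = {}")
    case False
    then show ?thesis using continuous_attains_inf[OF that(1) False that(2)] that(3) by blast
  qed (auto intro: exI[of _ 1])
  let ?Z = "K \<inter> h -` {..0}"
  have "\<exists>\<epsilon>>0. \<forall>p\<in>?Z. \<epsilon> \<le> g p"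
    using h_nonneg pos
    by (intro min_pos sublevel[OF h] continuous_on_subset[OF g]) (auto intro: antisym)
  then obtain \<epsilon> where \<epsilon>: "0 < \<epsilon>" "\<And>p. p \<in> ?Z \<Longrightarrow> \<epsilon> \<le> g p" by blast
  let ?S = "K \<inter> g -` {..\<epsilon> / 2}"
  have "0 < h p" if "p \<in> ?S" for p
    using \<epsilon>(2)[of p] \<epsilon>(1) h_nonneg[of p] that by (cases "h p = 0") (auto simp: less_le)
  then have "\<exists>\<eta>>0. \<forall>p\<in>?S. \<eta> \<le> h p"
    by (intro min_pos sublevel[OF g] continuous_on_subset[OF h]) auto
  then obtain \<eta> where \<eta>: "0 < \<eta>" "\<And>p. p \<in> ?S \<Longrightarrow> \<eta> \<le> h p" by blast
  obtain B where B: "\<And>p. p \<in> K \<Longrightarrow> \<bar>g p\<bar> \<le> B"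
    using compact_imp_bounded[OF compact_continuous_image[OF g K]] by (auto simp: bounded_iff)
  define C where "C = (\<epsilon> / 2 + \<bar>B\<bar>) / \<eta>"
  have C: "0 \<le> C" using \<epsilon>(1) \<eta>(1) by (simp add: C_def)
  have "\<epsilon> / 2 - C * h p \<le> g p" if p: "p \<in> K" for p
  proof (cases "g p \<le> \<epsilon> / 2")
    case True
    then have "C * \<eta> \<le> C * h p" using \<eta>(2) p C by (intro mult_left_mono) auto
    moreover have "C * \<eta> = \<epsilon> / 2 + \<bar>B\<bar>" using \<eta>(1) by (simp add: C_def)
    ultimately show ?thesis using B[OF p] by linarith
  next
    case False
    then show ?thesis using mult_nonneg_nonneg[OF C h_nonneg[OF p]] by linarith
  qed
  then show ?thesis using \<epsilon>(1) C by (intro exI[of _ "\<epsilon> / 2"] exI[of _ C] conjI) auto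
qed

lemma compact_lower_bound_family:
  fixes g :: "'i \<Rightarrow> 'a::topological_space \<Rightarrow> real"
  assumes "finite I" and K: "compact K" and g: "\<And>i. i \<in> I \<Longrightarrow> continuous_on K (g i)"
    and h: "continuous_on K h"
    and h_nonneg: "\<And>p. p \<in> K \<Longrightarrow> 0 \<le> h p" and pos: "\<And>i p. i \<in> I \<Longrightarrow> p \<in> K \<Longrightarrow> h p = 0 \<Longrightarrow> 0 < g i p"
  shows "\<exists>\<epsilon>>0. \<exists>C\<ge>0. \<forall>i\<in>I. \<forall>p\<in>K. \<epsilon> - C * h p \<le> g i p"
  using assms(1) g pos
proof (induction I rule: finite_induct)
  case empty
  then show ?case by (auto intro: exI[of _ 1])
next
  case (insert j I)
  obtain \<epsilon> C where \<epsilon>: "0 < \<epsilon>" and C: "0 \<le> C" and I: "\<And>i p. i \<in> I \<Longrightarrow> p \<in> K \<Longrightarrow> \<epsilon> - C * h p \<le> g i p"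
    using insert by blast
  obtain \<epsilon>' C' where \<epsilon>': "0 < \<epsilon>'" and C': "0 \<le> C'" and j: "\<And>p. p \<in> K \<Longrightarrow> \<epsilon>' - C' * h p \<le> g j p"
    using compact_lower_bound[OF K _ h h_nonneg, of "g j"] insert.prems by blast
  have "min \<epsilon> \<epsilon>' - max C C' * h p \<le> g i p" if i: "i \<in> insert j I" and p: "p \<in> K" for i p
  proof -
    have "C * h p \<le> max C C' * h p" "C' * h p \<le> max C C' * h p"
      using h_nonneg[OF p] by (auto intro: mult_right_mono)
    then show ?thesis using I[OF _ p, of i] j[OF p] i by auto
  qed
  then show ?case using \<epsilon> \<epsilon>' C by (intro exI[of _ "min \<epsilon> \<epsilon>'"] exI[of _ "max C C'"] conjI) auto
qed

lemma small_threshold: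
  fixes \<epsilon> C \<epsilon>' C' :: real
  assumes "0 < \<epsilon>" "0 \<le> C" "0 < \<epsilon>'" "0 \<le> C'"
  obtains \<rho> where "0 < \<rho>" "\<And>t. 0 \<le> t \<Longrightarrow> t \<le> \<rho> \<Longrightarrow> t \<le> 1 \<and> C * t \<le> \<epsilon> \<and> C' * t \<le> \<epsilon>'"
proof
  define \<rho> where "\<rho> = min 1 (min (\<epsilon> / (C + 1)) (\<epsilon>' / (C' + 1)))"
  show "0 < \<rho>" using assms by (simp add: \<rho>_def)
  fix t assume t: "0 \<le> t" "t \<le> \<rho>"
  then have "t \<le> 1" "t \<le> \<epsilon> / (C + 1)" "t \<le> \<epsilon>' / (C' + 1)" by (simp_all add: \<rho>_def)
  then have "t \<le> 1" "t * (C + 1) \<le> \<epsilon>" "t * (C' + 1) \<le> \<epsilon>'" using assms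
    by (simp_all add: pos_le_divide_eq)
  then show "t \<le> 1 \<and> C * t \<le> \<epsilon> \<and> C' * t \<le> \<epsilon>'" using t(1) by (simp add: distrib_left mult.commute)
qed

lemma compact_box:
  fixes l u :: "'i \<Rightarrow> real"
  shows "compact {z. \<forall>i. z i \<in> {l i..u i}}"
proof -
  have "compactin (product_topology (\<lambda>i. euclidean) UNIV) (Pi\<^sub>E UNIV (\<lambda>i. {l i..u i}))"
    by (simp add: compactin_PiE)
  moreover have "Pi\<^sub>E UNIV (\<lambda>i. {l i..u i}) = {z. \<forall>i. z i \<in> {l i..u i}}" by auto
  ultimately show ?thesis by (simp add: euclidean_product_topology)
qed

definition nth_continuous_on :: "'a::topological_space set \<Rightarrow> ('a \<Rightarrow> real fps) \<Rightarrow> bool" where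
  "nth_continuous_on K f \<longleftrightarrow> (\<forall>m. continuous_on K (\<lambda>p. f p $ m))"

lemma nth_continuous_onD: "nth_continuous_on K f \<Longrightarrow> continuous_on K (\<lambda>p. f p $ m)"
  by (simp add: nth_continuous_on_def)

lemma continuous_on_slope_energy:
  assumes "nth_continuous_on K q" "\<And>p. p \<in> K \<Longrightarrow> 0 < q p $ 0"
  shows "continuous_on K (\<lambda>p. slope_energy (q p))" "continuous_on K (\<lambda>p. penalized_concavity (q p))"
  unfolding penalized_concavity_def slope_energy_def using assms
  by (auto intro!: continuous_intros nth_continuous_onD simp: less_imp_neq[symmetric])

lemma nth_continuous_on_const [intro]:
  assumes "continuous_on K f"
  shows "nth_continuous_on K (\<lambda>p. fps_const (f p))"
proof -
  have "continuous_on K (\<lambda>p. if m = 0 then f p else 0)" for m :: nat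
    using assms by (cases "m = 0") auto
  then show ?thesis by (simp add: nth_continuous_on_def)
qed

lemma nth_continuous_on_constant [intro]: "nth_continuous_on K (\<lambda>p. f)"
  by (simp add: nth_continuous_on_def)

lemma nth_continuous_on_add [intro]:
  "nth_continuous_on K f \<Longrightarrow> nth_continuous_on K g \<Longrightarrow> nth_continuous_on K (\<lambda>p. f p + g p)"
  by (simp add: nth_continuous_on_def continuous_on_add)

lemma nth_continuous_on_diff [intro]:
  "nth_continuous_on K f \<Longrightarrow> nth_continuous_on K g \<Longrightarrow> nth_continuous_on K (\<lambda>p. f p - g p)"
  by (simp add: nth_continuous_on_def continuous_on_diff)

lemma nth_continuous_on_mult [intro]:
  "nth_continuous_on K f \<Longrightarrow> nth_continuous_on K g \<Longrightarrow> nth_continuous_on K (\<lambda>p. f p * g p)"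
  unfolding nth_continuous_on_def fps_mult_nth by (intro allI continuous_intros) auto

lemma nth_continuous_on_sum [intro]:
  "(\<And>i. i \<in> S \<Longrightarrow> nth_continuous_on K (f i)) \<Longrightarrow> nth_continuous_on K (\<lambda>p. \<Sum>i\<in>S. f i p)"
  unfolding nth_continuous_on_def fps_sum_nth by (intro allI continuous_intros) auto

lemma nth_continuous_on_prod [intro]:
  "(\<And>i. i \<in> S \<Longrightarrow> nth_continuous_on K (f i)) \<Longrightarrow> nth_continuous_on K (\<lambda>p. \<Prod>i\<in>S. f i p)"
  by (induction S rule: infinite_finite_induct) auto

lemma nth_continuous_on_inverse [intro]:
  assumes f: "nth_continuous_on K f" and nonzero: "\<And>p. p \<in> K \<Longrightarrow> f p $ 0 \<noteq> 0"
  shows "nth_continuous_on K (\<lambda>p. inverse (f p))"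
proof -
  have "continuous_on K (\<lambda>p. inverse (f p) $ m)" for m
  proof (induction m rule: less_induct)
    case (less m)
    show ?case
    proof (cases m)
      case 0
      then show ?thesis using nth_continuous_onD[OF f] nonzero by (auto intro!: continuous_intros)
    next
      case (Suc k)
      have "inverse (f p) $ m = - (\<Sum>i=1..m. f p $ i * inverse (f p) $ (m - i)) / f p $ 0"
        if p: "p \<in> K" for p
      proof -
        have "0 = (f p * inverse (f p)) $ m"
          using inverse_mult_eq_1'[OF nonzero[OF p]] Suc by simp
        also have "\<dots> = f p $ 0 * inverse (f p) $ m + (\<Sum>i=1..m. f p $ i * inverse (f p) $ (m - i))"
          unfolding fps_mult_nth by (simp add: sum.atLeast_Suc_atMost)
        finally show ?thesis using nonzero[OF p] by (simp add: field_simps)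
      qed
      moreover have "continuous_on K (\<lambda>p. - (\<Sum>i=1..m. f p $ i * inverse (f p) $ (m - i)) / f p $ 0)"
        using nonzero by (intro continuous_intros nth_continuous_onD[OF f] less.IH) auto
      ultimately show ?thesis by (simp cong: continuous_on_cong_simp)
    qed
  qed
  then show ?thesis by (simp add: nth_continuous_on_def)
qed

lemma nth_continuous_on_es [intro]:
  "(\<And>i. i \<in> I \<Longrightarrow> nth_continuous_on K (\<lambda>p. c p i)) \<Longrightarrow> nth_continuous_on K (\<lambda>p. es I j (c p))"
  unfolding es_def by (intro nth_continuous_on_sum nth_continuous_on_prod) auto

lemma nth_continuous_on_line [intro]:
  assumes "continuous_on K x" "continuous_on K u"
  shows "nth_continuous_on K (\<lambda>p. line (x p) (u p) i)"
  unfolding line_def using assms[THEN continuous_on_product_then_coordinatewise]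
  by (intro nth_continuous_on_add nth_continuous_on_mult nth_continuous_on_const
    nth_continuous_on_constant)

lemma nth_continuous_on_flip_es [intro]:
  assumes "continuous_on K t" "\<And>i. nth_continuous_on K (\<lambda>p. c p i)"
  shows "nth_continuous_on K (\<lambda>p. flip_es s n r b (t p) (c p))"
  unfolding flip_es_def using assms
  by (intro nth_continuous_on_sum nth_continuous_on_mult nth_continuous_on_const nth_continuous_on_es
      continuous_intros)

subsection \<open>The flipped inequality near the singular boundary\<close>

text \<open>The variables \<open>z\<^sub>i\<close> with \<open>i \<le> s\<close> are the inverses of the large variables, \<open>z\<^sub>s\<^sub>+\<^sub>1, \<dots>, z\<^sub>s\<^sub>+\<^sub>a\<close> the small
  variables that are comparable to \<open>1\<close>.\<close>
definition flip_box :: "nat \<Rightarrow> nat \<Rightarrow> nat \<Rightarrow> real \<Rightarrow> (nat \<Rightarrow> real) set" where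
  "flip_box s n a c = {z. \<forall>i. z i \<in> {if i \<in> {s+1..s+a} then c else 0..of_bool (i \<in> {1..n})}}"

text \<open>The bounds follow from the normalization, up to coordinates without influence; they make the set a box.\<close>
definition unit_directions :: "nat \<Rightarrow> (nat \<Rightarrow> real) set" where
  "unit_directions n
      = {w. \<forall>i. w i \<in> {- of_bool (i \<in> {1..n})..of_bool (i \<in> {1..n})}} \<inter> {w. (\<Sum>i=1..n. (w i)\<^sup>2) = 1}"

lemma compact_flip_box: "compact (flip_box s n a c)"
  unfolding flip_box_def by (rule compact_box)

lemma continuous_on_coordinate: "continuous_on S (\<lambda>w :: 'i \<Rightarrow> real. w i)"
  by (rule continuous_on_subset[OF continuous_on_product_coordinates]) simp

lemma compact_unit_directions: "compact (unit_directions n)"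
  unfolding unit_directions_def
  by (intro compact_Int_closed compact_box closed_Collect_eq continuous_intros continuous_on_coordinate)

lemma unit_directions_sum_small:
  assumes "w \<in> unit_directions n" "\<And>i. i \<in> {1..s} \<Longrightarrow> w i = 0" "s \<le> n"
  shows "(\<Sum>i=s+1..n. (w i)\<^sup>2) = 1"
proof -
  have "{1..n} = {1..s} \<union> {s+1..n}" using assms(3) by auto
  then have "(\<Sum>i=1..n. (w i)\<^sup>2) = (\<Sum>i=1..s. (w i)\<^sup>2) + (\<Sum>i=s+1..n. (w i)\<^sup>2)"
    by (simp add: sum.union_disjoint)
  then show ?thesis using assms(1,2) by (simp add: unit_directions_def)
qed

lemma flip_boxD:
  assumes "z \<in> flip_box s n a c" "0 \<le> c"
  shows "0 \<le> z i" and "i \<in> {s+1..s+a} \<Longrightarrow> c \<le> z i" and "z i \<le> 1"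
proof -
  have z: "z i \<in> {if i \<in> {s+1..s+a} then c else 0..of_bool (i \<in> {1..n})}"
    using assms(1) by (simp add: flip_box_def)
  then show "0 \<le> z i" using assms(2) by (auto split: if_splits)
  show "c \<le> z i" if "i \<in> {s+1..s+a}" using z that by simp
  show "z i \<le> 1" using z by (auto simp: of_bool_def split: if_splits)
qed

lemma flip_box_many_pos:
  assumes z: "z \<in> flip_box s n a c" and c: "0 < c" and "s + a \<le> n"
  shows "many_pos a {s+1..n} z"
proof -
  have "{s+1..s+a} \<subseteq> {i \<in> {s+1..n}. 0 < z i}"
    using flip_boxD(2)[OF z] c assms(3) by fastforce
  then have "card {s+1..s+a} \<le> card {i \<in> {s+1..n}. 0 < z i}"
    by (intro card_mono) auto
  then show ?thesis using flip_boxD(1)[OF z] c by (simp add: many_pos_def)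
qed

lemma flip_es_Suc:
  assumes "r \<le> s"
  shows "flip_es s n r b t c
    = es {1..s} (int r) c * es {s+1..n} (b + int r) c + fps_const t * flip_es s n (Suc r) b t c"
proof -
  have "fps_const (t ^ (j - r)) * f = fps_const t * (fps_const (t ^ (j - Suc r)) * f)"
    if "j \<in> {Suc r..s}" for j f
    using that by (simp add: Suc_diff_Suc mult.assoc[symmetric] flip: power_Suc)
  then show ?thesis
    using assms unfolding flip_es_def sum_distrib_left
    by (subst sum.atLeast_Suc_atMost) (auto intro!: sum.cong)
qed

lemma flip_es_nth_0_ge:
  assumes z: "z \<in> flip_box s n a c" "0 \<le> c" and t: "0 \<le> t" and r: "r \<le> s"
  shows "es {1..s} (int r) z * es {s+1..n} (b + int r) z \<le> flip_es s n r b t (line z w) $ 0"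
proof -
  have "0 \<le> t ^ (j - r) * (es {1..s} (int j) z * es {s+1..n} (b + int j) z)" for j
    using t flip_boxD(1)[OF z] by (intro mult_nonneg_nonneg es_nonneg) auto
  then have "t ^ (r - r) * (es {1..s} (int r) z * es {s+1..n} (b + int r) z)
      \<le> (\<Sum>j=r..s. t ^ (j - r) * (es {1..s} (int j) z * es {s+1..n} (b + int j) z))"
    using r by (intro member_le_sum) auto
  then show ?thesis by (simp add: flip_es_def fps_sum_nth)
qed

lemma flip_quot_mult:
  "flip_es s n (nat (- b)) b t c $ 0 \<noteq> 0 \<Longrightarrow>
    flip_quot s n a b t c * flip_es s n (nat (- b)) b t c = flip_es s n (nat (- a)) a t c"
  by (simp add: flip_quot_def fps_mult_inverse_cancel)

lemma nth_continuous_on_flip_quot: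
  assumes "continuous_on K t" "continuous_on K z" "continuous_on K w"
    and "\<And>p. p \<in> K \<Longrightarrow> flip_es s n (nat (- b)) b (t p) (line (z p) (w p)) $ 0 \<noteq> 0"
  shows "nth_continuous_on K (\<lambda>p. flip_quot s n a b (t p) (line (z p) (w p)))"
  unfolding flip_quot_def using assms
  by (intro nth_continuous_on_mult nth_continuous_on_inverse nth_continuous_on_flip_es
    nth_continuous_on_line)

lemma es_line_unitv_nth_Suc_0:
  assumes "finite I"
  shows "es I j (line z (unitv i)) $ Suc 0 = (if i \<in> I then es (I - {i}) (j - 1) z else 0)"
proof -
  have "es I j (line z (unitv i)) $ Suc 0 = (\<Sum>k\<in>I. unitv i k * es (I - {k}) (j - 1) z)"
    using es_fps_nth_Suc_0[OF assms, of "line z (unitv i)" z j] by (simp add: es_partial_def)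
  then show ?thesis
    using assms by (simp add: unitv_def of_bool_def if_distrib[of "\<lambda>c. c * _"] cong: if_cong)
qed

lemma flip_inequalityI:
  assumes "1 \<le> s" "0 \<le> t" and pos: "\<And>i. i \<in> {1..s} \<Longrightarrow> 0 < z i"
    and large: "\<And>i. i \<in> {1..s} \<Longrightarrow> flip_partial s n a b t z i \<le> 0"
    and small: "\<And>i. i \<in> {s+1..n} \<Longrightarrow> 0 \<le> flip_partial s n a b t z i"
    and main: "0 \<le> penalized_concavity (flip_quot s n a b t (line z w))
      + (\<Sum>i=1..s. - flip_partial s n a b t z i * ((w i)\<^sup>2 / z i)) / 2"
  shows "flip_inequality s n a b t z w"
proof -
  let ?T = "\<lambda>i. - flip_partial s n a b t z i * ((w i)\<^sup>2 / z i)"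
  have "0 \<le> ?T i" if "i \<in> {1..s}" for i
    using large[OF that] pos[OF that] by (auto intro!: divide_nonpos_pos mult_nonpos_nonneg)
  then have "?T 1 \<le> (\<Sum>i=1..s. ?T i)"
    using assms(1) by (intro member_le_sum) auto
  moreover have "0 \<le> 2 * t * z 1 * (\<Sum>i=s+1..n. flip_partial s n a b t z i * (w i)\<^sup>2)"
    using assms(1,2) pos[of 1] small by (intro mult_nonneg_nonneg sum_nonneg) (auto intro: less_imp_le)
  ultimately show ?thesis using main unfolding flip_inequality_def Let_def by linarith
qed

subsubsection \<open>Gaps at \<open>s \<le> k - 2\<close>\<close>

lemma flip_es_inverses_zero:
  assumes "\<And>i. i \<in> {1..s} \<Longrightarrow> c i = 0"
  shows "flip_es s n 0 b t c = es {s+1..n} b c"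
proof -
  have "es {1..s} (int j) c = of_bool (j = 0)" for j
    using es_cong[of "{1..s}" c "\<lambda>_. 0" "int j"] assms es_zero_fun[of "{1..s}" "int j"] by simp
  then have "flip_es s n 0 b t c = (\<Sum>j=0..s. if j = 0 then es {s+1..n} b c else 0)"
    unfolding flip_es_def by (intro sum.cong) (auto simp: of_bool_def)
  then show ?thesis by simp
qed

lemma flip_es_nth_Suc_0_inverses_zero:
  assumes z: "\<And>i. i \<in> {1..s} \<Longrightarrow> z i = 0" and i: "i \<in> {1..s}"
  shows "flip_es s n 0 b 1 (line z (unitv i)) $ Suc 0 = es {s+1..n} (b + 1) z"
proof -
  have large: "es I j z = of_bool (j = 0)" if "I \<subseteq> {1..s}" for I and j :: int
    using that es_cong[of I z "\<lambda>_. 0" j] z es_zero_fun[of I j] finite_subset[OF that] by fastforce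
  have "flip_es s n 0 b 1 (line z (unitv i)) $ Suc 0
      = (\<Sum>j=0..s. if j = 1 then es {s+1..n} (b + 1) z else 0)"
    unfolding flip_es_def fps_sum_nth
    using i by (intro sum.cong refl)
      (auto simp: fps_mult_nth_Suc_0 es_line_unitv_nth_Suc_0 large Diff_subset)
  also have "\<dots> = es {s+1..n} (b + 1) z" using i by simp
  finally show ?thesis .
qed

lemma flip_es_line_nth_0: "flip_es s n r b t (line z w) $ 0 = flip_es s n r b t (line z v) $ 0"
  by (simp add: flip_es_def fps_sum_nth)

lemma flip_es_nth_0_inverses_zero:
  assumes "\<And>i. i \<in> {1..s} \<Longrightarrow> z i = 0"
  shows "flip_es s n 0 b t (line z w) $ 0 = es {s+1..n} b z"
  using assms flip_es_line_nth_0[of s n 0 b t z w "\<lambda>_. 0"]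
    flip_es_inverses_zero[of s "line z (\<lambda>_. 0)" n b t]
  by (simp add: line_def[of z "\<lambda>_. 0"])

lemma flip_es_nth_0_pos:
  assumes z: "z \<in> flip_box s n a c" and c: "0 < c" and n: "s + a \<le> n" and t: "0 \<le> t" and b: "b \<le> a"
  shows "0 < flip_es s n 0 (int b) t (line z w) $ 0"
proof -
  have "0 < es {s+1..n} (int b) z" by (rule es_pos[OF flip_box_many_pos[OF z c n] b])
  then show ?thesis using flip_es_nth_0_ge[OF z _ t, of 0 "int b" w] c by simp
qed

context
  fixes s n a b :: nat and c :: real
  fixes q :: "(nat \<Rightarrow> real) \<Rightarrow> (nat \<Rightarrow> real) \<Rightarrow> real fps"
  assumes s: "1 \<le> s" "s + a \<le> n" and b: "b < a" and c: "0 < c"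
  defines "q \<equiv> \<lambda>z w. flip_quot s n (int a) (int b) 1 (line z w)"
begin

lemma flip_partial_eq_nth: "flip_partial s n (int a) (int b) 1 z i = q z (unitv i) $ Suc 0"
  by (simp add: flip_partial_def q_def)

lemma flip_quot_mult_flip_box:
  assumes "z \<in> flip_box s n a c"
  shows "q z w * flip_es s n 0 (int b) 1 (line z w) = flip_es s n 0 (int a) 1 (line z w)"
  unfolding q_def
  using flip_quot_mult[of s n "int b" 1 "line z w" "int a"]
    flip_es_nth_0_pos[OF assms c s(2), of 1 b w] b by simp

lemma flip_partial_inverses_zero_neg:
  assumes z: "z \<in> flip_box s n a c" and zero: "\<And>i. i \<in> {1..s} \<Longrightarrow> z i = 0" and i: "i \<in> {1..s}"
  shows "flip_partial s n (int a) (int b) 1 z i < 0"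
proof -
  note many = flip_box_many_pos[OF z c s(2)]
  have R: "0 < es {s+1..n} (int b) z" using b by (intro es_pos[OF many]) simp
  have es_0: "flip_es s n 0 m 1 (line z (unitv i)) $ 0 = es {s+1..n} m z"
    and es_1: "flip_es s n 0 m 1 (line z (unitv i)) $ Suc 0 = es {s+1..n} (m + 1) z" for m
    by (rule flip_es_nth_0_inverses_zero flip_es_nth_Suc_0_inverses_zero; fact zero i)+
  note nth = fps_quotient_nth[OF flip_quot_mult_flip_box[OF z, of "unitv i"], unfolded es_0 es_1,
      OF R[THEN less_imp_neq, symmetric]]
  have "flip_partial s n (int a) (int b) 1 z i
      = - newton_gap {s+1..n} z (int (Suc b)) (int a) / (es {s+1..n} (int b) z)\<^sup>2"
    unfolding flip_partial_eq_nth newton_gap_def nth(2) nth(1) using R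
    by (simp add: field_simps power2_eq_square)
  moreover have "0 < newton_gap {s+1..n} z (int (Suc b)) (int a)"
    using b by (intro newton_gap_pos[OF many]) simp
  ultimately show ?thesis using R by simp
qed

lemma flip_quot_nth_0_pos: "z \<in> flip_box s n a c \<Longrightarrow> 0 < q z w $ 0"
  using fps_quotient_nth(1)[OF flip_quot_mult_flip_box] b
    flip_es_nth_0_pos[OF _ c s(2), of z 1 a w] flip_es_nth_0_pos[OF _ c s(2), of z 1 b w] by simp

lemma nth_continuous_on_flip_quot_flip_box:
  assumes "continuous_on K z" "continuous_on K w" "\<And>p. p \<in> K \<Longrightarrow> z p \<in> flip_box s n a c"
  shows "nth_continuous_on K (\<lambda>p. q (z p) (w p))"
  unfolding q_def
proof (intro nth_continuous_on_flip_quot continuous_on_const assms)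
  fix p assume "p \<in> K"
  then show "flip_es s n (nat (- int b)) (int b) 1 (line (z p) (w p)) $ 0 \<noteq> 0"
    using flip_es_nth_0_pos[OF assms(3) c s(2), of p 1 b "w p"] b by simp
qed

lemma penalized_concavity_inverses_zero_pos:
  assumes a: "2 \<le> a" and b': "b = a - 1 \<or> b = a - 2"
    and z: "z \<in> flip_box s n a c" and w: "w \<in> unit_directions n"
    and zero: "\<And>i. i \<in> {1..s} \<Longrightarrow> z i = 0" "\<And>i. i \<in> {1..s} \<Longrightarrow> w i = 0"
  shows "0 < penalized_concavity (q z w)"
proof -
  have "flip_es s n 0 m 1 (line z w) = es {s+1..n} m (line z w)" for m
    using zero by (intro flip_es_inverses_zero) (simp add: line_def)
  then have q: "q z w = es {s+1..n} (int a) (line z w) * inverse (es {s+1..n} (int b) (line z w))"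
    by (simp add: q_def flip_quot_def)
  have "(\<Sum>i=s+1..n. (w i)\<^sup>2) = 1"
    using zero(2) s by (intro unit_directions_sum_small[OF w]) auto
  then have "(\<Sum>i=s+1..n. (w i)\<^sup>2) \<noteq> 0" by simp
  then obtain i where "i \<in> {s+1..n}" "(w i)\<^sup>2 \<noteq> 0" by (rule sum.not_neutral_contains_not_neutral)
  then have "\<exists>i\<in>{s+1..n}. w i \<noteq> 0" by auto
  then show ?thesis
    unfolding q by (intro penalized_concavity_es_quotient_pos[OF a flip_box_many_pos[OF z c s(2)] b'])
qed

lemma penalized_concavity_flip_quot_ge:
  assumes a: "2 \<le> a" and b': "b = a - 1 \<or> b = a - 2"
  shows "\<exists>\<epsilon>>0. \<exists>C\<ge>0. \<forall>z\<in>flip_box s n a c. \<forall>w\<in>unit_directions n.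
    \<epsilon> - C * (\<Sum>i=1..s. z i + (w i)\<^sup>2) \<le> penalized_concavity (q z w)"
proof -
  let ?K = "flip_box s n a c \<times> unit_directions n"
  let ?q = "\<lambda>p. q (fst p) (snd p)" and ?h = "\<lambda>p. \<Sum>i=1..s. fst p i + (snd p i)\<^sup>2"
  have "\<exists>\<epsilon>>0. \<exists>C\<ge>0. \<forall>p\<in>?K. \<epsilon> - C * ?h p \<le> penalized_concavity (?q p)"
  proof (rule compact_lower_bound)
    show "compact ?K" by (intro compact_Times compact_flip_box compact_unit_directions)
    have coords: "continuous_on ?K (\<lambda>p. fst p i)" "continuous_on ?K (\<lambda>p. snd p i)" for i
      by (rule continuous_on_product_then_coordinatewise, intro continuous_intros)+
    have "nth_continuous_on ?K ?q"
      by (intro nth_continuous_on_flip_quot_flip_box continuous_intros) auto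
    then show "continuous_on ?K (\<lambda>p. penalized_concavity (?q p))"
      by (rule continuous_on_slope_energy) (auto intro: flip_quot_nth_0_pos)
    show "continuous_on ?K ?h" by (intro continuous_intros coords)
  next
    fix p assume p: "p \<in> ?K"
    then have z: "0 \<le> fst p i" for i using flip_boxD(1)[of "fst p"] c by auto
    then show "0 \<le> ?h p" by (intro sum_nonneg) auto
    assume "?h p = 0"
    then have "fst p i + (snd p i)\<^sup>2 = 0" if "i \<in> {1..s}" for i
      using that z by (subst (asm) sum_nonneg_eq_0_iff) auto
    then have "fst p i = 0" "snd p i = 0" if "i \<in> {1..s}" for i
      using that z add_nonneg_eq_0_iff[of "fst p i" "(snd p i)\<^sup>2"] by auto
    then show "0 < penalized_concavity (?q p)"
      using p by (intro penalized_concavity_inverses_zero_pos[OF a b']) auto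
  qed
  then show ?thesis by (simp add: mem_Times_iff)
qed

lemma neg_flip_partial_ge:
  "\<exists>\<epsilon>>0. \<exists>C\<ge>0. \<forall>i\<in>{1..s}. \<forall>z\<in>flip_box s n a c.
    \<epsilon> - C * (\<Sum>i=1..s. z i) \<le> - flip_partial s n (int a) (int b) 1 z i"
proof (rule compact_lower_bound_family)
  fix i assume i: "i \<in> {1..s}"
  show "continuous_on (flip_box s n a c) (\<lambda>z. - flip_partial s n (int a) (int b) 1 z i)"
    unfolding flip_partial_eq_nth
    by (intro continuous_intros nth_continuous_onD nth_continuous_on_flip_quot_flip_box) auto
  fix z assume z: "z \<in> flip_box s n a c" and "(\<Sum>i=1..s. z i) = 0"
  then have "z i = 0" if "i \<in> {1..s}" for i
    using that flip_boxD(1)[OF z] c by (subst (asm) sum_nonneg_eq_0_iff) auto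
  then show "0 < - flip_partial s n (int a) (int b) 1 z i"
    using flip_partial_inverses_zero_neg[OF z _ i] by simp
next
  show "continuous_on (flip_box s n a c) (\<lambda>z. \<Sum>i=1..s. z i)"
    by (intro continuous_intros continuous_on_coordinate)
  show "0 \<le> (\<Sum>i=1..s. z i)" if "z \<in> flip_box s n a c" for z
    using flip_boxD(1)[OF that] c by (intro sum_nonneg) auto
qed (auto intro: compact_flip_box)

lemma flip_inequality_of_penalized_concavity:
  assumes pos: "\<forall>i\<in>{1..s}. 0 < z i"
    and small: "\<forall>i\<in>{s+1..n}. 0 \<le> flip_partial s n (int a) (int b) 1 z i"
    and large: "\<And>i. i \<in> {1..s} \<Longrightarrow> 2 * C * z i \<le> - flip_partial s n (int a) (int b) 1 z i" and C: "0 \<le> C"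
    and concavity: "- C * (\<Sum>i=1..s. (w i)\<^sup>2) \<le> penalized_concavity (q z w)"
  shows "flip_inequality s n (int a) (int b) 1 z w"
proof (rule flip_inequalityI)
  have "2 * C * (w i)\<^sup>2 \<le> - flip_partial s n (int a) (int b) 1 z i * ((w i)\<^sup>2 / z i)"
    if i: "i \<in> {1..s}" for i
  proof -
    have zi: "0 < z i" using pos i by blast
    then have "2 * C * z i * ((w i)\<^sup>2 / z i) \<le> - flip_partial s n (int a) (int b) 1 z i * ((w i)\<^sup>2 / z i)"
      by (intro mult_right_mono large i) auto
    then show ?thesis using zi by simp
  qed
  then have "2 * C * (\<Sum>i=1..s. (w i)\<^sup>2)
      \<le> (\<Sum>i=1..s. - flip_partial s n (int a) (int b) 1 z i * ((w i)\<^sup>2 / z i))"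
    unfolding sum_distrib_left by (rule sum_mono)
  then show "0 \<le> penalized_concavity (flip_quot s n (int a) (int b) 1 (line z w))
      + (\<Sum>i=1..s. - flip_partial s n (int a) (int b) 1 z i * ((w i)\<^sup>2 / z i)) / 2"
    using concavity unfolding q_def by linarith
  show "flip_partial s n (int a) (int b) 1 z i \<le> 0" if "i \<in> {1..s}" for i
  proof -
    have "0 \<le> 2 * C * z i" using C pos that by (intro mult_nonneg_nonneg) (auto intro: less_imp_le)
    then show ?thesis using large[OF that] by linarith
  qed
qed (use s(1) pos small in auto)

lemma flip_inequality_comparable:
  assumes a: "2 \<le> a" and b': "b = a - 1 \<or> b = a - 2"
  shows "\<exists>\<rho>>0. \<forall>z\<in>flip_box s n a c. \<forall>w\<in>unit_directions n.
    (\<forall>i\<in>{1..s}. 0 < z i) \<longrightarrow> (\<Sum>i=1..s. z i) \<le> \<rho> \<longrightarrow>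
    (\<forall>i\<in>{s+1..n}. 0 \<le> flip_partial s n (int a) (int b) 1 z i) \<longrightarrow>
    flip_inequality s n (int a) (int b) 1 z w"
proof -
  obtain \<epsilon>1 C1 where \<epsilon>1: "0 < \<epsilon>1" "0 \<le> C1"
    and concavity: "\<And>z w. z \<in> flip_box s n a c \<Longrightarrow> w \<in> unit_directions n \<Longrightarrow>
      \<epsilon>1 - C1 * (\<Sum>i=1..s. z i + (w i)\<^sup>2) \<le> penalized_concavity (q z w)"
    using penalized_concavity_flip_quot_ge[OF a b'] by blast
  obtain \<epsilon>2 C2 where \<epsilon>2: "0 < \<epsilon>2" "0 \<le> C2" and partial: "\<And>i z. i \<in> {1..s} \<Longrightarrow> z \<in> flip_box s n a c \<Longrightarrow>
      \<epsilon>2 - C2 * (\<Sum>i=1..s. z i) \<le> - flip_partial s n (int a) (int b) 1 z i"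
    using neg_flip_partial_ge by blast
  obtain \<rho> where \<rho>: "0 < \<rho>"
    and C: "\<And>t. 0 \<le> t \<Longrightarrow> t \<le> \<rho> \<Longrightarrow> t \<le> 1 \<and> C1 * t \<le> min \<epsilon>1 (\<epsilon>2 / 4) \<and> C2 * t \<le> \<epsilon>2 / 2"
    by (rule small_threshold[of "min \<epsilon>1 (\<epsilon>2 / 4)" C1 "\<epsilon>2 / 2" C2]) (use \<epsilon>1 \<epsilon>2 in auto)
  show ?thesis
  proof (intro exI[of _ \<rho>] conjI \<rho> ballI impI)
    fix z w assume z: "z \<in> flip_box s n a c" and w: "w \<in> unit_directions n"
      and pos: "\<forall>i\<in>{1..s}. 0 < z i"
      and sum: "(\<Sum>i=1..s. z i) \<le> \<rho>" and small: "\<forall>i\<in>{s+1..n}. 0 \<le> flip_partial s n (int a) (int b) 1 z i"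
    have z_le: "0 \<le> z i" "z i \<le> (\<Sum>i=1..s. z i)" if "i \<in> {1..s}" for i
      using that flip_boxD(1)[OF z] c by (auto intro!: member_le_sum)
    have sum_nonneg: "0 \<le> (\<Sum>i=1..s. z i)" by (intro sum_nonneg z_le)
    show "flip_inequality s n (int a) (int b) 1 z w"
    proof (rule flip_inequality_of_penalized_concavity[OF pos small _ \<epsilon>1(2)])
      show "2 * C1 * z i \<le> - flip_partial s n (int a) (int b) 1 z i" if i: "i \<in> {1..s}" for i
        using partial[OF i z] C[OF z_le(1)[OF i]] C[OF sum_nonneg sum] z_le(2)[OF i] sum by linarith
      show "- C1 * (\<Sum>i=1..s. (w i)\<^sup>2) \<le> penalized_concavity (q z w)"
        using concavity[OF z w] C[OF sum_nonneg sum] by (simp add: sum.distrib distrib_left)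
    qed
  qed
qed

end

subsubsection \<open>Normalization for the gap at \<open>s = k - 1\<close>\<close>

lemma flip_es_0:
  "flip_es s n r b 0 c = es {1..s} (int r) c * es {s+1..n} (b + int r) c"
proof (cases "r \<le> s")
  case True
  have "flip_es s n r b 0 c
      = (\<Sum>j=r..s. if j = r then es {1..s} (int r) c * es {s+1..n} (b + int r) c else 0)"
    unfolding flip_es_def by (intro sum.cong) auto
  then show ?thesis using True by simp
next
  case False
  then show ?thesis by (simp add: flip_es_def es_gt_card)
qed

lemma es_1_line_nth:
  assumes "finite I"
  shows "es I 1 (line z w) $ 0 = (\<Sum>i\<in>I. z i)" "es I 1 (line z w) $ Suc 0 = (\<Sum>i\<in>I. w i)"
    "es I 1 (line z w) $ 2 = 0"
  by (simp_all add: es_1[OF assms] fps_sum_nth)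

lemma es_2_line_nth:
  assumes "finite I"
  shows "es I 2 (line z w) $ 0 = ((\<Sum>i\<in>I. z i)\<^sup>2 - (\<Sum>i\<in>I. (z i)\<^sup>2)) / 2"
    "es I 2 (line z w) $ Suc 0 = (\<Sum>i\<in>I. z i) * (\<Sum>i\<in>I. w i) - (\<Sum>i\<in>I. z i * w i)"
    "es I 2 (line z w) $ 2 = ((\<Sum>i\<in>I. w i)\<^sup>2 - (\<Sum>i\<in>I. (w i)\<^sup>2)) / 2"
proof -
  define S where "S = (\<Sum>i\<in>I. line z w i)"
  have S: "S $ 0 = (\<Sum>i\<in>I. z i)" "S $ Suc 0 = (\<Sum>i\<in>I. w i)" "S $ 2 = 0"
    by (simp_all add: S_def fps_sum_nth)
  have "S * S = (\<Sum>i\<in>I. line z w i * line z w i) + (es I 2 (line z w) + es I 2 (line z w))"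
    using power2_sum_eq_es_2[OF assms, of "line z w"] by (simp only: S_def power2_eq_square mult_2)
  then have "(S * S) $ m
      = (\<Sum>i\<in>I. (line z w i * line z w i) $ m) + (es I 2 (line z w) $ m + es I 2 (line z w) $ m)" for m
    by (simp only: fps_add_nth fps_sum_nth)
  note nth = this
  have cross: "(\<Sum>i\<in>I. (line z w i * line z w i) $ Suc 0) = 2 * (\<Sum>i\<in>I. z i * w i)"
    by (simp add: fps_mult_nth_Suc_0 sum_distrib_left mult.commute)
  show "es I 2 (line z w) $ 0 = ((\<Sum>i\<in>I. z i)\<^sup>2 - (\<Sum>i\<in>I. (z i)\<^sup>2)) / 2"
    using nth[of 0] by (simp add: S power2_eq_square)
  show "es I 2 (line z w) $ Suc 0 = (\<Sum>i\<in>I. z i) * (\<Sum>i\<in>I. w i) - (\<Sum>i\<in>I. z i * w i)"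
    using nth[of "Suc 0"] unfolding cross unfolding fps_mult_nth_Suc_0 S
      mult.commute[of "\<Sum>i\<in>I. w i" "\<Sum>i\<in>I. z i"] by linarith
  show "es I 2 (line z w) $ 2 = ((\<Sum>i\<in>I. w i)\<^sup>2 - (\<Sum>i\<in>I. (w i)\<^sup>2)) / 2"
    using nth[of 2] by (simp add: fps_mult_nth_2 S power2_eq_square)
qed

lemma power2_sum_le_weighted:
  fixes w \<alpha> :: "'i \<Rightarrow> real"
  assumes "\<And>i. i \<in> I \<Longrightarrow> 0 < \<alpha> i"
  shows "(\<Sum>i\<in>I. w i)\<^sup>2 \<le> (\<Sum>i\<in>I. \<alpha> i) * (\<Sum>i\<in>I. (w i)\<^sup>2 / \<alpha> i)"
proof -
  have "(\<Sum>i\<in>I. sqrt (\<alpha> i) * (w i / sqrt (\<alpha> i)))\<^sup>2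
      \<le> (\<Sum>i\<in>I. (sqrt (\<alpha> i))\<^sup>2) * (\<Sum>i\<in>I. (w i / sqrt (\<alpha> i))\<^sup>2)"
    by (rule Cauchy_Schwarz_ineq_sum)
  moreover have "sqrt (\<alpha> i) * (w i / sqrt (\<alpha> i)) = w i" "(sqrt (\<alpha> i))\<^sup>2 = \<alpha> i"
    "(w i / sqrt (\<alpha> i))\<^sup>2 = (w i)\<^sup>2 / \<alpha> i"
    if "i \<in> I" for i
    using assms[OF that] by (simp_all add: power_divide)
  ultimately show ?thesis by simp
qed

text \<open>The term \<open>i = 1\<close> keeps only the factor \<open>2 - 3/2\<close>, so it gets the weight \<open>3 z\<^sub>1\<close> in the
  Cauchy-Schwarz inequality.\<close>
definition tripled_first :: "(nat \<Rightarrow> real) \<Rightarrow> nat \<Rightarrow> real" where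
  "tripled_first z i = (if i = 1 then 3 * z 1 else z i)"

lemma tripled_first_weighted_sum_ge:
  fixes z w :: "nat \<Rightarrow> real"
  assumes s: "1 \<le> s" and z: "\<And>i. i \<in> {1..s} \<Longrightarrow> 0 < z i" and sum: "(\<Sum>i=1..s. z i) = 1"
  defines "\<psi> \<equiv> \<Sum>i=1..s. (w i)\<^sup>2 / tripled_first z i"
  shows "(\<Sum>i=1..s. w i)\<^sup>2 / (1 + 2 * z 1) \<le> \<psi>" and "(\<Sum>i=1..s. (w i)\<^sup>2) / 3 \<le> \<psi>"
proof -
  have one: "1 \<in> {1..s}" using s by simp
  have pos: "0 < tripled_first z i" and le: "tripled_first z i \<le> 3" if "i \<in> {1..s}" for i
  proof -
    show "0 < tripled_first z i" using z[OF that] z[OF one] by (simp add: tripled_first_def)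
    have "z j \<le> (\<Sum>i=1..s. z i)" if "j \<in> {1..s}" for j
      using that z by (intro member_le_sum) (auto intro: less_imp_le)
    then show "tripled_first z i \<le> 3" using that one sum by (force simp: tripled_first_def)
  qed
  have "(\<Sum>i=1..s. tripled_first z i) = (\<Sum>i=1..s. z i + (if i = 1 then 2 * z 1 else 0))"
    by (intro sum.cong) (auto simp: tripled_first_def)
  also have "\<dots> = 1 + 2 * z 1" using s sum by (simp add: sum.distrib)
  finally have "(\<Sum>i=1..s. w i)\<^sup>2 \<le> (1 + 2 * z 1) * \<psi>"
    using power2_sum_le_weighted[of "{1..s}" "tripled_first z" w] pos by (simp add: \<psi>_def)
  then show "(\<Sum>i=1..s. w i)\<^sup>2 / (1 + 2 * z 1) \<le> \<psi>"
    using z[OF one] by (simp add: divide_le_eq mult.commute)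
  show "(\<Sum>i=1..s. (w i)\<^sup>2) / 3 \<le> \<psi>"
    unfolding \<psi>_def sum_divide_distrib using pos le by (intro sum_mono divide_left_mono) auto
qed

lemma weighted_sum_ge:
  fixes z w \<delta> :: "nat \<Rightarrow> real"
  assumes s: "1 \<le> s" and z: "\<And>i. i \<in> {1..s} \<Longrightarrow> 0 < z i" and sum: "(\<Sum>i=1..s. z i) = 1"
    and \<delta>: "\<And>i. i \<in> {1..s} \<Longrightarrow> 5 / 6 * W \<le> \<delta> i" and W: "1 \<le> W"
  shows "W * (\<Sum>i=1..s. w i)\<^sup>2 / (1 + 2 * z 1) + (\<Sum>i=1..s. (w i)\<^sup>2) / 12
    \<le> 2 * (\<Sum>i=1..s. \<delta> i * ((w i)\<^sup>2 / z i)) - 3 / 2 * (\<delta> 1 * ((w 1)\<^sup>2 / z 1))"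
proof -
  define \<psi> where "\<psi> = (\<Sum>i=1..s. (w i)\<^sup>2 / tripled_first z i)"
  note \<psi>_ge = tripled_first_weighted_sum_ge[of s z w, OF s z sum, folded \<psi>_def]
  have square: "W * ((\<Sum>i=1..s. w i)\<^sup>2 / (1 + 2 * z 1)) \<le> W * \<psi>"
    using W \<psi>_ge(1) by (intro mult_left_mono) auto
  have "0 \<le> (\<Sum>i=1..s. (w i)\<^sup>2) / 3" by (simp add: sum_nonneg)
  then have "1 * \<psi> \<le> W * \<psi>" using W \<psi>_ge(2) by (intro mult_right_mono) auto
  then have rest: "(\<Sum>i=1..s. (w i)\<^sup>2) / 12 \<le> 1 / 4 * (W * \<psi>)" using \<psi>_ge(2) by simp
  have "5 / 4 * (W * \<psi>) \<le> (\<Sum>i=1..s. (if i = 1 then 1 / 2 else 2) * (\<delta> i * ((w i)\<^sup>2 / z i)))"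
    unfolding \<psi>_def sum_distrib_left
  proof (rule sum_mono)
    fix i assume i: "i \<in> {1..s}"
    define X where "X = (w i)\<^sup>2 / z i"
    have X: "(w i)\<^sup>2 / tripled_first z i = (if i = 1 then X / 3 else X)"
      by (simp add: X_def tripled_first_def)
    have "5 / 6 * W * X \<le> \<delta> i * X"
      using \<delta>[OF i] z[OF i] unfolding X_def by (intro mult_right_mono) auto
    moreover have "0 \<le> W * X" using W z[OF i] by (simp add: X_def)
    ultimately show "5 / 4 * (W * ((w i)\<^sup>2 / tripled_first z i))
        \<le> (if i = 1 then 1 / 2 else 2) * (\<delta> i * ((w i)\<^sup>2 / z i))"
      unfolding X X_def[symmetric] by (cases "i = 1") simp_all
  qed
  also have "\<dots>
      = (\<Sum>i=1..s. 2 * (\<delta> i * ((w i)\<^sup>2 / z i)) - (if i = 1 then 3 / 2 * (\<delta> 1 * ((w 1)\<^sup>2 / z 1)) else 0))"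
    by (intro sum.cong) auto
  also have "\<dots> = 2 * (\<Sum>i=1..s. \<delta> i * ((w i)\<^sup>2 / z i)) - 3 / 2 * (\<delta> 1 * ((w 1)\<^sup>2 / z 1))"
    using s by (simp add: sum_subtractf sum_distrib_left)
  finally show ?thesis using square rest by simp
qed

definition normalized_box :: "nat \<Rightarrow> nat \<Rightarrow> (nat \<Rightarrow> real) set" where
  "normalized_box s n = flip_box s n 1 1 \<inter> {z. (\<Sum>i=1..s. z i) = 1}"

lemma compact_normalized_box: "compact (normalized_box s n)"
  unfolding normalized_box_def
  by (intro compact_Int_closed compact_flip_box closed_Collect_eq continuous_intros
    continuous_on_coordinate)

lemma normalized_box_sum_ge:
  assumes "z \<in> normalized_box s n" "s < n"
  shows "1 \<le> (\<Sum>i=s+1..n. z i)" and "1 \<le> (\<Sum>i=s+1..n. (z i)\<^sup>2)"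
proof -
  have z: "z \<in> flip_box s n 1 1" using assms by (simp add: normalized_box_def)
  have ge: "1 \<le> z (s + 1)" using flip_boxD(2)[OF z, of "s + 1"] by simp
  have "z (s + 1) \<le> (\<Sum>i=s+1..n. z i)"
    using assms flip_boxD(1)[OF z] by (intro member_le_sum) auto
  then show "1 \<le> (\<Sum>i=s+1..n. z i)" using ge by linarith
  have "(z (s + 1))\<^sup>2 \<le> (\<Sum>i=s+1..n. (z i)\<^sup>2)"
    using assms by (intro member_le_sum) auto
  then show "1 \<le> (\<Sum>i=s+1..n. (z i)\<^sup>2)" using one_le_power[OF ge, of 2] by linarith
qed

lemma normalized_boxD:
  assumes "z \<in> normalized_box s n"
  shows "z \<in> flip_box s n 1 1" and "(\<Sum>i=1..s. z i) = 1" and "0 \<le> z i"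
  using assms flip_boxD(1)[of z s n 1 1] by (simp_all add: normalized_box_def)

lemma flip_es_numerator_ge_1:
  assumes s: "s < n" and z: "z \<in> normalized_box s n" and t: "0 \<le> t"
  shows "1 \<le> flip_es s n 0 1 t (line z w) $ 0"
  using flip_es_nth_0_ge[OF normalized_boxD(1)[OF z] _ t, of 0 1 w] normalized_box_sum_ge(1)[OF z s]
  by (simp add: es_1)

context
  fixes s n r :: nat and z w :: "nat \<Rightarrow> real" and t :: real
  assumes s: "1 \<le> s" and r: "r \<le> 1" and z: "z \<in> normalized_box s n" and t: "0 \<le> t"
begin

lemma flip_es_denominator_ge_1: "1 \<le> flip_es s n r (- int r) t (line z w) $ 0"
proof -
  have "es {1..s} (int r) z = 1"
    using r normalized_boxD(2)[OF z] by (cases r) (auto simp: es_1)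
  then show ?thesis
    using flip_es_nth_0_ge[OF normalized_boxD(1)[OF z] _ t, of r "- int r" w] r s by simp
qed

lemma flip_quot_normalized_mult:
  "flip_quot s n 1 (- int r) t (line z w) * flip_es s n r (- int r) t (line z w)
      = flip_es s n 0 1 t (line z w)"
  using flip_quot_mult[of s n "- int r" t "line z w" 1] flip_es_denominator_ge_1 by simp

lemma flip_quot_normalized_nth_0_pos:
  assumes "s < n"
  shows "0 < flip_quot s n 1 (- int r) t (line z w) $ 0"
  using fps_quotient_nth(1)[OF flip_quot_normalized_mult]
    flip_es_denominator_ge_1 flip_es_numerator_ge_1[OF assms z t, of w] by simp

end

subsubsection \<open>The gap at \<open>s = k - 1\<close> for \<open>l = k - 1\<close>\<close>

definition degree_one_defect :: "nat \<Rightarrow> nat \<Rightarrow> real \<Rightarrow> (nat \<Rightarrow> real fps) \<Rightarrow> real fps" where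
  "degree_one_defect s n t c
    = (flip_es s n 1 1 t c - es {s+1..n} 1 c * flip_es s n 1 0 t c) * inverse (flip_es s n 0 0 t c)"

lemma flip_quot_eq_degree_one_defect:
  assumes "flip_es s n 0 0 t c $ 0 \<noteq> 0"
  shows "flip_quot s n 1 0 t c = es {s+1..n} 1 c + fps_const t * degree_one_defect s n t c"
proof -
  define M where "M = flip_es s n 0 0 t c"
  have M: "M * inverse M = 1" using assms by (intro inverse_mult_eq_1') (simp add: M_def)
  have expand: "M = 1 + fps_const t * flip_es s n 1 0 t c"
    "flip_es s n 0 1 t c = es {s+1..n} 1 c + fps_const t * flip_es s n 1 1 t c"
    using flip_es_Suc[of 0 s n _ t c] by (simp_all add: M_def)
  have "es {s+1..n} 1 c + fps_const t * degree_one_defect s n t c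
      = es {s+1..n} 1 c * (M * inverse M)
        + fps_const t * (flip_es s n 1 1 t c - es {s+1..n} 1 c * flip_es s n 1 0 t c) * inverse M"
    by (simp add: degree_one_defect_def M mult.assoc flip: M_def)
  also have "\<dots> = flip_es s n 0 1 t c * inverse M"
    unfolding expand(2) by (subst expand(1)) (simp add: algebra_simps)
  finally show ?thesis by (simp add: flip_quot_def M_def)
qed

lemma degree_one_defect_0:
  "degree_one_defect s n 0 c = - (es {1..s} 1 c * ((es {s+1..n} 1 c)\<^sup>2 - es {s+1..n} 2 c))"
  by (simp add: degree_one_defect_def flip_es_0 power2_eq_square algebra_simps)

lemma power2_es_1_minus_es_2_nth:
  assumes "finite I"
  defines "W z w \<equiv> (es I 1 (line z w))\<^sup>2 - es I 2 (line z w)"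
  shows "W z w $ 0 = ((\<Sum>i\<in>I. z i)\<^sup>2 + (\<Sum>i\<in>I. (z i)\<^sup>2)) / 2"
    "W z w $ Suc 0 = (\<Sum>i\<in>I. z i) * (\<Sum>i\<in>I. w i) + (\<Sum>i\<in>I. z i * w i)"
    "W z w $ 2 = ((\<Sum>i\<in>I. w i)\<^sup>2 + (\<Sum>i\<in>I. (w i)\<^sup>2)) / 2"
proof -
  note nth = es_1_line_nth[OF assms(1)] es_2_line_nth[OF assms(1)]
  have "(es I 1 (line z w))\<^sup>2 $ 0 = (\<Sum>i\<in>I. z i)\<^sup>2"
    "(es I 1 (line z w))\<^sup>2 $ Suc 0 = 2 * ((\<Sum>i\<in>I. z i) * (\<Sum>i\<in>I. w i))"
    "(es I 1 (line z w))\<^sup>2 $ 2 = (\<Sum>i\<in>I. w i)\<^sup>2"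
    unfolding power2_eq_square fps_mult_nth_0 fps_mult_nth_Suc_0 fps_mult_nth_2 nth
    by (simp_all add: mult.commute)
  then show "W z w $ 0 = ((\<Sum>i\<in>I. z i)\<^sup>2 + (\<Sum>i\<in>I. (z i)\<^sup>2)) / 2"
    "W z w $ Suc 0 = (\<Sum>i\<in>I. z i) * (\<Sum>i\<in>I. w i) + (\<Sum>i\<in>I. z i * w i)"
    "W z w $ 2 = ((\<Sum>i\<in>I. w i)\<^sup>2 + (\<Sum>i\<in>I. (w i)\<^sup>2)) / 2"
    unfolding W_def fps_sub_nth nth by (simp_all add: field_simps)
qed

definition defect_weight :: "nat \<Rightarrow> nat \<Rightarrow> (nat \<Rightarrow> real) \<Rightarrow> real" where
  "defect_weight s n z = ((\<Sum>i=s+1..n. z i)\<^sup>2 + (\<Sum>i=s+1..n. (z i)\<^sup>2)) / 2"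

lemma degree_one_defect_0_nth:
  assumes z: "(\<Sum>i=1..s. z i) = 1"
  shows "degree_one_defect s n 0 (line z w) $ Suc 0 = - ((\<Sum>i=1..s. w i) * defect_weight s n z
      + (\<Sum>i=s+1..n. z i) * (\<Sum>i=s+1..n. w i) + (\<Sum>i=s+1..n. z i * w i))"
    and "degree_one_defect s n 0 (line z w) $ 2 = - (((\<Sum>i=s+1..n. w i)\<^sup>2 + (\<Sum>i=s+1..n. (w i)\<^sup>2)) / 2
      + (\<Sum>i=1..s. w i) * ((\<Sum>i=s+1..n. z i) * (\<Sum>i=s+1..n. w i) + (\<Sum>i=s+1..n. z i * w i)))"
  unfolding degree_one_defect_0 fps_neg_nth fps_mult_nth_Suc_0 fps_mult_nth_2
    es_1_line_nth[OF finite_atLeastAtMost] power2_es_1_minus_es_2_nth[OF finite_atLeastAtMost]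
    z defect_weight_def
  by (simp_all add: algebra_simps)

lemma degree_one_defect_0_unitv:
  assumes z: "(\<Sum>i=1..s. z i) = 1" and i: "i \<in> {1..s}"
  shows "degree_one_defect s n 0 (line z (unitv i)) $ Suc 0 = - defect_weight s n z"
proof -
  have "(\<Sum>j=1..s. unitv i j) = 1" "(\<Sum>j=s+1..n. unitv i j) = 0" "(\<Sum>j=s+1..n. z j * unitv i j) = 0"
    using i by (simp_all add: unitv_def of_bool_def if_distrib cong: if_cong)
  then show ?thesis unfolding degree_one_defect_0_nth(1)[OF z] by simp
qed

lemma nth_continuous_on_degree_one_defect:
  assumes "continuous_on K t" "continuous_on K z" "continuous_on K w"
    and "\<And>p. p \<in> K \<Longrightarrow> flip_es s n 0 0 (t p) (line (z p) (w p)) $ 0 \<noteq> 0"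
  shows "nth_continuous_on K (\<lambda>p. degree_one_defect s n (t p) (line (z p) (w p)))"
  unfolding degree_one_defect_def using assms
  by (intro nth_continuous_on_mult nth_continuous_on_diff nth_continuous_on_inverse
      nth_continuous_on_flip_es nth_continuous_on_es nth_continuous_on_line)

lemma defect_weight_ge:
  assumes z: "z \<in> normalized_box s n" and "s < n"
  shows "(\<Sum>i=s+1..n. (z i)\<^sup>2) \<le> defect_weight s n z" and "1 \<le> defect_weight s n z"
proof -
  have "(\<Sum>i=s+1..n. (z i)\<^sup>2) \<le> (\<Sum>i=s+1..n. z i)\<^sup>2"
    unfolding power2_sum_eq_es_2[OF finite_atLeastAtMost]
    using es_nonneg[of "{s+1..n}" z 2] normalized_boxD(3)[OF z] by simp
  then show "(\<Sum>i=s+1..n. (z i)\<^sup>2) \<le> defect_weight s n z" by (simp add: defect_weight_def)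
  then show "1 \<le> defect_weight s n z" using normalized_box_sum_ge(2)[OF assms] by linarith
qed

text \<open>\<open>t\<close> times this form bounds the difference of the two sides of the flipped inequality from below,
  up to the first-order term.\<close>
definition degree_one_form :: "nat \<Rightarrow> nat \<Rightarrow> real \<Rightarrow> (nat \<Rightarrow> real) \<Rightarrow> (nat \<Rightarrow> real) \<Rightarrow> real" where
  "degree_one_form s n t z w = - 2 * degree_one_defect s n t (line z w) $ 2
    + defect_weight s n z * (\<Sum>i=1..s. w i)\<^sup>2 / (1 + 2 * z 1) + (\<Sum>i=1..s. (w i)\<^sup>2) / 12
    + 2 * z 1 * (\<Sum>i=s+1..n. flip_partial s n 1 0 t z i * (w i)\<^sup>2)"

lemma flip_partial_degree_one_0:
  assumes "i \<in> {s+1..n}"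
  shows "flip_partial s n 1 0 0 z i = 1"
proof -
  have "flip_es s n 0 0 0 c = 1" for c :: "nat \<Rightarrow> real fps" by (simp add: flip_es_0)
  then have "flip_quot s n 1 0 0 (line z (unitv i)) = es {s+1..n} 1 (line z (unitv i))"
    using flip_quot_eq_degree_one_defect[of s n 0 "line z (unitv i)"] by simp
  then show ?thesis using assms by (simp add: flip_partial_def es_line_unitv_nth_Suc_0)
qed

lemma completed_square_nonneg:
  fixes p P V W \<mu> :: real
  assumes p: "0 < p" and W: "0 < W" and P: "P\<^sup>2 \<le> W * \<mu>"
  shows "0 \<le> p * \<mu> + 2 * (V * P) + W * V\<^sup>2 / p"
proof -
  have "0 \<le> (p * P + W * V)\<^sup>2 + p\<^sup>2 * (W * \<mu> - P\<^sup>2)" using P by simp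
  also have "\<dots> = W * p * (p * \<mu> + 2 * (V * P) + W * V\<^sup>2 / p)"
    using p by (simp add: field_simps power2_eq_square)
  finally show ?thesis using W p by (intro mult_left_le_imp_le[of "W * p" 0]) auto
qed

lemma degree_one_form_0_pos:
  assumes s: "s < n" and z: "z \<in> normalized_box s n" and w: "w \<in> unit_directions n"
    and fixed: "(\<Sum>i=s+1..n. w i) = 0"
  shows "0 < degree_one_form s n 0 z w"
proof -
  define W V P \<mu> \<nu> p where "W = defect_weight s n z" and "V = (\<Sum>i=1..s. w i)"
    and "P = (\<Sum>i=s+1..n. z i * w i)" and "\<mu> = (\<Sum>i=s+1..n. (w i)\<^sup>2)" and "\<nu> = (\<Sum>i=1..s. (w i)\<^sup>2)"
    and "p = 1 + 2 * z 1"
  have nonneg: "0 \<le> \<mu>" "0 \<le> \<nu>" by (simp_all add: \<mu>_def \<nu>_def sum_nonneg)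
  have W: "1 \<le> W" and p: "1 \<le> p"
    using defect_weight_ge(2)[OF z s] normalized_boxD(3)[OF z] by (simp_all add: W_def p_def)
  have "P\<^sup>2 \<le> (\<Sum>i=s+1..n. (z i)\<^sup>2) * \<mu>"
    unfolding P_def \<mu>_def by (rule Cauchy_Schwarz_ineq_sum)
  also have "\<dots> \<le> W * \<mu>"
    unfolding W_def by (rule mult_right_mono[OF defect_weight_ge(1)[OF z s] nonneg(1)])
  finally have cs: "P\<^sup>2 \<le> W * \<mu>" .
  have square: "0 \<le> p * \<mu> + 2 * (V * P) + W * V\<^sup>2 / p"
    using p W cs by (intro completed_square_nonneg) auto
  have "0 < p * \<mu> + 2 * (V * P) + W * V\<^sup>2 / p + \<nu> / 12"
  proof (cases "\<nu> = 0")
    case True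
    then have zero: "w i = 0" if "i \<in> {1..s}" for i
      using that by (simp add: \<nu>_def sum_nonneg_eq_0_iff)
    have "\<mu> = 1" unfolding \<mu>_def using zero s by (intro unit_directions_sum_small[OF w]) auto
    moreover have "V = 0" using zero by (simp add: V_def)
    ultimately show ?thesis using p nonneg by simp
  next
    case False
    then show ?thesis using square nonneg by simp
  qed
  moreover have "(\<Sum>i=s+1..n. flip_partial s n 1 0 0 z i * (w i)\<^sup>2) = \<mu>"
    unfolding \<mu>_def by (intro sum.cong refl) (simp add: flip_partial_degree_one_0)
  ultimately show ?thesis
    unfolding degree_one_form_def degree_one_defect_0_nth(2)[OF normalized_boxD(2)[OF z]] fixed
      W_def[symmetric] V_def[symmetric] P_def[symmetric] \<mu>_def[symmetric] \<nu>_def[symmetric]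
      p_def[symmetric]
    by (simp add: p_def algebra_simps)
qed

context
  fixes s n :: nat
  assumes s: "1 \<le> s" "s < n"
begin

lemma degree_one_form_ge:
  "\<exists>\<epsilon>>0. \<exists>C\<ge>0. \<forall>t\<in>{0..1}. \<forall>z\<in>normalized_box s n. \<forall>w\<in>unit_directions n.
    \<epsilon> - C * (t + slope_energy (flip_quot s n 1 0 t (line z w)))
      \<le> degree_one_form s n t z w"
proof -
  let ?K = "{0..1::real} \<times> (normalized_box s n \<times> unit_directions n)"
  let ?t = "fst :: real \<times> _ \<Rightarrow> _" and ?z = "\<lambda>p. fst (snd p)" and ?w = "\<lambda>p. snd (snd p)"
  let ?q = "\<lambda>p. flip_quot s n 1 0 (?t p) (line (?z p) (?w p))"
  have "\<exists>\<epsilon>>0. \<exists>C\<ge>0. \<forall>p\<in>?K. \<epsilon> - C * (?t p + slope_energy (?q p))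
      \<le> degree_one_form s n (?t p) (?z p) (?w p)"
  proof (rule compact_lower_bound)
    show "compact ?K"
      by (intro compact_Times compact_normalized_box compact_unit_directions compact_Icc)
    have t: "continuous_on ?K ?t" and z: "continuous_on ?K ?z" and w: "continuous_on ?K ?w"
      by (intro continuous_intros)+
    note coords = z[THEN continuous_on_product_then_coordinatewise]
      w[THEN continuous_on_product_then_coordinatewise]
    have denom: "flip_es s n 0 0 (?t p) (line (?z p) u) $ 0 \<noteq> 0" and q_pos: "0 < ?q p $ 0"
      and z1: "0 \<le> ?z p 1" if "p \<in> ?K" for p u
      using that flip_es_denominator_ge_1[OF s(1), of 0 "?z p" n "?t p" u]
        flip_quot_normalized_nth_0_pos[OF s(1) _ _ _ s(2), of 0 "?z p" "?t p" "?w p"]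
        normalized_boxD(3)[of "?z p" s n 1] by auto
    have q: "nth_continuous_on ?K ?q"
      using denom by (intro nth_continuous_on_flip_quot t z w) simp
    then show "continuous_on ?K (\<lambda>p. ?t p + slope_energy (?q p))"
      by (intro continuous_intros t continuous_on_slope_energy q_pos)
    show "continuous_on ?K (\<lambda>p. degree_one_form s n (?t p) (?z p) (?w p))"
      unfolding degree_one_form_def defect_weight_def flip_partial_def using denom z1
      by (intro continuous_intros coords nth_continuous_onD nth_continuous_on_degree_one_defect
          nth_continuous_on_flip_quot t z w) force+
    fix p assume p: "p \<in> ?K"
    then have nonneg: "0 \<le> ?t p" "0 \<le> slope_energy (?q p)"
      using slope_energy_nonneg[OF q_pos[OF p]] by auto
    then show "0 \<le> ?t p + slope_energy (?q p)" by simp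
    assume "?t p + slope_energy (?q p) = 0"
    then have t0: "?t p = 0" and "slope_energy (?q p) = 0" using nonneg by linarith+
    then have q1: "?q p $ Suc 0 = 0" using q_pos[OF p] by (simp add: slope_energy_def)
    have "(\<Sum>i=s+1..n. ?w p i) = 0"
      using q1 flip_quot_eq_degree_one_defect[OF denom[OF p]]
        es_1_line_nth(2)[of "{s+1..n}" "?z p" "?w p"] by (simp add: t0)
    then show "0 < degree_one_form s n (?t p) (?z p) (?w p)"
      unfolding t0 using p s by (intro degree_one_form_0_pos) auto
  qed
  then show ?thesis by simp
qed

lemma degree_one_defect_partial_ge:
  "\<exists>\<epsilon>>0. \<exists>C\<ge>0. \<forall>i\<in>{1..s}. \<forall>t\<in>{0..1}. \<forall>z\<in>normalized_box s n.
    \<epsilon> - C * t \<le> - (degree_one_defect s n t (line z (unitv i)) $ Suc 0) - 5 / 6 * defect_weight s n z"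
proof -
  let ?K = "{0..1::real} \<times> normalized_box s n"
  let ?g = "\<lambda>i p. - (degree_one_defect s n (fst p) (line (snd p) (unitv i)) $ Suc 0)
      - 5 / 6 * defect_weight s n (snd p)"
  have "\<exists>\<epsilon>>0. \<exists>C\<ge>0. \<forall>i\<in>{1..s}. \<forall>p\<in>?K. \<epsilon> - C * fst p \<le> ?g i p"
  proof (rule compact_lower_bound_family)
    have coords: "continuous_on ?K (\<lambda>p. snd p i)" for i
      by (rule continuous_on_product_then_coordinatewise, intro continuous_intros)
    have "flip_es s n 0 0 (fst p) (line (snd p) u) $ 0 \<noteq> 0" if "p \<in> ?K" for p u
      using that flip_es_denominator_ge_1[OF s(1), of 0 "snd p" n "fst p" u] by auto
    then show "continuous_on ?K (?g i)" for i
      unfolding defect_weight_def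
      by (intro continuous_intros coords nth_continuous_onD nth_continuous_on_degree_one_defect) auto
    fix i p assume i: "i \<in> {1..s}" and p: "p \<in> ?K" and t0: "fst p = 0"
    have z: "snd p \<in> normalized_box s n" using p by auto
    show "0 < ?g i p"
      unfolding t0 degree_one_defect_0_unitv[OF normalized_boxD(2)[OF z] i]
      using defect_weight_ge(2)[OF z s(2)] by simp
  qed (auto intro!: compact_Times compact_normalized_box continuous_intros)
  then show ?thesis by simp
qed

lemma flip_inequality_of_degree_one_form:
  assumes t: "0 < t" and z: "z \<in> normalized_box s n" and pos: "\<forall>i\<in>{1..s}. 0 < z i"
    and partial: "\<And>i. i \<in> {1..s} \<Longrightarrow>
      5 / 6 * defect_weight s n z \<le> - (degree_one_defect s n t (line z (unitv i)) $ Suc 0)"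
    and form: "0 \<le> 16 * slope_energy (flip_quot s n 1 0 t (line z w))
      + t * degree_one_form s n t z w"
  shows "flip_inequality s n 1 0 t z w"
proof -
  define q d where "q = flip_quot s n 1 0 t (line z w)"
    and "d = (\<lambda>i. - (degree_one_defect s n t (line z (unitv i)) $ Suc 0))"
  have denom: "flip_es s n 0 0 t (line z u) $ 0 \<noteq> 0" for u
    using flip_es_denominator_ge_1[OF s(1) _ z, of 0 t u] t by auto
  have q2: "q $ 2 = t * degree_one_defect s n t (line z w) $ 2"
    unfolding q_def flip_quot_eq_degree_one_defect[OF denom] by (simp add: es_1_line_nth(3))
  have large: "- flip_partial s n 1 0 t z i = t * d i" if "i \<in> {1..s}" for i
    using that unfolding flip_partial_def flip_quot_eq_degree_one_defect[OF denom]
    by (simp add: d_def es_line_unitv_nth_Suc_0)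
  have "defect_weight s n z * (\<Sum>i=1..s. w i)\<^sup>2 / (1 + 2 * z 1) + (\<Sum>i=1..s. (w i)\<^sup>2) / 12
      \<le> 2 * (\<Sum>i=1..s. d i * ((w i)\<^sup>2 / z i)) - 3 / 2 * (d 1 * ((w 1)\<^sup>2 / z 1))"
    using pos partial unfolding d_def
    by (intro weighted_sum_ge normalized_boxD(2)[OF z] s(1) defect_weight_ge(2)[OF z s(2)]) auto
  then have "degree_one_form s n t z w \<le> - 2 * degree_one_defect s n t (line z w) $ 2
      + 2 * (\<Sum>i=1..s. d i * ((w i)\<^sup>2 / z i)) - 3 / 2 * (d 1 * ((w 1)\<^sup>2 / z 1))
      + 2 * z 1 * (\<Sum>i=s+1..n. flip_partial s n 1 0 t z i * (w i)\<^sup>2)" (is "_ \<le> ?D")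
    unfolding degree_one_form_def by linarith
  then have "t * degree_one_form s n t z w \<le> t * ?D" using t by (intro mult_left_mono) auto
  then have "0 \<le> 16 * slope_energy q + t * ?D" using form unfolding q_def by linarith
  moreover have "(\<Sum>i=1..s. - flip_partial s n 1 0 t z i * ((w i)\<^sup>2 / z i))
      = t * (\<Sum>i=1..s. d i * ((w i)\<^sup>2 / z i))"
    unfolding sum_distrib_left by (intro sum.cong refl) (simp add: large)
  moreover have "- flip_partial s n 1 0 t z 1 * ((w 1)\<^sup>2 / z 1) = t * (d 1 * ((w 1)\<^sup>2 / z 1))"
    using large[of 1] s by simp
  ultimately show ?thesis
    unfolding flip_inequality_def Let_def q_def[symmetric] penalized_concavity_def q2
    by (simp add: algebra_simps del: One_nat_def)
qed

lemma flip_inequality_degree_one: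
  "\<exists>\<rho>>0. \<forall>t z w. 0 < t \<longrightarrow> t \<le> \<rho> \<longrightarrow> z \<in> normalized_box s n \<longrightarrow> w \<in> unit_directions n \<longrightarrow>
    (\<forall>i\<in>{1..s}. 0 < z i) \<longrightarrow> flip_inequality s n 1 0 t z w"
proof -
  define X where "X t z w = slope_energy (flip_quot s n 1 0 t (line z w))" for t z w
  obtain \<epsilon>1 C1 where \<epsilon>1: "0 < \<epsilon>1" "0 \<le> C1"
    and form: "\<And>t z w. t \<in> {0..1} \<Longrightarrow> z \<in> normalized_box s n \<Longrightarrow> w \<in> unit_directions n \<Longrightarrow>
      \<epsilon>1 - C1 * (t + X t z w) \<le> degree_one_form s n t z w"
    unfolding X_def using degree_one_form_ge by blast
  obtain \<epsilon>2 C2 where \<epsilon>2: "0 < \<epsilon>2" "0 \<le> C2"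
    and partial: "\<And>i t z. i \<in> {1..s} \<Longrightarrow> t \<in> {0..1} \<Longrightarrow> z \<in> normalized_box s n \<Longrightarrow>
      \<epsilon>2 - C2 * t \<le> - (degree_one_defect s n t (line z (unitv i)) $ Suc 0)
        - 5 / 6 * defect_weight s n z"
    using degree_one_defect_partial_ge by blast
  obtain \<rho> where \<rho>: "0 < \<rho>"
    and C: "\<And>t. 0 \<le> t \<Longrightarrow> t \<le> \<rho> \<Longrightarrow> t \<le> 1 \<and> C1 * t \<le> min \<epsilon>1 16 \<and> C2 * t \<le> \<epsilon>2"
    by (rule small_threshold[of "min \<epsilon>1 16" C1 \<epsilon>2 C2]) (use \<epsilon>1 \<epsilon>2 in auto)
  show ?thesis
  proof (intro exI[of _ \<rho>] conjI allI impI \<rho>)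
    fix t z w assume t: "0 < t" "t \<le> \<rho>" and z: "z \<in> normalized_box s n" and w: "w \<in> unit_directions n"
      and pos: "\<forall>i\<in>{1..s}. 0 < z i"
    have t01: "t \<in> {0..1}" and Ct: "C1 * t \<le> \<epsilon>1" "C1 * t \<le> 16" "C2 * t \<le> \<epsilon>2" using C[of t] t by auto
    have X: "0 \<le> X t z w"
      using slope_energy_nonneg[of "flip_quot s n 1 0 t (line z w)"]
        flip_quot_normalized_nth_0_pos[OF s(1) _ z _ s(2), of 0 t w] t by (simp add: X_def)
    have "t * (\<epsilon>1 - C1 * (t + X t z w)) \<le> t * degree_one_form s n t z w"
      using form[OF t01 z w] t by (intro mult_left_mono) auto
    moreover have "0 \<le> t * (\<epsilon>1 - C1 * t) + (16 - C1 * t) * X t z w"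
      using Ct t X by (intro add_nonneg_nonneg mult_nonneg_nonneg) auto
    ultimately have "0 \<le> 16 * X t z w + t * degree_one_form s n t z w" by (simp add: algebra_simps)
    then show "flip_inequality s n 1 0 t z w"
      using partial[OF _ t01 z] Ct(3) unfolding X_def
      by (intro flip_inequality_of_degree_one_form[OF t(1) z pos]) (force, assumption)
  qed
qed

end

subsubsection \<open>The gap at \<open>s = k - 1\<close> for \<open>l = k - 2\<close>\<close>

text \<open>In the quotient \<open>q = N / M\<close> of order \<open>1\<close> over order \<open>-1\<close>, this is the part of \<open>- 2 q\<^sub>2\<close> that is of first
  order in \<open>t\<close>, less what is lost in estimating \<open>2 q\<^sub>1 M\<^sub>1 / M\<^sub>0\<close>.\<close>
definition straddling_form :: "nat \<Rightarrow> nat \<Rightarrow> real \<Rightarrow> (nat \<Rightarrow> real) \<Rightarrow> (nat \<Rightarrow> real) \<Rightarrow> real" where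
  "straddling_form s n t z w =
    (let M = flip_es s n 1 (- 1) t (line z w); M' = flip_es s n 2 (- 1) t (line z w);
      q = flip_quot s n 1 (- 1) t (line z w) in
    - 2 * (flip_es s n 1 1 t (line z w) $ 2 - q $ 0 * M' $ 2) / M $ 0
      - t * q $ 0 * ((M' $ Suc 0 - (\<Sum>i=1..s. w i) * M' $ 0) / M $ 0)\<^sup>2 / 4)"

lemma flip_quot_line_nth_0: "flip_quot s n a b t (line z w) $ 0 = flip_quot s n a b t (line z v) $ 0"
  by (simp add: flip_quot_def flip_es_line_nth_0[of _ _ _ _ _ z w v])

context
  fixes s n :: nat
  assumes s: "1 \<le> s" "s < n"
begin

lemma straddling_denominator:
  "flip_es s n 1 (- 1) t c = es {1..s} 1 c + fps_const t * flip_es s n 2 (- 1) t c"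
  using flip_es_Suc[of 1 s n "- 1" t c] s by (simp add: numeral_2_eq_2)

lemma straddling_numerator:
  "flip_es s n 0 1 t c = es {s+1..n} 1 c + fps_const t * flip_es s n 1 1 t c"
  using flip_es_Suc[of 0 s n 1 t c] by simp

lemmas straddling_denominator_ge_1 = flip_es_denominator_ge_1[OF s(1) order_refl, unfolded of_nat_1]
  and straddling_quot_mult = flip_quot_normalized_mult[OF s(1) order_refl, unfolded of_nat_1]
  and straddling_quot_nth_0_pos =
    flip_quot_normalized_nth_0_pos[OF s(1) order_refl _ _ s(2), unfolded of_nat_1]

lemma straddling_quot_nth_2_le:
  fixes z w :: "nat \<Rightarrow> real" and t :: real
  assumes z: "z \<in> normalized_box s n" and t: "0 \<le> t"
  defines "q \<equiv> flip_quot s n 1 (- 1) t (line z w)"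
  shows "t * straddling_form s n t z w - 8 * slope_energy q - q $ 0 * (\<Sum>i=1..s. w i)\<^sup>2 / 4 \<le> - 2 * q $ 2"
proof -
  define M M' N' V e where "M = flip_es s n 1 (- 1) t (line z w)"
    and "M' = flip_es s n 2 (- 1) t (line z w)"
    and "N' = flip_es s n 1 1 t (line z w)" and "V = (\<Sum>i=1..s. w i)"
    and "e = (M' $ Suc 0 - V * M' $ 0) / M $ 0"
  have M: "1 \<le> M $ 0" and q0: "0 < q $ 0"
    using straddling_denominator_ge_1[OF z t] straddling_quot_nth_0_pos[OF z t]
    by (simp_all add: M_def q_def)
  have M_nth: "M $ 0 = 1 + t * M' $ 0" "M $ Suc 0 = V + t * M' $ Suc 0" "M $ 2 = t * M' $ 2"
    unfolding M_def straddling_denominator using normalized_boxD(2)[OF z]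
    by (simp_all only: fps_add_nth fps_mult_left_const_nth es_1_line_nth[OF finite_atLeastAtMost]
      M'_def V_def)
  have N2: "flip_es s n 0 1 t (line z w) $ 2 = t * N' $ 2"
    unfolding straddling_numerator by (simp add: es_1_line_nth(3) N'_def)
  have "M $ Suc 0 = (V + t * e) * M $ 0"
    using M unfolding e_def M_nth(2) by (simp add: M_nth(1) field_simps)
  moreover have "q * M = flip_es s n 0 1 t (line z w)"
    unfolding q_def M_def by (rule straddling_quot_mult[OF z t])
  note fps_quotient_nth(3)[OF this]
  ultimately have "- 2 * q $ 2
      = 2 * q $ Suc 0 * (V + t * e) - 2 * t * (N' $ 2 - q $ 0 * M' $ 2) / M $ 0"
    using M unfolding N2 M_nth(3) by (simp add: field_simps)
  moreover have "- 8 * slope_energy q - q $ 0 * (V + t * e)\<^sup>2 / 8 \<le> 2 * q $ Suc 0 * (V + t * e)"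
  proof -
    have "0 \<le> (8 * q $ Suc 0 + q $ 0 * (V + t * e))\<^sup>2 / (8 * q $ 0)" using q0 by simp
    also have "\<dots> = 8 * slope_energy q + q $ 0 * (V + t * e)\<^sup>2 / 8 + 2 * q $ Suc 0 * (V + t * e)"
      using q0 by (simp add: slope_energy_def field_simps power2_eq_square)
    finally show ?thesis by linarith
  qed
  moreover have "q $ 0 * (V + t * e)\<^sup>2 \<le> q $ 0 * (2 * V\<^sup>2 + 2 * (t * e)\<^sup>2)"
    using q0 sum_squares_ge_zero[of "V - t * e" 0]
    by (intro mult_left_mono) (simp_all add: power2_eq_square algebra_simps)
  moreover have "t * straddling_form s n t z w
      = - (2 * t * (N' $ 2 - q $ 0 * M' $ 2) / M $ 0) - q $ 0 * (t * e)\<^sup>2 / 4"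
    unfolding straddling_form_def Let_def M_def[symmetric] M'_def[symmetric] N'_def[symmetric]
      V_def[symmetric] q_def[symmetric]
      e_def[symmetric] using M by (simp add: field_simps power2_eq_square)
  ultimately show ?thesis unfolding V_def[symmetric] by (simp add: algebra_simps)
qed

lemma straddling_form_0_pos:
  assumes z: "z \<in> normalized_box s n" and w: "w \<in> unit_directions n"
    and zero: "\<And>i. i \<in> {1..s} \<Longrightarrow> w i = 0"
    and stationary: "flip_quot s n 1 (- 1) 0 (line z w) $ Suc 0 = 0"
  shows "0 < straddling_form s n 0 z w"
proof -
  have sums: "(\<Sum>i=1..s. w i) = 0" "(\<Sum>i=1..s. z i * w i) = 0" "(\<Sum>i=1..s. (w i)\<^sup>2) = 0"
    using zero by simp_all
  note nth = es_1_line_nth[OF finite_atLeastAtMost] es_2_line_nth[OF finite_atLeastAtMost]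
  have eq: "flip_es s n 1 (- 1) 0 c = es {1..s} 1 c" "flip_es s n 0 1 0 c = es {s+1..n} 1 c"
    "flip_es s n 2 (- 1) 0 c = es {1..s} 2 c * es {s+1..n} 1 c"
    "flip_es s n 1 1 0 c = es {1..s} 1 c * es {s+1..n} 2 c"
    for c :: "nat \<Rightarrow> real fps"
    by (simp_all add: flip_es_0)
  note q = fps_quotient_nth[OF straddling_quot_mult[OF z order_refl, of w], unfolded eq nth
    normalized_boxD(2)[OF z] sums, OF one_neq_zero]
  have "(\<Sum>i=s+1..n. w i) = 0" using q(2) stationary by simp
  moreover have "(\<Sum>i=s+1..n. (w i)\<^sup>2) = 1"
    using zero s by (intro unit_directions_sum_small[OF w]) auto
  ultimately show ?thesis
    unfolding straddling_form_def Let_def eq fps_mult_nth_2 fps_mult_nth_Suc_0 fps_mult_nth_0 nth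
      normalized_boxD(2)[OF z] sums by simp
qed

lemma straddling_form_ge:
  "\<exists>\<epsilon>>0. \<exists>C\<ge>0. \<forall>t\<in>{0..1}. \<forall>z\<in>normalized_box s n. \<forall>w\<in>unit_directions n.
    \<epsilon> - C * (t + (\<Sum>i=1..s. (w i)\<^sup>2)
      + slope_energy (flip_quot s n 1 (- 1) t (line z w)))
      \<le> straddling_form s n t z w"
proof -
  let ?K = "{0..1::real} \<times> (normalized_box s n \<times> unit_directions n)"
  let ?t = "fst :: real \<times> _ \<Rightarrow> _" and ?z = "\<lambda>p. fst (snd p)" and ?w = "\<lambda>p. snd (snd p)"
  let ?q = "\<lambda>p. flip_quot s n 1 (- 1) (?t p) (line (?z p) (?w p))"
  let ?h = "\<lambda>p. ?t p + (\<Sum>i=1..s. (?w p i)\<^sup>2) + slope_energy (?q p)"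
  have "\<exists>\<epsilon>>0. \<exists>C\<ge>0. \<forall>p\<in>?K. \<epsilon> - C * ?h p \<le> straddling_form s n (?t p) (?z p) (?w p)"
  proof (rule compact_lower_bound)
    show "compact ?K"
      by (intro compact_Times compact_normalized_box compact_unit_directions compact_Icc)
    have t: "continuous_on ?K ?t" and z: "continuous_on ?K ?z" and w: "continuous_on ?K ?w"
      by (intro continuous_intros)+
    note coords = w[THEN continuous_on_product_then_coordinatewise]
    have denom: "flip_es s n 1 (- 1) (?t p) (line (?z p) (?w p)) $ 0 \<noteq> 0" and q_pos: "0 < ?q p $ 0"
      if "p \<in> ?K" for p
      using that straddling_denominator_ge_1[of "?z p" n "?t p" "?w p"]
        straddling_quot_nth_0_pos[of "?z p" "?t p" "?w p"] by auto
    have q: "nth_continuous_on ?K ?q"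
      using denom by (intro nth_continuous_on_flip_quot t z w) simp
    then show "continuous_on ?K ?h"
      by (intro continuous_intros t coords continuous_on_slope_energy q_pos)
    show "continuous_on ?K (\<lambda>p. straddling_form s n (?t p) (?z p) (?w p))"
      unfolding straddling_form_def Let_def using denom
      by (intro continuous_intros coords nth_continuous_onD nth_continuous_on_flip_es
        nth_continuous_on_line q t z w) force+
    fix p assume p: "p \<in> ?K"
    have nonneg: "0 \<le> ?t p" "0 \<le> (\<Sum>i=1..s. (?w p i)\<^sup>2)" "0 \<le> slope_energy (?q p)"
      using p slope_energy_nonneg[OF q_pos[OF p]] by (auto intro: sum_nonneg)
    then show "0 \<le> ?h p" by linarith
    assume "?h p = 0"
    then have zero: "?t p = 0" "(\<Sum>i=1..s. (?w p i)\<^sup>2) = 0" "slope_energy (?q p) = 0"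
      using nonneg by linarith+
    have "?w p i = 0" if "i \<in> {1..s}" for i using zero(2) that by (simp add: sum_nonneg_eq_0_iff)
    moreover have "?q p $ Suc 0 = 0" using zero(3) q_pos[OF p] by (simp add: slope_energy_def)
    ultimately show "0 < straddling_form s n (?t p) (?z p) (?w p)"
      using p unfolding zero(1) by (intro straddling_form_0_pos) auto
  qed
  then show ?thesis by simp
qed

lemma straddling_partial_ge:
  "\<exists>\<epsilon>>0. \<exists>C\<ge>0. \<forall>i\<in>{1..s}. \<forall>t\<in>{0..1}. \<forall>z\<in>normalized_box s n.
    \<epsilon> - C * t \<le> - flip_partial s n 1 (- 1) t z i
        - 3 / 4 * flip_quot s n 1 (- 1) t (line z (unitv i)) $ 0"
proof -
  let ?K = "{0..1::real} \<times> normalized_box s n"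
  let ?q = "\<lambda>i p. flip_quot s n 1 (- 1) (fst p) (line (snd p) (unitv i))"
  have "\<exists>\<epsilon>>0. \<exists>C\<ge>0. \<forall>i\<in>{1..s}. \<forall>p\<in>?K. \<epsilon> - C * fst p
      \<le> - flip_partial s n 1 (- 1) (fst p) (snd p) i - 3 / 4 * ?q i p $ 0"
    unfolding flip_partial_def
  proof (rule compact_lower_bound_family)
    have "flip_es s n 1 (- 1) (fst p) (line (snd p) u) $ 0 \<noteq> 0" if "p \<in> ?K" for p u
      using that straddling_denominator_ge_1[of "snd p" n "fst p" u] by auto
    then have "nth_continuous_on ?K (?q i)" for i
      by (intro nth_continuous_on_flip_quot continuous_intros) auto
    then show "continuous_on ?K (\<lambda>p. - (?q i p $ Suc 0) - 3 / 4 * ?q i p $ 0)" for i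
      by (intro continuous_intros nth_continuous_onD)
    fix i p assume i: "i \<in> {1..s}" and p: "p \<in> ?K" and t0: "fst p = 0"
    have z: "snd p \<in> normalized_box s n" using p by auto
    have eq: "flip_es s n 1 (- 1) 0 c = es {1..s} 1 c" "flip_es s n 0 1 0 c = es {s+1..n} 1 c"
      for c :: "nat \<Rightarrow> real fps"
      by (simp_all add: flip_es_0)
    have sums: "(\<Sum>j=1..s. unitv i j) = 1" "(\<Sum>j=s+1..n. unitv i j) = 0"
      using i by (simp_all add: unitv_def)
    note q = fps_quotient_nth[OF straddling_quot_mult[OF z order_refl, of "unitv i"],
        unfolded eq es_1_line_nth[OF finite_atLeastAtMost] normalized_boxD(2)[OF z] sums,
        OF one_neq_zero]
    show "0 < - (?q i p $ Suc 0) - 3 / 4 * ?q i p $ 0"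
      using normalized_box_sum_ge(1)[OF z s(2)] by (simp add: t0 q)
  qed (auto intro!: compact_Times compact_normalized_box continuous_intros)
  then show ?thesis by simp
qed

lemma flip_inequality_of_straddling_form:
  assumes t: "0 < t" and z: "z \<in> normalized_box s n" and pos: "\<forall>i\<in>{1..s}. 0 < z i"
    and small: "\<forall>i\<in>{s+1..n}. 0 \<le> flip_partial s n 1 (- 1) t z i" and \<eta>: "0 \<le> \<eta>"
    and large: "\<And>i. i \<in> {1..s} \<Longrightarrow>
      3 / 4 * flip_quot s n 1 (- 1) t (line z w) $ 0 + \<eta> \<le> - flip_partial s n 1 (- 1) t z i"
    and form: "0 \<le> 8 * slope_energy (flip_quot s n 1 (- 1) t (line z w))
      + t * straddling_form s n t z w + \<eta> / 2 * (\<Sum>i=1..s. (w i)\<^sup>2)"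
  shows "flip_inequality s n 1 (- 1) t z w"
proof -
  define q \<chi> where "q = flip_quot s n 1 (- 1) t (line z w)" and "\<chi> = (\<Sum>i=1..s. (w i)\<^sup>2 / z i)"
  have q0: "0 < q $ 0" using straddling_quot_nth_0_pos[OF z, of t w] t by (simp add: q_def)
  have "(\<Sum>i=1..s. w i)\<^sup>2 \<le> \<chi>"
    using power2_sum_le_weighted[of "{1..s}" z w] pos normalized_boxD(2)[OF z] by (simp add: \<chi>_def)
  then have V: "q $ 0 * (\<Sum>i=1..s. w i)\<^sup>2 \<le> q $ 0 * \<chi>" using q0 by (intro mult_left_mono) auto
  have "(w i)\<^sup>2 \<le> (w i)\<^sup>2 / z i" if "i \<in> {1..s}" for i
    using that pos flip_boxD(3)[OF normalized_boxD(1)[OF z], of i] mult_left_le[of "z i" "(w i)\<^sup>2"]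
    by (simp add: pos_le_divide_eq)
  then have "(\<Sum>i=1..s. (w i)\<^sup>2) \<le> \<chi>" unfolding \<chi>_def by (rule sum_mono)
  then have \<nu>: "\<eta> * (\<Sum>i=1..s. (w i)\<^sup>2) \<le> \<eta> * \<chi>" using \<eta> by (rule mult_left_mono)
  have "0 \<le> \<chi>" unfolding \<chi>_def using pos by (intro sum_nonneg divide_nonneg_pos) auto
  then have \<chi>: "0 \<le> q $ 0 * \<chi>" using q0 by simp
  have "(3 / 4 * q $ 0 + \<eta>) * \<chi> \<le> (\<Sum>i=1..s. - flip_partial s n 1 (- 1) t z i * ((w i)\<^sup>2 / z i))"
    unfolding \<chi>_def sum_distrib_left q_def using pos
    by (intro sum_mono mult_right_mono large divide_nonneg_pos) auto
  then have "0 \<le> penalized_concavity q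
      + (\<Sum>i=1..s. - flip_partial s n 1 (- 1) t z i * ((w i)\<^sup>2 / z i)) / 2"
    using straddling_quot_nth_2_le[OF z, of t w] t form V \<nu> \<chi>
    unfolding q_def[symmetric] penalized_concavity_def
    by (simp add: algebra_simps)
  moreover have "flip_partial s n 1 (- 1) t z i \<le> 0" if "i \<in> {1..s}" for i
    using large[OF that] q0 \<eta> unfolding q_def by linarith
  ultimately show ?thesis
    using pos small s(1) t normalized_boxD(3)[OF z, of 1] unfolding q_def
    by (intro flip_inequalityI) auto
qed

lemma flip_inequality_straddling:
  "\<exists>\<rho>>0. \<forall>t z w. 0 < t \<longrightarrow> t \<le> \<rho> \<longrightarrow> z \<in> normalized_box s n \<longrightarrow> w \<in> unit_directions n \<longrightarrow>
    (\<forall>i\<in>{1..s}. 0 < z i) \<longrightarrow> (\<forall>i\<in>{s+1..n}. 0 \<le> flip_partial s n 1 (- 1) t z i) \<longrightarrow>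
    flip_inequality s n 1 (- 1) t z w"
proof -
  define X where "X t z w = slope_energy (flip_quot s n 1 (- 1) t (line z w))" for t z w
  obtain \<epsilon>1 C1 where \<epsilon>1: "0 < \<epsilon>1" "0 \<le> C1"
    and form: "\<And>t z w. t \<in> {0..1} \<Longrightarrow> z \<in> normalized_box s n \<Longrightarrow> w \<in> unit_directions n \<Longrightarrow>
      \<epsilon>1 - C1 * (t + (\<Sum>i=1..s. (w i)\<^sup>2) + X t z w) \<le> straddling_form s n t z w"
    unfolding X_def using straddling_form_ge by blast
  obtain \<epsilon>2 C2 where \<epsilon>2: "0 < \<epsilon>2" "0 \<le> C2"
    and partial: "\<And>i t z. i \<in> {1..s} \<Longrightarrow> t \<in> {0..1} \<Longrightarrow> z \<in> normalized_box s n \<Longrightarrow>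
      \<epsilon>2 - C2 * t \<le> - flip_partial s n 1 (- 1) t z i
        - 3 / 4 * flip_quot s n 1 (- 1) t (line z (unitv i)) $ 0"
    using straddling_partial_ge by blast
  obtain \<rho> where \<rho>: "0 < \<rho>"
    and C: "\<And>t. 0 \<le> t \<Longrightarrow> t \<le> \<rho> \<Longrightarrow> t \<le> 1 \<and> C1 * t \<le> min \<epsilon>1 (min (\<epsilon>2 / 4) 8) \<and> C2 * t \<le> \<epsilon>2 / 2"
    by (rule small_threshold[of "min \<epsilon>1 (min (\<epsilon>2 / 4) 8)" C1 "\<epsilon>2 / 2" C2]) (use \<epsilon>1 \<epsilon>2 in auto)
  show ?thesis
  proof (intro exI[of _ \<rho>] conjI allI impI \<rho>)
    fix t z w assume t: "0 < t" "t \<le> \<rho>" and z: "z \<in> normalized_box s n" and w: "w \<in> unit_directions n"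
      and pos: "\<forall>i\<in>{1..s}. 0 < z i" and small: "\<forall>i\<in>{s+1..n}. 0 \<le> flip_partial s n 1 (- 1) t z i"
    have t01: "t \<in> {0..1}" and Ct: "C1 * t \<le> \<epsilon>1" "C1 * t \<le> \<epsilon>2 / 4" "C1 * t \<le> 8" "C2 * t \<le> \<epsilon>2 / 2"
      using C[of t] t by auto
    have nonneg: "0 \<le> X t z w" "0 \<le> (\<Sum>i=1..s. (w i)\<^sup>2)"
      using slope_energy_nonneg[OF straddling_quot_nth_0_pos[OF z, of t w]] t
      by (simp_all add: X_def sum_nonneg)
    show "flip_inequality s n 1 (- 1) t z w"
    proof (rule flip_inequality_of_straddling_form[OF t(1) z pos small])
      show "3 / 4 * flip_quot s n 1 (- 1) t (line z w) $ 0 + \<epsilon>2 / 2 \<le> - flip_partial s n 1 (- 1) t z i"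
        if "i \<in> {1..s}" for i
        using partial[OF that t01 z] Ct(4)
        unfolding flip_quot_line_nth_0[of s n 1 "- 1" t z w "unitv i"] by linarith
      have "t * (\<epsilon>1 - C1 * (t + (\<Sum>i=1..s. (w i)\<^sup>2) + X t z w)) \<le> t * straddling_form s n t z w"
        using form[OF t01 z w] t by (intro mult_left_mono) auto
      moreover have "0 \<le>
          t * (\<epsilon>1 - C1 * t) + (\<epsilon>2 / 4 - C1 * t) * (\<Sum>i=1..s. (w i)\<^sup>2) + (8 - C1 * t) * X t z w"
        using Ct t nonneg by (intro add_nonneg_nonneg mult_nonneg_nonneg) auto
      ultimately show "0 \<le> 8 * slope_energy (flip_quot s n 1 (- 1) t (line z w))
        + t * straddling_form s n t z w + \<epsilon>2 / 2 / 2 * (\<Sum>i=1..s. (w i)\<^sup>2)"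
        unfolding X_def[symmetric] by (simp add: algebra_simps)
    qed (use \<epsilon>2 in simp)
  qed
qed

end

subsection \<open>Ordered points with a gap\<close>

definition ordered :: "nat \<Rightarrow> (nat \<Rightarrow> real) \<Rightarrow> bool" where
  "ordered n x \<longleftrightarrow> (\<forall>i j. 1 \<le> i \<and> i \<le> j \<and> j \<le> n \<longrightarrow> x j \<le> x i) \<and> 0 \<le> x n"

lemma orderedD: "ordered n x \<Longrightarrow> 1 \<le> i \<Longrightarrow> i \<le> j \<Longrightarrow> j \<le> n \<Longrightarrow> x j \<le> x i"
  by (simp add: ordered_def)

lemma ordered_nonneg: "ordered n x \<Longrightarrow> i \<in> {1..n} \<Longrightarrow> 0 \<le> x i"
  using orderedD[of n x i n] by (force simp: ordered_def)

lemma ordered_es_pos: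
  assumes x: "ordered n x" "0 < x k" and "j \<le> k" "k \<le> n"
  shows "0 < es {1..n} (int j) x"
proof -
  have "{1..k} \<subseteq> {i \<in> {1..n}. 0 < x i}"
    using orderedD[OF x(1), of _ k] x(2) assms(4) by force
  then have "card {1..k} \<le> card {i \<in> {1..n}. 0 < x i}" by (intro card_mono) auto
  then have "many_pos k {1..n} x" using ordered_nonneg[OF x(1)] by (simp add: many_pos_def)
  then show ?thesis using assms(3) by (rule es_pos)
qed

lemma pderiv1_sigma_quot_nonneg:
  assumes "0 < es {1..n} (int l) x" "\<And>i. i \<in> {1..n} \<Longrightarrow> 0 \<le> x i" "l < k" and i: "i \<in> {1..n}"
  shows "0 \<le> pderiv1 i (sigma_quot n k l) x"
proof -
  have "es_partial {1..n} (int k) i x * es {1..n} (int l) x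
      - es {1..n} (int k) x * es_partial {1..n} (int l) i x
      = newton_gap ({1..n} - {i}) x (int l) (int k - 1)"
    using es_remove[OF finite_atLeastAtMost i, of "int k" x]
      es_remove[OF finite_atLeastAtMost i, of "int l" x]
    by (simp add: es_partial_def newton_gap_def algebra_simps)
  moreover have "0 \<le> newton_gap ({1..n} - {i}) x (int l) (int k - 1)"
    using assms(2,3) by (intro newton_gap_nonneg) auto
  ultimately show ?thesis using pderiv1_sigma_quot[of n l x i k] assms(1) i by simp
qed

lemma gap_inequality_of_unit_directions:
  assumes s: "1 \<le> s" "s \<le> n" and slope: "\<And>i. i \<in> {1..n} \<Longrightarrow> slope i \<noteq> 0"
    and unit: "\<And>w. w \<in> unit_directions n \<Longrightarrow> gap_inequality n k l s x (\<lambda>i. slope i * w i)"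
  shows "gap_inequality n k l s x u"
proof -
  define v where "v i = (if i \<in> {1..n} then u i / slope i else 0)" for i
  define r where "r = sqrt (\<Sum>i=1..n. (v i)\<^sup>2)"
  have r2: "r\<^sup>2 = (\<Sum>i=1..n. (v i)\<^sup>2)" by (simp add: r_def sum_nonneg)
  show ?thesis
  proof (cases "r = 0")
    case True
    then have "v i = 0" if "i \<in> {1..n}" for i using r2 that by (simp add: sum_nonneg_eq_0_iff)
    then have "u i = 0" if "i \<in> {1..n}" for i using that slope[OF that] by (auto simp: v_def)
    then show ?thesis
      using gap_inequality_cong[of n u "\<lambda>_. 0"] s by (simp add: gap_inequality_def)
  next
    case False
    have "(\<Sum>i=1..n. (v i / r)\<^sup>2) = r\<^sup>2 / r\<^sup>2"
      unfolding r2 power_divide sum_divide_distrib ..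
    then have unit_sum: "(\<Sum>i=1..n. (v i / r)\<^sup>2) = 1" using False by simp
    have "v i / r \<in> {- of_bool (i \<in> {1..n})..of_bool (i \<in> {1..n})}" for i
    proof (cases "i \<in> {1..n}")
      case True
      then have "(v i / r)\<^sup>2 \<le> (\<Sum>i=1..n. (v i / r)\<^sup>2)" by (intro member_le_sum) auto
      then have "\<bar>v i / r\<bar> \<le> 1" unfolding unit_sum by (simp only: abs_square_le_1)
      then show ?thesis using True unfolding abs_le_iff by auto
    next
      case False
      then have "v i = 0" unfolding v_def by (rule if_not_P)
      then show ?thesis by simp
    qed
    then have "(\<lambda>i. v i / r) \<in> unit_directions n" using unit_sum by (simp add: unit_directions_def)
    then have "gap_inequality n k l s x (\<lambda>i. r * (slope i * (v i / r)))"
      unfolding gap_inequality_scale[OF False] by (rule unit)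
    moreover have "r * (slope i * (v i / r)) = u i" if "i \<in> {1..n}" for i
      using that False slope[OF that] by (simp add: v_def)
    ultimately show ?thesis using gap_inequality_cong[of n "\<lambda>i. r * (slope i * (v i / r))" u] s by auto
  qed
qed

definition flip_coordinates :: "nat \<Rightarrow> nat \<Rightarrow> real \<Rightarrow> real \<Rightarrow> (nat \<Rightarrow> real) \<Rightarrow> nat \<Rightarrow> real" where
  "flip_coordinates s n h t x i
    = (if i \<in> {1..s} then h / (t * x i) else if i \<in> {s+1..n} then x i / h else 0)"

context
  fixes n k s :: nat and x :: "nat \<Rightarrow> real"
  assumes x: "ordered n x" "0 < x k" and n: "k \<le> n" and s: "1 \<le> s" "s < k"
begin

lemma ordered_pos: "i \<in> {1..s + 1} \<Longrightarrow> 0 < x i"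
  using orderedD[OF x(1), of i k] x(2) n s by force

lemma sum_inverse_ratios_le:
  assumes gap: "x (s + 1) \<le> \<rho> / real n * x s" and \<rho>: "0 < \<rho>"
  shows "(\<Sum>i=1..s. x (s + 1) / x i) \<le> \<rho>"
proof -
  have "x (s + 1) / x i \<le> \<rho> / real n" if i: "i \<in> {1..s}" for i
  proof -
    have "\<rho> / real n * x s \<le> \<rho> / real n * x i"
      using orderedD[OF x(1), of i s] i s n \<rho> by (intro mult_left_mono) auto
    then show ?thesis using gap ordered_pos[of i] i by (simp add: pos_divide_le_eq)
  qed
  then have "(\<Sum>i=1..s. x (s + 1) / x i) \<le> real s * (\<rho> / real n)"
    using sum_bounded_above[of "{1..s}" "\<lambda>i. x (s + 1) / x i" "\<rho> / real n"] by simp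
  also have "\<dots> \<le> real n * (\<rho> / real n)" using s n \<rho> by (intro mult_right_mono) auto
  finally show ?thesis using s n by simp
qed

context
  fixes t :: real and z :: "nat \<Rightarrow> real"
  assumes t: "0 < t"
  defines "z \<equiv> flip_coordinates s n (x (s + 1)) t x"
begin

lemma flip_coordinates_pos: "i \<in> {1..s} \<Longrightarrow> 0 < z i"
  using ordered_pos[of i] ordered_pos[of "s + 1"] t by (simp add: z_def flip_coordinates_def)

lemma gap_inequality_of_flip_inequality:
  assumes l: "l < k" and ineq: "\<And>w. w \<in> unit_directions n \<Longrightarrow> (\<forall>i\<in>{1..s}. 0 < z i) \<Longrightarrow>
    (\<forall>i\<in>{s+1..n}. 0 \<le> flip_partial s n (int k - int s) (int l - int s) t z i) \<Longrightarrow>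
    flip_inequality s n (int k - int s) (int l - int s) t z w"
  shows "gap_inequality n k l s x u"
proof -
  define h where "h = x (s + 1)"
  have h: "0 < h" using ordered_pos[of "s + 1"] by (simp add: h_def)
  have sn: "s \<le> n" and lk: "l \<le> k" using s n l by auto
  have kl: "int k = int s + (int k - int s)" "int l = int s + (int l - int s)" by auto
  have eq: "x i = h * (if i \<le> s then 1 / (t * z i) else z i)" if "i \<in> {1..n}" for i
    using that h t ordered_pos[of i] by (auto simp: z_def flip_coordinates_def h_def)
  have T: "0 < es {1..n} (int l) x" using ordered_es_pos[OF x] n l by simp
  then have denom: "es {1..n} (int l) x \<noteq> 0" by simp
  define factor where "factor = h ^ (k - l) * t ^ nat (- (int k - int s)) / t ^ nat (- (int l - int s))"
  note flip = gap_inequality_flip[OF kl(1,2) lk s(1) sn h t flip_coordinates_pos eq denom]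
    and partial = pderiv1_flip[OF kl(1,2) lk s(1) sn h t flip_coordinates_pos eq denom,
      folded factor_def]
    and factor = factor_pos[OF kl(1,2) lk s(1) sn h t flip_coordinates_pos eq denom, folded factor_def]
  have "0 \<le> flip_partial s n (int k - int s) (int l - int s) t z i" if i: "i \<in> {s+1..n}" for i
  proof -
    have "0 \<le> pderiv1 i (sigma_quot n k l) x * h"
      using pderiv1_sigma_quot_nonneg[OF T ordered_nonneg[OF x(1)] l, of i] i h by simp
    also have "\<dots> = factor * flip_partial s n (int k - int s) (int l - int s) t z i"
      using partial[of i] i by simp
    finally show ?thesis using factor by (simp add: zero_le_mult_iff)
  qed
  then have flipped: "flip_inequality s n (int k - int s) (int l - int s) t z w"
    if "w \<in> unit_directions n" for w
    using ineq[OF that] flip_coordinates_pos by blast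
  show ?thesis
  proof (rule gap_inequality_of_unit_directions[OF s(1) sn])
    show "h * (if i \<le> s then - 1 / (t * (z i)\<^sup>2) else 1) \<noteq> 0" if "i \<in> {1..n}" for i
      using h t flip_coordinates_pos[of i] that by auto
    show "gap_inequality n k l s x (\<lambda>i. h * (if i \<le> s then - 1 / (t * (z i)\<^sup>2) else 1) * w i)"
      if "w \<in> unit_directions n" for w
      by (rule flip) (use flipped[OF that] in auto)
  qed
qed

lemma flip_coordinates_in_flip_box:
  assumes c: "c * x (s + 1) \<le> x k" and large: "\<And>i. i \<in> {1..s} \<Longrightarrow> x (s + 1) \<le> t * x i"
  shows "z \<in> flip_box s n (k - s) c"
proof -
  have h: "0 < x (s + 1)" by (rule ordered_pos) simp
  have "z i \<in> {if i \<in> {s+1..s+(k-s)} then c else 0..of_bool (i \<in> {1..n})}" for i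
  proof -
    consider "i \<in> {1..s}" | "i \<in> {s+1..n}" | "i \<notin> {1..n}" by force
    then show ?thesis
    proof cases
      case 1
      then have "z i \<le> 1"
        using large[OF 1] t ordered_pos[of i] by (simp add: z_def flip_coordinates_def pos_divide_le_eq)
      then show ?thesis using 1 flip_coordinates_pos[OF 1] s n by simp
    next
      case 2
      then have "x i \<le> x (s + 1)" "0 \<le> x i"
        using orderedD[OF x(1), of "s + 1" i] ordered_nonneg[OF x(1), of i] by auto
      moreover have "c * x (s + 1) \<le> x i" if "i \<in> {s+1..s+(k-s)}"
        using orderedD[OF x(1), of i k] that c s n by simp
      ultimately show ?thesis
        using 2 h by (auto simp: z_def flip_coordinates_def pos_le_divide_eq pos_divide_le_eq)
    next
      case 3
      then show ?thesis using s n by (auto simp: z_def flip_coordinates_def)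
    qed
  qed
  then show ?thesis by (simp add: flip_box_def)
qed

end

end

lemma flip_coordinates_in_normalized_box:
  assumes x: "ordered n x" "0 < x k" and n: "k \<le> n" and s: "1 \<le> s" "k = s + 1"
  defines "t \<equiv> \<Sum>i=1..s. x k / x i"
  shows "0 < t" and "flip_coordinates s n (x k) t x \<in> normalized_box s n"
proof -
  have sk: "s < k" using s by simp
  have pos: "0 < x i" if "i \<in> {1..s}" for i
    using ordered_pos[OF x n s(1) sk, of i] that by simp
  then show t: "0 < t" unfolding t_def using x(2) s by (intro sum_pos) auto
  have "x k \<le> t * x i" if i: "i \<in> {1..s}" for i
  proof -
    have "x k / x i \<le> t" unfolding t_def using i pos x(2)
      by (intro member_le_sum) (auto intro: less_imp_le)
    then show ?thesis using pos[OF i] by (simp add: pos_divide_le_eq)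
  qed
  then have "flip_coordinates s n (x k) t x \<in> flip_box s n 1 1"
    using flip_coordinates_in_flip_box[OF x n s(1) sk t, of 1] s(2) by simp
  moreover have "(\<Sum>i=1..s. flip_coordinates s n (x k) t x i) = (\<Sum>i=1..s. x k / x i) / t"
    unfolding sum_divide_distrib by (intro sum.cong refl) (simp add: flip_coordinates_def mult.commute)
  then have "(\<Sum>i=1..s. flip_coordinates s n (x k) t x i) = 1"
    using t unfolding t_def[symmetric] by simp
  ultimately show "flip_coordinates s n (x k) t x \<in> normalized_box s n"
    by (simp add: normalized_box_def)
qed

definition sufficient_gap :: "nat \<Rightarrow> nat \<Rightarrow> nat \<Rightarrow> nat \<Rightarrow> real \<Rightarrow> real \<Rightarrow> bool" where
  "sufficient_gap n k l s c \<rho> \<longleftrightarrow> (\<forall>x u. ordered n x \<longrightarrow> 0 < x k \<longrightarrow> c * x (s + 1) \<le> x k \<longrightarrow>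
    x (s + 1) \<le> \<rho> * x s \<longrightarrow> gap_inequality n k l s x u)"

lemma sufficient_gap_comparable:
  assumes l: "l < k" "k \<le> n" "k - l \<in> {1, 2}" and s: "1 \<le> s" "s + 2 \<le> k" and c: "0 < c"
  shows "\<exists>\<rho>>0. sufficient_gap n k l s c \<rho>"
proof -
  have sk: "s < k" using s by simp
  define a b where "a = k - s" and "b = l - s"
  have ab: "2 \<le> a" "b < a" "b = a - 1 \<or> b = a - 2" "s + a \<le> n"
    and eq: "int k - int s = int a" "int l - int s = int b"
    using l s by (auto simp: a_def b_def)
  obtain \<rho> where \<rho>: "0 < \<rho>" and ineq: "\<And>z w. z \<in> flip_box s n a c \<Longrightarrow> w \<in> unit_directions n \<Longrightarrow>
      \<forall>i\<in>{1..s}. 0 < z i \<Longrightarrow> (\<Sum>i=1..s. z i) \<le> \<rho> \<Longrightarrow>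
      \<forall>i\<in>{s+1..n}. 0 \<le> flip_partial s n (int a) (int b) 1 z i \<Longrightarrow>
      flip_inequality s n (int a) (int b) 1 z w"
    using flip_inequality_comparable[OF s(1) ab(4,2) c ab(1,3)] by blast
  have "gap_inequality n k l s x u"
    if x: "ordered n x" "0 < x k" and cmp: "c * x (s + 1) \<le> x k"
      and gap: "x (s + 1) \<le> \<rho> / real n * x s" for x u
  proof (rule gap_inequality_of_flip_inequality[OF x l(2) s(1) sk zero_less_one l(1), unfolded eq])
    let ?z = "flip_coordinates s n (x (s + 1)) 1 x"
    fix w assume w: "w \<in> unit_directions n" and pos: "\<forall>i\<in>{1..s}. 0 < ?z i"
      and small: "\<forall>i\<in>{s+1..n}. 0 \<le> flip_partial s n (int a) (int b) 1 ?z i"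
    have "?z \<in> flip_box s n a c"
      unfolding a_def using orderedD[OF x(1), of _ "s + 1"] s l
      by (intro flip_coordinates_in_flip_box[OF x l(2) s(1) sk] cmp) auto
    moreover have "(\<Sum>i=1..s. ?z i) \<le> \<rho>"
      using sum_inverse_ratios_le[OF x l(2) s(1) sk gap \<rho>] by (simp add: flip_coordinates_def)
    ultimately show "flip_inequality s n (int a) (int b) 1 ?z w"
      using w pos small by (intro ineq)
  qed
  then have "sufficient_gap n k l s c (\<rho> / real n)" by (simp add: sufficient_gap_def)
  moreover have "0 < \<rho> / real n" using \<rho> l by simp
  ultimately show ?thesis by blast
qed

lemma sufficient_gap_normalized:
  assumes l: "l < k" "k \<le> n" and s: "1 \<le> s" "k = s + 1" and \<rho>: "0 < \<rho>"
    and ineq: "\<And>t z w. 0 < t \<Longrightarrow> t \<le> \<rho> \<Longrightarrow> z \<in> normalized_box s n \<Longrightarrow> w \<in> unit_directions n \<Longrightarrow>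
      \<forall>i\<in>{1..s}. 0 < z i \<Longrightarrow> \<forall>i\<in>{s+1..n}. 0 \<le> flip_partial s n 1 (int l - int s) t z i \<Longrightarrow>
      flip_inequality s n 1 (int l - int s) t z w"
  shows "\<exists>\<rho>>0. sufficient_gap n k l s c \<rho>"
proof -
  have eq: "int k - int s = 1" and sk: "s < k" using s by auto
  have "gap_inequality n k l s x u"
    if x: "ordered n x" "0 < x k" and gap: "x (s + 1) \<le> \<rho> / real n * x s" for x u
  proof -
    define t where "t = (\<Sum>i=1..s. x (s + 1) / x i)"
    note normalized = flip_coordinates_in_normalized_box[OF x l(2) s, unfolded s(2), folded t_def]
    have "t \<le> \<rho>"
      unfolding t_def by (rule sum_inverse_ratios_le[OF x l(2) s(1) sk gap \<rho>])
    then show ?thesis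
      using normalized
      by (intro gap_inequality_of_flip_inequality[OF x l(2) s(1) sk _ l(1), where t = t, unfolded eq] ineq)
  qed
  then have "sufficient_gap n k l s c (\<rho> / real n)" by (simp add: sufficient_gap_def)
  moreover have "0 < \<rho> / real n" using \<rho> l by simp
  ultimately show ?thesis by blast
qed

lemma ex_sufficient_gap:
  assumes l: "l < k" "k \<le> n" "k - l \<in> {1, 2}" and s: "1 \<le> s" "s < k" and c: "0 < c"
  shows "\<exists>\<rho>>0. \<rho> < 1 \<and> sufficient_gap n k l s c \<rho>"
proof -
  consider "s + 2 \<le> k" | "k = s + 1" "l = s" | "k = s + 1" "int l - int s = - 1"
    using l s by force
  then have "\<exists>\<rho>>0. sufficient_gap n k l s c \<rho>"
  proof cases
    case 1
    then show ?thesis using sufficient_gap_comparable l s(1) c by blast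
  next
    case 2
    then show ?thesis
      using flip_inequality_degree_one[of s n] s l sufficient_gap_normalized[of l k n s] by auto
  next
    case 3
    then show ?thesis
      using flip_inequality_straddling[of s n] s l sufficient_gap_normalized[of l k n s] by auto
  qed
  then obtain \<rho> where \<rho>: "0 < \<rho>" "sufficient_gap n k l s c \<rho>" by blast
  have "sufficient_gap n k l s c (min \<rho> (1 / 2))"
    unfolding sufficient_gap_def
  proof (intro allI impI)
    fix x u assume x: "ordered n x" "0 < x k" "c * x (s + 1) \<le> x k"
      and gap: "x (s + 1) \<le> min \<rho> (1 / 2) * x s"
    have "min \<rho> (1 / 2) * x s \<le> \<rho> * x s"
      using ordered_nonneg[OF x(1), of s] s l by (intro mult_right_mono) auto
    then show "gap_inequality n k l s x u"
      using \<rho>(2) x gap unfolding sufficient_gap_def by force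
  qed
  then show ?thesis using \<rho>(1) by (intro exI[of _ "min \<rho> (1 / 2)"]) auto
qed

definition ex_gap_inequality :: "nat \<Rightarrow> nat \<Rightarrow> nat \<Rightarrow> (nat \<Rightarrow> real) \<Rightarrow> (nat \<Rightarrow> real) \<Rightarrow> bool" where
  "ex_gap_inequality n k l x u \<longleftrightarrow> (\<exists>s\<ge>1. x (s + 1) < x s \<and> gap_inequality n k l s x u)"

lemma gap_or_comparable:
  assumes l: "l < k" "k \<le> n" "k - l \<in> {1, 2}" and "j < k"
  shows "\<exists>c>0. \<forall>x u. ordered n x \<longrightarrow> 0 < x k \<longrightarrow>
    c * x (k - j) \<le> x k \<or> ex_gap_inequality n k l x u"
  using \<open>j < k\<close>
proof (induction j)
  case 0
  show ?case by (rule exI[of _ 1]) simp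
next
  case (Suc j)
  define s where "s = k - Suc j"
  have s: "1 \<le> s" "s < k" "k - j = s + 1" using Suc.prems by (auto simp: s_def)
  from Suc obtain c where c: "0 < c" and IH: "\<And>x u. ordered n x \<Longrightarrow> 0 < x k \<Longrightarrow>
    c * x (s + 1) \<le> x k \<or> ex_gap_inequality n k l x u"
    unfolding s(3) by auto
  obtain \<rho> where \<rho>: "0 < \<rho>" "\<rho> < 1" "sufficient_gap n k l s c \<rho>"
    using ex_sufficient_gap[OF l s(1,2) c] by blast
  show ?case
  proof (intro exI[of _ "c * \<rho>"] conjI allI impI)
    show "0 < c * \<rho>" using c \<rho> by simp
    fix x u assume x: "ordered n x" "0 < x k"
    have xs: "0 < x s" using x orderedD[of n x s k] s l by simp
    consider "c * x (s + 1) \<le> x k" "x (s + 1) \<le> \<rho> * x s" | "c * x (s + 1) \<le> x k" "\<rho> * x s \<le> x (s + 1)"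
      | "\<not> c * x (s + 1) \<le> x k" by linarith
    then show "c * \<rho> * x (k - Suc j) \<le> x k \<or> ex_gap_inequality n k l x u"
    proof cases
      case 1
      then have "gap_inequality n k l s x u" using \<rho>(3) x unfolding sufficient_gap_def by blast
      moreover have "\<rho> * x s < 1 * x s" using \<rho>(2) xs by (rule mult_strict_right_mono)
      then have "x (s + 1) < x s" using 1(2) by simp
      ultimately show ?thesis using s(1) unfolding ex_gap_inequality_def by blast
    next
      case 2
      then have "c * (\<rho> * x s) \<le> c * x (s + 1)" using c by (intro mult_left_mono) auto
      then show ?thesis using 2(1) by (simp add: s_def mult.assoc)
    next
      case 3
      then show ?thesis using IH[OF x, of u] by blast
    qed
  qed
qed

lemma ordered_es_pos_imp:
  assumes x: "ordered n x" and k: "1 \<le> k" "k \<le> n" and pos: "0 < es {1..n} (int k) x"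
  shows "0 < x k"
proof (rule ccontr)
  assume "\<not> 0 < x k"
  then have zero: "x i = 0" if "i \<in> {k..n}" for i
    using orderedD[OF x k(1), of i] ordered_nonneg[OF x, of i] that k by auto
  have "(\<Prod>i\<in>S. x i) = 0" if S: "S \<subseteq> {1..n}" "card S = k" for S
  proof -
    have "\<not> S \<subseteq> {1..k - 1}" using card_mono[of "{1..k - 1}" S] S(2) k(1) by auto
    then obtain i where i: "i \<in> S" "k \<le> i" using S(1) by fastforce
    then have "x i = 0" using S(1) by (intro zero) auto
    then show ?thesis using i(1) finite_subset[OF S(1)] by (auto simp: prod_zero_iff)
  qed
  then have "es {1..n} (int k) x = 0" unfolding es_def by (intro sum.neutral) auto
  then show False using pos by simp
qed

lemma comparable_sigma_quot_ge:
  assumes x: "ordered n x" "0 < x k" and k: "l < k" "k \<le> n" and c: "0 < c" "c * x 1 \<le> x k"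
  shows "c ^ k / 2 ^ n * x 1 ^ (k - l) \<le> sigma_quot n k l x"
proof -
  have x1: "0 < x 1" using x orderedD[of n x 1 k] k by simp
  have "(c * x 1) ^ k \<le> es {1..n} (int k) x"
  proof (rule es_ge_power[where J = "{1..k}"])
    fix i assume "i \<in> {1..k}"
    then show "c * x 1 \<le> x i" using orderedD[OF x(1), of i k] c k by simp
  qed (use k c x1 ordered_nonneg[OF x(1)] in auto)
  moreover have "es {1..n} (int l) x \<le> 2 ^ card {1..n} * x 1 ^ l"
    using ordered_nonneg[OF x(1)] orderedD[OF x(1), of 1] x1 by (intro es_le_power) auto
  moreover have "0 < es {1..n} (int l) x" using ordered_es_pos[OF x] k by simp
  ultimately have "(c * x 1) ^ k / (2 ^ n * x 1 ^ l) \<le> es {1..n} (int k) x / es {1..n} (int l) x"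
    using c x1 es_nonneg[of "{1..n}" x "int k"] ordered_nonneg[OF x(1)] by (intro frac_le) auto
  moreover have "(c * x 1) ^ k / (2 ^ n * x 1 ^ l) = c ^ k / 2 ^ n * x 1 ^ (k - l)"
    using x1 k by (simp add: power_mult_distrib power_diff)
  ultimately show ?thesis by (simp add: sigma_quot_def esym_eq_es)
qed

lemma less_powr_if_power_le:
  fixes y \<kappa> A F :: real
  assumes "0 < y" "0 < \<kappa>" "0 < d" "\<kappa> * y ^ d \<le> F" "2 / \<kappa> powr (1 / real d) \<le> A"
  shows "y < A * F powr (1 / real d)"
proof -
  have "\<kappa> powr (1 / real d) * y = (\<kappa> * y ^ d) powr (1 / real d)"
    using assms by (simp add: powr_mult powr_powr flip: powr_realpow)
  also have "\<dots> \<le> F powr (1 / real d)" using assms by (intro powr_mono2) auto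
  finally have root: "\<kappa> powr (1 / real d) * y \<le> F powr (1 / real d)" .
  have "2 * y = 2 / \<kappa> powr (1 / real d) * (\<kappa> powr (1 / real d) * y)" using assms by simp
  also have "\<dots> \<le> A * F powr (1 / real d)"
    using root assms by (intro mult_mono) (auto intro: order_trans[OF _ assms(5)])
  finally show ?thesis using assms(1) by linarith
qed

lemma gap_inequality_of_large_maximum:
  assumes l: "l < k" "k \<le> n" "k - l \<in> {1, 2}"
  shows "\<exists>A\<ge>2. \<forall>x u. ordered n x \<longrightarrow> 0 < x k \<longrightarrow> A * sigma_quot n k l x powr (1 / real (k - l)) \<le> x 1 \<longrightarrow>
    ex_gap_inequality n k l x u"
proof -
  have k: "0 < k" "k - (k - 1) = 1" "0 < k - l" using l by auto
  obtain c where c: "0 < c" and alt: "\<And>x u. ordered n x \<Longrightarrow> 0 < x k \<Longrightarrow>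
      c * x 1 \<le> x k \<or> ex_gap_inequality n k l x u"
    using gap_or_comparable[OF l, of "k - 1"] unfolding k(2) using k(1) by auto
  define \<kappa> A where "\<kappa> = c ^ k / 2 ^ n" and "A = max 2 (2 / \<kappa> powr (1 / real (k - l)))"
  have \<kappa>: "0 < \<kappa>" using c by (simp add: \<kappa>_def)
  show ?thesis
  proof (intro exI[of _ A] conjI allI impI)
    fix x u assume x: "ordered n x" "0 < x k"
      and large: "A * sigma_quot n k l x powr (1 / real (k - l)) \<le> x 1"
    have "\<not> c * x 1 \<le> x k"
    proof
      assume "c * x 1 \<le> x k"
      then have "\<kappa> * x 1 ^ (k - l) \<le> sigma_quot n k l x"
        unfolding \<kappa>_def by (rule comparable_sigma_quot_ge[OF x l(1,2) c])
      moreover have "0 < x 1" using x orderedD[of n x 1 k] l by simp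
      ultimately have "x 1 < A * sigma_quot n k l x powr (1 / real (k - l))"
        using \<kappa> k(3) by (intro less_powr_if_power_le[of _ \<kappa>]) (auto simp: A_def)
      then show False using large by simp
    qed
    then show "ex_gap_inequality n k l x u" using alt[OF x, of u] by blast
  qed (simp add: A_def)
qed

lemma ordered_of_multiplicity:
  assumes m: "1 \<le> m" "m \<le> n" and top: "\<forall>i\<in>{1..m}. x i = y" and below: "m < n \<longrightarrow> x (m + 1) < y"
    and dec: "\<forall>i\<in>{m+1..<n}. x (i + 1) \<le> x i" and "0 \<le> x n"
  shows "ordered n x"
proof -
  have step: "x (Suc i) \<le> x i" if "1 \<le> i" "i < n" for i
  proof -
    consider "i < m" | "i = m" | "m < i" by linarith
    then show ?thesis using that m top below dec by cases (auto simp: less_imp_le)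
  qed
  have "x j \<le> x i" if "i \<le> j" "1 \<le> i" "j \<le> n" for i j
    using that by (induction j rule: dec_induct) (auto intro: order_trans[OF step])
  then show ?thesis using \<open>0 \<le> x n\<close> by (auto simp: ordered_def)
qed

lemma multiplicity_le_gap:
  fixes x :: "nat \<Rightarrow> real"
  assumes "\<forall>i\<in>{1..m}. x i = y" "1 \<le> s" "x (s + 1) < x s"
  shows "m \<le> s"
proof (rule ccontr)
  assume "\<not> m \<le> s"
  then have "x s = y" "x (s + 1) = y" using assms(1,2) by auto
  then show False using assms(3) by simp
qed

lemma concavity_inequality_of_gap_inequality:
  fixes x u :: "nat \<Rightarrow> real"
  assumes x: "ordered n x" "0 < x k" and l: "l < k" "k \<le> n" and m: "m \<le> s"
    and below: "\<And>i. i \<in> {m+1..n} \<Longrightarrow> x i < x 1" and gap: "gap_inequality n k l s x u" and \<delta>: "\<delta> < 1 / 2"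
  defines "F \<equiv> sigma_quot n k l"
  shows "(1 + \<delta>) * (pderiv1 1 F x * (u 1)\<^sup>2 / x 1)
    \<le> - (\<Sum>i=1..n. \<Sum>j=1..n. pderiv2 i j F x * u i * u j)
      + 16 / F x * (\<Sum>i=1..n. pderiv1 i F x * u i)\<^sup>2
      + (\<Sum>i=m+1..n. 2 * pderiv1 i F x * (u i)\<^sup>2 / (x 1 - x i))"
proof -
  have "0 < es {1..n} (int l) x" using ordered_es_pos[OF x] l by simp
  then have F: "0 \<le> pderiv1 i F x" if "i \<in> {1..n}" for i
    unfolding F_def by (rule pderiv1_sigma_quot_nonneg[OF _ ordered_nonneg[OF x(1)] l(1) that])
  have x1: "0 < x 1" using x orderedD[of n x 1 k] l by simp
  have "2 * pderiv1 i F x * (u i)\<^sup>2 / x 1 \<le> 2 * pderiv1 i F x * (u i)\<^sup>2 / (x 1 - x i)"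
    if i: "i \<in> {s+1..n}" for i
    using F[of i] below[of i] ordered_nonneg[OF x(1), of i] i m x1 by (intro divide_left_mono) auto
  then have "(\<Sum>i=s+1..n. 2 * pderiv1 i F x * (u i)\<^sup>2 / x 1)
      \<le> (\<Sum>i=s+1..n. 2 * pderiv1 i F x * (u i)\<^sup>2 / (x 1 - x i))"
    by (rule sum_mono)
  also have "\<dots> \<le> (\<Sum>i=m+1..n. 2 * pderiv1 i F x * (u i)\<^sup>2 / (x 1 - x i))"
  proof (rule sum_mono2)
    show "0 \<le> 2 * pderiv1 i F x * (u i)\<^sup>2 / (x 1 - x i)" if "i \<in> {m+1..n} - {s+1..n}" for i
      using F[of i] below[of i] that by (intro divide_nonneg_pos) auto
  qed (use m in auto)
  moreover have "(1 + \<delta>) * (pderiv1 1 F x * (u 1)\<^sup>2 / x 1) \<le> 3 / 2 * (pderiv1 1 F x * (u 1)\<^sup>2 / x 1)"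
    using \<delta> F[of 1] x1 l by (intro mult_right_mono) auto
  ultimately show ?thesis
    using gap unfolding gap_inequality_def Let_def F_def by linarith
qed

theorem theorem1p1:
  fixes n k l :: nat and \<delta> :: real
  assumes "1 \<le> l" and "l < k" and "k \<le> n" and "k - l \<in> {1, 2}"
    and "0 < \<delta>" and "\<delta> < 1 / 2"
  defines "F \<equiv> sigma_quot n k l"
  shows "\<exists>A K :: real. A \<ge> 2 \<and> K \<ge> 1 \<and>
    (\<forall>(m::nat) (lmax::real) (lam::nat \<Rightarrow> real).
      1 \<le> m \<and> m \<le> n \<and>
      (\<forall>i\<in>{1..m}. lam i = lmax) \<and>
      (m < n \<longrightarrow> lmax > lam (m + 1)) \<and>
      (\<forall>i\<in>{m+1..<n}. lam i \<ge> lam (i + 1)) \<and>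
      lam n \<ge> 0 \<and>
      esym n k lam > 0 \<and>
      lmax \<ge> A * F lam powr (1 / real (k - l)) \<longrightarrow>
      (\<forall>\<xi>::nat \<Rightarrow> real. (\<forall>i\<in>{1..m}. \<xi> i = \<xi> 1) \<longrightarrow>
        - (\<Sum>i=1..n. \<Sum>j=1..n. pderiv2 i j F lam * \<xi> i * \<xi> j)
        + K / F lam * (\<Sum>i=1..n. pderiv1 i F lam * \<xi> i)\<^sup>2
        + (\<Sum>i=m+1..n. 2 * pderiv1 i F lam * (\<xi> i)\<^sup>2 / (lmax - lam i))
        \<ge> (1 + \<delta>) * (pderiv1 1 F lam * (\<xi> 1)\<^sup>2 / lmax)))"
proof -
  obtain A where "2 \<le> A" and gap: "\<And>x u. ordered n x \<Longrightarrow> 0 < x k \<Longrightarrow> A * F x powr (1 / real (k - l)) \<le> x 1 \<Longrightarrow>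
      ex_gap_inequality n k l x u"
    using gap_inequality_of_large_maximum[OF assms(2-4)] unfolding F_def by blast
  show ?thesis
  proof (rule exI[of _ A], rule exI[of _ 16], intro conjI allI impI \<open>2 \<le> A\<close>; (elim conjE)?)
    fix m lmax and x \<xi> :: "nat \<Rightarrow> real"
    assume m: "1 \<le> m" "m \<le> n" and top: "\<forall>i\<in>{1..m}. x i = lmax" and below: "m < n \<longrightarrow> lmax > x (m + 1)"
      and "\<forall>i\<in>{m+1..<n}. x i \<ge> x (i + 1)" "x n \<ge> 0" and pos: "esym n k x > 0"
      and large: "lmax \<ge> A * F x powr (1 / real (k - l))"
    then have x: "ordered n x" by (intro ordered_of_multiplicity)
    then have xk: "0 < x k"
      using pos assms(2,3) by (intro ordered_es_pos_imp) (auto simp: esym_eq_es)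
    have x1: "x 1 = lmax" using top m by simp
    obtain s where s: "1 \<le> s" "x (s + 1) < x s" "gap_inequality n k l s x \<xi>"
      using gap[OF x xk] large x1 unfolding ex_gap_inequality_def by blast
    have "x i < x 1" if "i \<in> {m+1..n}" for i
      using that below x1 orderedD[OF x, of "m + 1" i] by force
    then show "(1 + \<delta>) * (pderiv1 1 F x * (\<xi> 1)\<^sup>2 / lmax) \<le>
        - (\<Sum>i=1..n. \<Sum>j=1..n. pderiv2 i j F x * \<xi> i * \<xi> j)
        + 16 / F x * (\<Sum>i=1..n. pderiv1 i F x * \<xi> i)\<^sup>2
        + (\<Sum>i=m+1..n. 2 * pderiv1 i F x * (\<xi> i)\<^sup>2 / (lmax - x i))"
      unfolding F_def x1[symmetric]
      by (intro concavity_inequality_of_gap_inequality[OF x xk assms(2,3)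
          multiplicity_le_gap[OF top s(1,2)]] s(3) assms(6))
  qed simp
qed

end
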